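(* Let $\beta,\gamma\in\mathbb R$, let $\mathcal W$, $\varepsilon_0$ be as in the context, let $0<\varepsilon\le\varepsilon_0$, and let $u$ be the global small-data solution of the context with $\|u(1)\|_\Sigma\le\varepsilon$. Let $\mathcal P_u$ be its cubic-renormalized interaction profile. There is a unique $\mathcal P_{u,+}\in L^2(\mathbb R)\cap C_0(\mathbb R)$ such that $\mathcal P_u(t)\to\mathcal P_{u,+}$ both in $L^2_\zeta$ and uniformly in $\zeta$ as $t\to\infty$. More precisely, for $T\ge1$, $$\|\mathcal P_{u,+}-\mathcal P_u(T)\|_{L^2_\zeta}\le C_{\beta,\mathcal W}\,\varepsilon^5T^{-7/4},\qquad \|\mathcal P_{u,+}-\mathcal P_u(T)\|_{L^\infty_\zeta}\le C_{\beta,\mathcal W}\,\varepsilon^5T^{-3/2}.$$ Its tail satisfies the exact identity $$\mathcal P_{u,+}(\zeta)-\mathcal P_u(T,\zeta)=i\int_T^\infty e^{is\zeta^2}\,\widehat{\mathcal W(\cdot+\gamma s)|u(s)|^4u(s)}(\zeta)\,ds .$$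
   Context: Notation: $\langle x\rangle=(1+x^2)^{1/2}$; $\|\cdot\|_q$ is the $L^q(\mathbb R)$ norm; $C_0(\mathbb R)$ is the space of continuous functions vanishing at infinity; $\Sigma=\{f\in H^1(\mathbb R):xf\in L^2(\mathbb R)\}$ with $\|f\|_\Sigma=\|f\|_{H^1}+\|xf\|_2$; Fourier transform $\widehat f(\zeta)=\int_{\mathbb R}e^{-i\zeta y}f(y)\,dy$. Assumption on $\mathcal W$: $\mathcal W:\mathbb R\to\mathbb R$ is smooth and there exist $p>2$ and constants $C_{\mathcal W,j}>0$ such that $|\partial_x^j\mathcal W(x)|\le C_{\mathcal W,j}\langle x\rangle^{-p-j}$ for all $x\in\mathbb R$ and all integers $j\ge0$. Equation: $i\partial_tu+\partial_y^2u-\beta|u|^2u+\mathcal W(y+\gamma t)|u|^4u=0$, $t\ge1$, $y\in\mathbb R$ (mild solutions). Small-data solution: $\varepsilon_0=\varepsilon_0(\beta,\mathcal W)>0$ is a sufficiently small threshold, independent of $\gamma$, such that whenever $\|u_1\|_\Sigma\le\varepsilon\le\varepsilon_0$ there is a unique global solution $u\in C([1,\infty);\Sigma)\cap C^1([1,\infty);H^{-1})$ with $u(1)=u_1$, and it satisfies $\|u(t)\|_\infty\le C\varepsilon t^{-1/2}$ for all $t\ge1$. Cubic-renormalized interaction profile: for $t\ge1$, $\zeta\in\mathbb R$, $$\mathcal P_u(t,\zeta)=e^{it\zeta^2}\widehat u(t,\zeta)+i\beta\int_1^te^{is\zeta^2}\,\widehat{|u(s)|^2u(s)}(\zeta)\,ds,$$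 where the integral is understood in $L^2_\zeta$ and has a continuous pointwise representative. *)

theory Defs
  imports "HOL-Analysis.Analysis" "HOL-Probability.Essential_Supremum"
begin

text \<open>
  Elements of \<open>L\<^sup>2\<close>, \<open>H\<^sup>1\<close> and \<open>\<Sigma>\<close> are represented by Borel functions; two functions that agree
  almost everywhere represent the same element.
\<close>

definition japanese :: "real \<Rightarrow> real" where
  "japanese x = sqrt (1 + x\<^sup>2)"

definition L2 :: "(real \<Rightarrow> complex) set" where
  "L2 = {f. f \<in> borel_measurable lborel \<and> integrable lborel (\<lambda>x. (norm (f x))\<^sup>2)}"

definition L2_norm :: "(real \<Rightarrow> complex) \<Rightarrow> real" where
  "L2_norm f = sqrt (LINT x|lborel. (norm (f x))\<^sup>2)"

definition Linf_norm :: "(real \<Rightarrow> complex) \<Rightarrow> ereal" where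
  "Linf_norm f = esssup lborel (\<lambda>x. ereal (norm (f x)))"

definition C0 :: "(real \<Rightarrow> complex) set" where
  "C0 = {f. continuous_on UNIV f \<and> (f \<longlongrightarrow> 0) at_infinity}"

definition smooth :: "(real \<Rightarrow> real) \<Rightarrow> bool" where
  "smooth f \<longleftrightarrow> (\<forall>j x. (deriv ^^ j) f field_differentiable at x)"

definition test_function :: "(real \<Rightarrow> real) \<Rightarrow> bool" where
  "test_function \<phi> \<longleftrightarrow> smooth \<phi> \<and> compact (closure {x. \<phi> x \<noteq> 0})"

definition has_weak_derivative :: "(real \<Rightarrow> complex) \<Rightarrow> (real \<Rightarrow> complex) \<Rightarrow> bool" where
  "has_weak_derivative f g \<longleftrightarrow>
     (\<forall>\<phi>. test_function \<phi> \<longrightarrow>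
        (LINT x|lborel. deriv \<phi> x *\<^sub>R f x) = - (LINT x|lborel. \<phi> x *\<^sub>R g x))"

definition H1 :: "(real \<Rightarrow> complex) set" where
  "H1 = {f \<in> L2. \<exists>g\<in>L2. has_weak_derivative f g}"

text \<open>The weak derivative is unique up to null sets, so the choice does not affect any norm.\<close>

definition weak_derivative :: "(real \<Rightarrow> complex) \<Rightarrow> real \<Rightarrow> complex" where
  "weak_derivative f = (SOME g. g \<in> L2 \<and> has_weak_derivative f g)"

definition H1_norm :: "(real \<Rightarrow> complex) \<Rightarrow> real" where
  "H1_norm f = sqrt ((L2_norm f)\<^sup>2 + (L2_norm (weak_derivative f))\<^sup>2)"

definition Sigma_space :: "(real \<Rightarrow> complex) set" where
  "Sigma_space = {f \<in> H1. (\<lambda>x. of_real x * f x) \<in> L2}"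

definition Sigma_norm :: "(real \<Rightarrow> complex) \<Rightarrow> real" where
  "Sigma_norm f = H1_norm f + L2_norm (\<lambda>x. of_real x * f x)"

text \<open>\<open>H\<^sup>-\<^sup>1\<close> is the dual of \<open>H\<^sup>1\<close>, and \<open>L\<^sup>2\<close> embeds by the bilinear pairing.\<close>

definition Hm1 :: "((real \<Rightarrow> complex) \<Rightarrow> complex) set" where
  "Hm1 = {L. (\<forall>\<phi>\<in>H1. \<forall>\<psi>\<in>H1. L (\<lambda>x. \<phi> x + \<psi> x) = L \<phi> + L \<psi>) \<and>
             (\<forall>\<phi>\<in>H1. \<forall>c. L (\<lambda>x. c * \<phi> x) = c * L \<phi>) \<and>
             (\<exists>K. \<forall>\<phi>\<in>H1. norm (L \<phi>) \<le> K * H1_norm \<phi>)}"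

definition Hm1_norm :: "((real \<Rightarrow> complex) \<Rightarrow> complex) \<Rightarrow> real" where
  "Hm1_norm L = Sup {norm (L \<phi>) |\<phi>. \<phi> \<in> H1 \<and> H1_norm \<phi> \<le> 1}"

definition L2_to_Hm1 :: "(real \<Rightarrow> complex) \<Rightarrow> (real \<Rightarrow> complex) \<Rightarrow> complex" where
  "L2_to_Hm1 f = (\<lambda>\<phi>. LINT x|lborel. f x * \<phi> x)"

text \<open>
  The transform is only applied to functions in \<open>\<Sigma>\<close> (or products of such functions with bounded
  functions). These are in \<open>L\<^sup>1\<close>, so that the integral converges absolutely.
\<close>

definition fourier :: "(real \<Rightarrow> complex) \<Rightarrow> real \<Rightarrow> complex" where
  "fourier f \<zeta> = (LINT y|lborel. cis (- (\<zeta> * y)) * f y)"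

text \<open>
  The group generated by \<open>i\<partial>\<^sub>y\<^sup>2\<close>, that is, the Fourier multiplier \<open>exp (- i t \<zeta>\<^sup>2)\<close>. For \<open>f\<close> in \<open>\<Sigma>\<close>
  the transform of \<open>f\<close> is in \<open>L\<^sup>1\<close> because \<open>f\<close> is in \<open>H\<^sup>1\<close>, and the inversion integral below is the
  continuous representative.
\<close>

definition free_propagator :: "real \<Rightarrow> (real \<Rightarrow> complex) \<Rightarrow> real \<Rightarrow> complex" where
  "free_propagator t f y =
     (1 / (2 * pi)) *\<^sub>R (LINT \<zeta>|lborel. cis (\<zeta> * y) * (cis (- (t * \<zeta>\<^sup>2)) * fourier f \<zeta>))"

definition admissible_potential :: "(real \<Rightarrow> real) \<Rightarrow> bool" where
  "admissible_potential W \<longleftrightarrow> smooth W \<and>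
     (\<exists>p>2. \<forall>j. \<exists>c>0. \<forall>x. \<bar>(deriv ^^ j) W x\<bar> \<le> c * japanese x powr (- p - real j))"

definition cubic :: "(real \<Rightarrow> complex) \<Rightarrow> real \<Rightarrow> complex" where
  "cubic f y = of_real ((norm (f y))\<^sup>2) * f y"

definition quintic :: "(real \<Rightarrow> real) \<Rightarrow> real \<Rightarrow> real \<Rightarrow> (real \<Rightarrow> complex) \<Rightarrow> real \<Rightarrow> complex" where
  "quintic W \<gamma> s f y = of_real (W (y + \<gamma> * s) * (norm (f y)) ^ 4) * f y"

text \<open>
  Duhamel's formula for \<open>i\<partial>\<^sub>tu + \<partial>\<^sub>y\<^sup>2u - \<beta>|u|\<^sup>2u + W(y + \<gamma>t)|u|\<^sup>4u = 0\<close> with data at time 1. When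
  \<open>u\<close> is continuous with values in \<open>\<Sigma>\<close>, the integrand is continuous in \<open>(s, y)\<close>, and its integral
  for fixed \<open>y\<close> represents the \<open>L\<^sup>2\<close>-valued integral.
\<close>

definition mild_solution ::
    "real \<Rightarrow> real \<Rightarrow> (real \<Rightarrow> real) \<Rightarrow> (real \<Rightarrow> real \<Rightarrow> complex) \<Rightarrow> bool" where
  "mild_solution \<beta> \<gamma> W u \<longleftrightarrow>
     (\<forall>t\<ge>1. AE y in lborel.
        u t y = free_propagator (t - 1) (u 1) y +
          \<i> * (LINT s:{1..t}|lborel.
                free_propagator (t - s) (\<lambda>x. - of_real \<beta> * cubic (u s) x + quintic W \<gamma> s (u s) x) y))"

definition C_Sigma :: "(real \<Rightarrow> real \<Rightarrow> complex) \<Rightarrow> bool" where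
  "C_Sigma u \<longleftrightarrow> (\<forall>t\<ge>1. u t \<in> Sigma_space) \<and>
     (\<forall>t\<^sub>0\<ge>1. ((\<lambda>t. Sigma_norm (\<lambda>y. u t y - u t\<^sub>0 y)) \<longlongrightarrow> 0) (at t\<^sub>0 within {1..}))"

definition C1_Hm1 :: "(real \<Rightarrow> real \<Rightarrow> complex) \<Rightarrow> bool" where
  "C1_Hm1 u \<longleftrightarrow> (\<exists>v. (\<forall>t\<ge>1. v t \<in> Hm1) \<and>
     (\<forall>t\<^sub>0\<ge>1. ((\<lambda>t. Hm1_norm (\<lambda>\<phi>.
          (L2_to_Hm1 (u t) \<phi> - L2_to_Hm1 (u t\<^sub>0) \<phi>) / of_real (t - t\<^sub>0) - v t\<^sub>0 \<phi>)) \<longlongrightarrow> 0)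
        (at t\<^sub>0 within {1..})) \<and>
     (\<forall>t\<^sub>0\<ge>1. ((\<lambda>t. Hm1_norm (\<lambda>\<phi>. v t \<phi> - v t\<^sub>0 \<phi>)) \<longlongrightarrow> 0) (at t\<^sub>0 within {1..})))"

definition global_solution ::
    "real \<Rightarrow> real \<Rightarrow> (real \<Rightarrow> real) \<Rightarrow> (real \<Rightarrow> real \<Rightarrow> complex) \<Rightarrow> bool" where
  "global_solution \<beta> \<gamma> W u \<longleftrightarrow> C_Sigma u \<and> C1_Hm1 u \<and> mild_solution \<beta> \<gamma> W u"

text \<open>
  The threshold \<open>\<epsilon>\<^sub>0\<close> and the decay constant \<open>C\<close> do not depend on \<open>\<gamma>\<close>.
\<close>

definition small_data_threshold :: "real \<Rightarrow> (real \<Rightarrow> real) \<Rightarrow> real \<Rightarrow> real \<Rightarrow> bool" where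
  "small_data_threshold \<beta> W \<epsilon>\<^sub>0 C \<longleftrightarrow> 0 < \<epsilon>\<^sub>0 \<and> 0 < C \<and>
     (\<forall>\<gamma> \<epsilon> u\<^sub>1. 0 < \<epsilon> \<and> \<epsilon> \<le> \<epsilon>\<^sub>0 \<and> u\<^sub>1 \<in> Sigma_space \<and> Sigma_norm u\<^sub>1 \<le> \<epsilon> \<longrightarrow>
        (\<exists>u. global_solution \<beta> \<gamma> W u \<and> (AE y in lborel. u 1 y = u\<^sub>1 y) \<and>
             (\<forall>t\<ge>1. Linf_norm (u t) \<le> ereal (C * \<epsilon> * t powr (- 1 / 2))) \<and>
             (\<forall>v. global_solution \<beta> \<gamma> W v \<and> (AE y in lborel. v 1 y = u\<^sub>1 y) \<longrightarrow>
                  (\<forall>t\<ge>1. AE y in lborel. v t y = u t y))))"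

text \<open>
  The integrand is continuous in \<open>(s, \<zeta>)\<close>, and the integral for fixed \<open>\<zeta>\<close> is the continuous
  representative of the \<open>L\<^sup>2\<close>-valued integral.
\<close>

definition profile :: "real \<Rightarrow> (real \<Rightarrow> real \<Rightarrow> complex) \<Rightarrow> real \<Rightarrow> real \<Rightarrow> complex" where
  "profile \<beta> u t \<zeta> =
     cis (t * \<zeta>\<^sup>2) * fourier (u t) \<zeta> +
     \<i> * of_real \<beta> * (LINT s:{1..t}|lborel. cis (s * \<zeta>\<^sup>2) * fourier (cubic (u s)) \<zeta>)"

definition L2_tendsto ::
    "(real \<Rightarrow> real \<Rightarrow> complex) \<Rightarrow> (real \<Rightarrow> complex) \<Rightarrow> real filter \<Rightarrow> bool" where
  "L2_tendsto f g F \<longleftrightarrow> (\<forall>\<^sub>F t in F. (\<lambda>x. f t x - g x) \<in> L2) \<and>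
     ((\<lambda>t. L2_norm (\<lambda>x. f t x - g x)) \<longlongrightarrow> 0) F"

definition profile_limit ::
    "real \<Rightarrow> (real \<Rightarrow> real \<Rightarrow> complex) \<Rightarrow> (real \<Rightarrow> complex) \<Rightarrow> bool" where
  "profile_limit \<beta> u P \<longleftrightarrow> P \<in> L2 \<inter> C0 \<and>
     L2_tendsto (profile \<beta> u) P at_top \<and> uniform_limit UNIV (profile \<beta> u) P at_top"

end

theory Submission
  imports Defs "HOL-Probability.Characteristic_Functions" "HOL-Probability.Sinc_Integral"
begin

text \<open>
  On the frequency side Duhamel's formula reads
  \<open>cis (t * \<zeta>\<^sup>2) * fourier (u t) \<zeta> = cis (\<zeta>\<^sup>2) * fourier (u 1) \<zeta> + \<i> * (LINT s:{1..t}|lborel. \<dots>)\<close>, where the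
  integrand is \<open>cis (s * \<zeta>\<^sup>2)\<close> times the transform of the nonlinearity at time \<open>s\<close>. The profile adds the
  cubic contribution back, so that its increments in time are integrals of the quintic contribution
  alone (\<open>profile_eq\<close>).

  The potential has an integrable majorant, so the \<open>L\<^sup>1\<close> norm of the quintic term is at most a constant
  times the fifth power of the supremum of the solution, hence of size \<open>\<epsilon> ^ 5 * s powr (- 5 / 2)\<close>. All
  translates of the majorant have the same integral, so the speed \<open>\<gamma>\<close> does not enter. The transform is bounded by the \<open>L\<^sup>1\<close> norm. Hence
  the integral over \<open>{T..}\<close> converges absolutely and uniformly in \<open>\<zeta>\<close>, at the rate \<open>T powr (- 3 / 2)\<close>, and
  defines the limit together with the identity for its tail. The limit is continuous by dominated
  convergence and vanishes at infinity by the Riemann--Lebesgue lemma.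

  In \<open>L\<^sup>2\<close>, Minkowski's inequality would again give only \<open>T powr (- 3 / 2)\<close>. The better exponent uses the
  oscillation of \<open>cis (s * \<zeta>\<^sup>2)\<close>: the square of the \<open>L\<^sup>2\<close> norm of the tail is a double integral over times
  \<open>s\<close> and \<open>r\<close> of pairings that the dispersive estimate bounds by \<open>\<bar>s - r\<bar> powr (- 1 / 2)\<close> times the two
  \<open>L\<^sup>1\<close> norms, and this double integral is of size \<open>T powr (- 7 / 2)\<close> (\<open>oscillatory_tail_L2\<close>). The kernel in
  the dispersive estimate is a truncated Fresnel integral, bounded uniformly in the truncation.

  It remains to obtain Duhamel's formula at every frequency from the mild equation, which is an
  almost everywhere identity between inverse transforms (\<open>Duhamel_fourier\<close>). Fourier inversion, by
  Gaussian summation, gives this once the transform of the nonlinearity is known to be integrable,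
  with bounds on compact time intervals. For that purpose membership in \<open>H\<^sup>1\<close> is expressed by
  difference quotients: testing the weak derivative with smooth trapezoids bounds the translates of
  the solution in \<open>L\<^sup>2\<close> (\<open>weak_derivative_increment\<close>), the bound passes to the nonlinearity pointwise,
  and Bessel's inequality turns it into a weighted \<open>L\<^sup>2\<close> bound for the transform.
\<close>

section \<open>Tools from integration theory\<close>

lemma borel_measurable_cis [measurable (raw)]:
  "f \<in> borel_measurable M \<Longrightarrow> (\<lambda>x. cis (f x)) \<in> borel_measurable M"
  by (rule measurable_compose[OF _ borel_measurable_continuous_onI[of cis]])
     (auto intro!: continuous_intros)

lemma borel_measurable_cnj [measurable (raw)]:
  "f \<in> borel_measurable M \<Longrightarrow> (\<lambda>x. cnj (f x)) \<in> borel_measurable M"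
  by (rule measurable_compose[OF _ borel_measurable_continuous_onI[of cnj]])
     (auto intro!: continuous_intros)

lemma integrable_cis_mult:
  fixes f :: "'a \<Rightarrow> complex"
  assumes f: "integrable M f" and c[measurable]: "c \<in> borel_measurable M"
  shows "integrable M (\<lambda>x. cis (c x) * f x)"
  by (rule Bochner_Integration.integrable_bound[OF f])
     (use f in \<open>auto simp: norm_mult\<close>)

lemma continuous_on_dominated_integral:
  fixes G :: "'a \<Rightarrow> 'x::metric_space \<Rightarrow> complex"
  assumes meas: "\<And>x. x \<in> S \<Longrightarrow> (\<lambda>s. G s x) \<in> borel_measurable M"
    and bound: "\<And>s x. x \<in> S \<Longrightarrow> norm (G s x) \<le> w s"
    and w: "integrable M w"
    and cont: "\<And>s. continuous_on S (G s)"
  shows "continuous_on S (\<lambda>x. LINT s|M. G s x)"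
proof -
  have "(\<lambda>n. LINT s|M. G s (X n)) \<longlonglongrightarrow> (LINT s|M. G s x)"
    if x: "x \<in> S" and X: "\<forall>n. X n \<in> S" "X \<longlonglongrightarrow> x" for X x
  proof (rule integral_dominated_convergence[OF _ _ w])
    show "AE s in M. (\<lambda>n. G s (X n)) \<longlonglongrightarrow> G s x"
      using continuous_on_tendsto_compose[OF cont X(2) x] X(1) by auto
  qed (use meas bound that in auto)
  then show ?thesis
    by (auto simp: continuous_on_sequentially o_def)
qed

lemma norm_integral_le:
  fixes f :: "'a \<Rightarrow> complex"
  assumes g: "integrable M g" and le: "AE x in M. norm (f x) \<le> g x"
  shows "norm (LINT x|M. f x) \<le> (LINT x|M. g x)"
proof (cases "integrable M f")
  case True
  then show ?thesis
    using g le by (intro order_trans[OF integral_norm_bound] integral_mono_AE) auto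
next
  case False
  have "AE x in M. 0 \<le> g x"
    using le by eventually_elim (rule order_trans[OF norm_ge_zero])
  with False show ?thesis
    by (simp add: not_integrable_integral_eq integral_nonneg_AE)
qed

text \<open>Fatou's lemma, in the form that turns bounds for regularised integrals into integrability.\<close>

lemma integrable_Fatou:
  fixes f :: "nat \<Rightarrow> 'a \<Rightarrow> real"
  assumes f: "\<And>n. integrable M (f n)" and nonneg: "\<And>n x. 0 \<le> f n x"
    and lim: "\<And>x. (\<lambda>n. f n x) \<longlonglongrightarrow> g x"
    and bound: "\<And>n. (LINT x|M. f n x) \<le> B"
  shows "integrable M g" and "(LINT x|M. g x) \<le> B"
proof -
  have [measurable]: "\<And>n. f n \<in> borel_measurable M"
    using f by auto
  have meas[measurable]: "g \<in> borel_measurable M"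
    by (rule borel_measurable_LIMSEQ_metric[OF _ lim]) auto
  have g0: "0 \<le> g x" for x
    by (rule LIMSEQ_le_const[OF lim]) (use nonneg in auto)
  have B0: "0 \<le> B"
    using bound[of 0] integral_nonneg_AE[where M = M and f = "f 0"] nonneg by (meson AE_I2 order_trans)
  have "(\<integral>\<^sup>+x. ennreal (g x) \<partial>M) = (\<integral>\<^sup>+x. liminf (\<lambda>n. ennreal (f n x)) \<partial>M)"
    by (intro nn_integral_cong lim_imp_Liminf[symmetric] tendsto_ennrealI lim) auto
  also have "\<dots> \<le> liminf (\<lambda>n. \<integral>\<^sup>+x. ennreal (f n x) \<partial>M)"
    by (rule nn_integral_liminf) auto
  also have "\<dots> \<le> limsup (\<lambda>n. \<integral>\<^sup>+x. ennreal (f n x) \<partial>M)"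
    by (rule Liminf_le_Limsup) auto
  also have "\<dots> \<le> ennreal B"
  proof (rule Limsup_bounded, rule always_eventually, rule allI)
    show "(\<integral>\<^sup>+x. ennreal (f n x) \<partial>M) \<le> ennreal B" for n
      by (subst nn_integral_eq_integral[OF f]) (use nonneg bound in \<open>auto intro!: ennreal_leI\<close>)
  qed
  finally have *: "(\<integral>\<^sup>+x. ennreal (g x) \<partial>M) \<le> ennreal B" .
  then have "(\<integral>\<^sup>+x. ennreal (g x) \<partial>M) < \<infinity>"
    using ennreal_less_top le_less_trans by (metis infinity_ennreal_def)
  then show int: "integrable M g"
    using g0 by (intro integrableI_nonneg) auto
  show "(LINT x|M. g x) \<le> B"
    using * B0 g0 by (subst (asm) nn_integral_eq_integral[OF int]) auto
qed

lemma integrable_inverse_one_plus_square: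
  "integrable lborel (\<lambda>x::real. 1 / (1 + x\<^sup>2))"
  and integral_inverse_one_plus_square: "(LINT x|lborel. 1 / (1 + x\<^sup>2)) = pi"
  using integrable_inverse_1_plus_square LBINT_inverse_1_plus_square
  by (auto simp: set_integrable_def interval_lebesgue_integral_def set_lebesgue_integral_def
      inverse_eq_divide)

section \<open>The space \<open>L\<^sup>2\<close>\<close>

lemma L2_measurable [dest]: "f \<in> L2 \<Longrightarrow> f \<in> borel_measurable borel"
  by (auto simp: L2_def)

lemma L2_integrable: "f \<in> L2 \<Longrightarrow> integrable lborel (\<lambda>x. (norm (f x))\<^sup>2)"
  by (auto simp: L2_def)

lemma L2_norm_nonneg [simp]: "0 \<le> L2_norm f"
  by (simp add: L2_norm_def)

lemma L2_norm_square: "(L2_norm f)\<^sup>2 = (LINT x|lborel. (norm (f x))\<^sup>2)"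
  by (simp add: L2_norm_def)

lemma norm_add_square_le:
  fixes a b :: complex
  shows "(norm (a + b))\<^sup>2 \<le> 2 * (norm a)\<^sup>2 + 2 * (norm b)\<^sup>2"
proof -
  have "(norm (a + b))\<^sup>2 \<le> (norm a + norm b)\<^sup>2"
    by (intro power_mono norm_triangle_ineq) auto
  also have "\<dots> \<le> 2 * (norm a)\<^sup>2 + 2 * (norm b)\<^sup>2"
    using zero_le_power2[of "norm a - norm b"] by (simp add: power2_eq_square algebra_simps)
  finally show ?thesis .
qed

lemma L2_bound:
  assumes f[measurable]: "f \<in> borel_measurable borel" and g: "integrable lborel g"
    and le: "AE x in lborel. (norm (f x))\<^sup>2 \<le> g x"
  shows "f \<in> L2" and "(LINT x|lborel. (norm (f x))\<^sup>2) \<le> (LINT x|lborel. g x)"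
proof -
  have i: "integrable lborel (\<lambda>x. (norm (f x))\<^sup>2)"
    by (rule Bochner_Integration.integrable_bound[OF g])
       (use le in auto)
  then show "f \<in> L2"
    by (auto simp: L2_def)
  show "(LINT x|lborel. (norm (f x))\<^sup>2) \<le> (LINT x|lborel. g x)"
    using i g le by (rule integral_mono_AE)
qed

lemma L2_add:
  assumes "f \<in> L2" "g \<in> L2"
  shows "(\<lambda>x. f x + g x) \<in> L2"
    and "(LINT x|lborel. (norm (f x + g x))\<^sup>2)
      \<le> 2 * (LINT x|lborel. (norm (f x))\<^sup>2) + 2 * (LINT x|lborel. (norm (g x))\<^sup>2)"
proof -
  note [simp] = L2_integrable[OF assms(1)] L2_integrable[OF assms(2)]
  have m: "(\<lambda>x. f x + g x) \<in> borel_measurable borel"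
    using assms by (intro borel_measurable_add) auto
  have i: "integrable lborel (\<lambda>x. 2 * (norm (f x))\<^sup>2 + 2 * (norm (g x))\<^sup>2)"
    by simp
  note * = L2_bound[OF m i AE_I2[OF norm_add_square_le]]
  show "(\<lambda>x. f x + g x) \<in> L2"
    by (rule *(1))
  show "(LINT x|lborel. (norm (f x + g x))\<^sup>2)
      \<le> 2 * (LINT x|lborel. (norm (f x))\<^sup>2) + 2 * (LINT x|lborel. (norm (g x))\<^sup>2)"
    using *(2) by simp
qed

lemma L2_uminus: "f \<in> L2 \<Longrightarrow> (\<lambda>x. - f x) \<in> L2"
  by (auto simp: L2_def)

lemma L2_mult_left: "f \<in> L2 \<Longrightarrow> (\<lambda>x. c * f x) \<in> L2"
  by (auto simp: L2_def norm_mult power_mult_distrib intro!: borel_measurable_times)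

lemma L2_diff: "f \<in> L2 \<Longrightarrow> g \<in> L2 \<Longrightarrow> (\<lambda>x. f x - g x) \<in> L2"
  using L2_add(1)[OF _ L2_uminus, of f g] by simp

lemma L2_shift:
  assumes "f \<in> L2"
  shows "(\<lambda>x. f (x + h)) \<in> L2"
    and "(LINT x|lborel. (norm (f (x + h)))\<^sup>2) = (LINT x|lborel. (norm (f x))\<^sup>2)"
proof -
  have [measurable]: "f \<in> borel_measurable borel"
    using assms by auto
  show "(\<lambda>x. f (x + h)) \<in> L2"
    using lborel_integrable_real_affine[OF L2_integrable[OF assms], of 1 h]
    by (auto simp: L2_def add.commute)
  show "(LINT x|lborel. (norm (f (x + h)))\<^sup>2) = (LINT x|lborel. (norm (f x))\<^sup>2)"
    using lborel_integral_real_affine[of 1 "\<lambda>x. (norm (f x))\<^sup>2" h] by (simp add: add.commute)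
qed

lemma integral_shift:
  fixes f :: "real \<Rightarrow> 'b::{banach, second_countable_topology}"
  shows "(LINT x|lborel. f (x + h)) = (LINT x|lborel. f x)"
  using lborel_integral_real_affine[of 1 f h] by (simp add: add.commute)

lemma integrable_shift:
  fixes f :: "real \<Rightarrow> 'b::{banach, second_countable_topology}"
  shows "integrable lborel f \<Longrightarrow> integrable lborel (\<lambda>x. f (x + h))"
  using lborel_integrable_real_affine[of f 1 h] by (simp add: add.commute)

text \<open>
  A function in \<open>L\<^sup>2\<close> with an \<open>L\<^sup>2\<close> moment is integrable. The scaling parameter \<open>c\<close> makes the bound
  for the \<open>L\<^sup>1\<close> norm small when the two \<open>L\<^sup>2\<close> norms are.
\<close>

lemma integrable_of_weighted_L2:
  assumes f: "f \<in> L2" and xf: "(\<lambda>x. of_real x * f x) \<in> L2" and c: "c > 0"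
  shows "integrable lborel f"
    and "(LINT x|lborel. norm (f x)) \<le>
      c * pi + ((LINT x|lborel. (norm (f x))\<^sup>2) + (LINT x|lborel. (norm (of_real x * f x))\<^sup>2)) / c"
proof -
  have [measurable]: "f \<in> borel_measurable borel"
    using f by auto
  define G where "G x = c * (1 / (1 + x\<^sup>2))
      + ((norm (f x))\<^sup>2 + (norm (of_real x * f x))\<^sup>2) / c" for x
  have G: "integrable lborel G"
    unfolding G_def
    using integrable_inverse_one_plus_square L2_integrable[OF f] L2_integrable[OF xf]
    by (intro Bochner_Integration.integrable_add integrable_mult_right integrable_divide) auto
  have le: "norm (f x) \<le> G x" for x
  proof -
    define a where "a = 1 + x\<^sup>2"
    have a: "a > 0"
      by (simp add: a_def add_pos_nonneg)
    have s: "(norm (f x))\<^sup>2 + (norm (of_real x * f x))\<^sup>2 = a * (norm (f x))\<^sup>2"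
      by (simp add: a_def norm_mult power_mult_distrib algebra_simps)
    have "0 \<le> (c / a - norm (f x))\<^sup>2 * (a / c)"
      using a c by auto
    also have "\<dots> = c / a + a * (norm (f x))\<^sup>2 / c - 2 * norm (f x)"
      using a c by (simp add: power2_eq_square field_simps)
    finally have "2 * norm (f x) \<le> c / a + a * (norm (f x))\<^sup>2 / c"
      by simp
    then show ?thesis
      using norm_ge_zero[of "f x"] unfolding G_def s a_def[symmetric] by (simp, linarith)
  qed
  show i: "integrable lborel f"
  proof (rule Bochner_Integration.integrable_bound[OF G])
    show "AE x in lborel. norm (f x) \<le> norm (G x)"
      using le by (intro AE_I2) (metis abs_ge_self order_trans real_norm_def)
  qed auto
  have "(LINT x|lborel. norm (f x)) \<le> (LINT x|lborel. G x)"
    by (rule integral_mono) (use i G le in auto)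
  also have "\<dots> = c * pi + ((LINT x|lborel. (norm (f x))\<^sup>2)
      + (LINT x|lborel. (norm (of_real x * f x))\<^sup>2)) / c"
    unfolding G_def
    using integrable_inverse_one_plus_square L2_integrable[OF f] L2_integrable[OF xf]
    by (simp only: Bochner_Integration.integral_add integrable_mult_right integrable_divide
        Bochner_Integration.integrable_add integral_mult_right_zero integral_divide_zero
        integral_inverse_one_plus_square)
  finally show "(LINT x|lborel. norm (f x)) \<le>
      c * pi + ((LINT x|lborel. (norm (f x))\<^sup>2) + (LINT x|lborel. (norm (of_real x * f x))\<^sup>2)) / c" .
qed

section \<open>The Fourier transform of integrable functions\<close>

lemma fourier_integrable:
  "integrable lborel f \<Longrightarrow> integrable lborel (\<lambda>y. cis (- (\<zeta> * y)) * f y)"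
  by (rule integrable_cis_mult) auto

lemma norm_fourier_le:
  assumes "integrable lborel f"
  shows "norm (fourier f \<zeta>) \<le> (LINT y|lborel. norm (f y))"
  unfolding fourier_def
  using integral_norm_bound[of lborel "\<lambda>y. cis (- (\<zeta> * y)) * f y"] by (simp add: norm_mult)

lemma fourier_diff:
  assumes "integrable lborel f" "integrable lborel g"
  shows "fourier (\<lambda>y. f y - g y) \<zeta> = fourier f \<zeta> - fourier g \<zeta>"
  using fourier_integrable[OF assms(1)] fourier_integrable[OF assms(2)]
  by (simp add: fourier_def right_diff_distrib)

lemma fourier_continuous:
  assumes f: "integrable lborel f"
  shows "continuous_on UNIV (fourier f)"
  unfolding fourier_def
proof (rule continuous_on_dominated_integral[where w = "\<lambda>y. norm (f y)"])
  show "continuous_on UNIV (\<lambda>\<zeta>. cis (- (\<zeta> * y)) * f y)" for y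
    by (intro continuous_intros)
qed (use f in \<open>auto simp: norm_mult\<close>)

lemma fourier_measurable:
  "integrable lborel f \<Longrightarrow> fourier f \<in> borel_measurable borel"
  by (intro borel_measurable_continuous_onI fourier_continuous)

text \<open>Fubini for two functions of one variable each, coupled by a unimodular kernel.\<close>

lemma fourier_multiplication_formula:
  assumes m: "integrable lborel m" and f: "integrable lborel f"
  shows "(LINT \<zeta>|lborel. m \<zeta> * fourier f \<zeta>) = (LINT y|lborel. f y * fourier m y)"
proof -
  have [measurable]: "m \<in> borel_measurable borel" "f \<in> borel_measurable borel"
    using m f by auto
  define G where "G \<zeta> y = m \<zeta> * (cis (- (\<zeta> * y)) * f y)" for \<zeta> y
  have G: "integrable (lborel \<Otimes>\<^sub>M lborel) (case_prod G)"
  proof (rule lborel_pair.Fubini_integrable)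
    show "case_prod G \<in> borel_measurable (lborel \<Otimes>\<^sub>M lborel)"
      unfolding G_def by measurable
    show "AE \<zeta> in lborel. integrable lborel (\<lambda>y. case_prod G (\<zeta>, y))"
      unfolding G_def using fourier_integrable[OF f] by auto
    show "integrable lborel (\<lambda>\<zeta>. LINT y|lborel. norm (case_prod G (\<zeta>, y)))"
      unfolding G_def using m by (simp add: norm_mult)
  qed
  have "(LINT \<zeta>|lborel. m \<zeta> * fourier f \<zeta>) = (LINT \<zeta>|lborel. LINT y|lborel. G \<zeta> y)"
    by (simp add: G_def fourier_def)
  also have "\<dots> = (LINT y|lborel. LINT \<zeta>|lborel. G \<zeta> y)"
    by (rule lborel_pair.Fubini_integral[OF G, symmetric])
  also have "\<dots> = (LINT y|lborel. f y * fourier m y)"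
  proof (rule Bochner_Integration.integral_cong)
    fix y
    have "(LINT \<zeta>|lborel. G \<zeta> y) = (LINT \<zeta>|lborel. f y * (cis (- (y * \<zeta>)) * m \<zeta>))"
      by (simp add: G_def mult_ac)
    then show "(LINT \<zeta>|lborel. G \<zeta> y) = f y * fourier m y"
      by (simp add: fourier_def)
  qed simp
  finally show ?thesis .
qed

text \<open>
  A weighted pairing of two transforms on the frequency side is a double integral on the physical
  side whose kernel is the transform of the weight. A Gaussian weight gives Bessel's inequality, and
  a truncated quadratic phase gives the dispersive estimate.
\<close>

lemma fourier_pairing:
  assumes m: "integrable lborel m" and f: "integrable lborel f" and g: "integrable lborel g"
  shows "(LINT \<zeta>|lborel. m \<zeta> * fourier f \<zeta> * cnj (fourier g \<zeta>)) =
    (LINT y|lborel. f y * cnj (LINT z|lborel. g z * fourier (\<lambda>\<zeta>. cnj (m \<zeta>)) (z - y)))"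
proof -
  have [measurable]: "m \<in> borel_measurable borel" "fourier g \<in> borel_measurable borel"
    using m g fourier_measurable by auto
  have m': "integrable lborel (\<lambda>\<zeta>. cnj (m \<zeta>))"
    using m by simp
  have mg: "integrable lborel (\<lambda>\<zeta>. m \<zeta> * cnj (fourier g \<zeta>))"
  proof (rule Bochner_Integration.integrable_bound)
    show "integrable lborel (\<lambda>\<zeta>. norm (m \<zeta>) * (LINT y|lborel. norm (g y)))"
      using m by simp
    show "AE \<zeta> in lborel. norm (m \<zeta> * cnj (fourier g \<zeta>))
        \<le> norm (norm (m \<zeta>) * (LINT y|lborel. norm (g y)))"
      using norm_fourier_le[OF g] by (auto simp: norm_mult intro!: mult_left_mono order_trans[OF norm_fourier_le[OF g]])
  qed auto
  have "(LINT \<zeta>|lborel. m \<zeta> * fourier f \<zeta> * cnj (fourier g \<zeta>))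
      = (LINT \<zeta>|lborel. m \<zeta> * cnj (fourier g \<zeta>) * fourier f \<zeta>)"
    by (simp add: mult_ac)
  also have "\<dots> = (LINT y|lborel. f y * fourier (\<lambda>\<zeta>. m \<zeta> * cnj (fourier g \<zeta>)) y)"
    by (rule fourier_multiplication_formula[OF mg f])
  also have "\<dots> = (LINT y|lborel. f y * cnj (LINT z|lborel. g z * fourier (\<lambda>\<zeta>. cnj (m \<zeta>)) (z - y)))"
  proof (rule Bochner_Integration.integral_cong)
    fix y
    have "fourier (\<lambda>\<zeta>. m \<zeta> * cnj (fourier g \<zeta>)) y
        = (LINT \<zeta>|lborel. cnj (cis (y * \<zeta>) * cnj (m \<zeta>) * fourier g \<zeta>))"
      unfolding fourier_def by (simp add: mult_ac cis_cnj)
    also have "\<dots> = cnj (LINT \<zeta>|lborel. (cis (y * \<zeta>) * cnj (m \<zeta>)) * fourier g \<zeta>)"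
      by (rule Bochner_Integration.integral_cnj)
    also have "(LINT \<zeta>|lborel. (cis (y * \<zeta>) * cnj (m \<zeta>)) * fourier g \<zeta>)
        = (LINT z|lborel. g z * fourier (\<lambda>\<zeta>. cis (y * \<zeta>) * cnj (m \<zeta>)) z)"
      by (rule fourier_multiplication_formula[OF integrable_cis_mult[OF m'] g]) auto
    also have "(\<lambda>z. fourier (\<lambda>\<zeta>. cis (y * \<zeta>) * cnj (m \<zeta>)) z)
        = (\<lambda>z. fourier (\<lambda>\<zeta>. cnj (m \<zeta>)) (z - y))"
    proof
      fix z
      have "cis (- (z * \<zeta>)) * (cis (y * \<zeta>) * cnj (m \<zeta>)) = cis (- ((z - y) * \<zeta>)) * cnj (m \<zeta>)" for \<zeta>
      proof -
        have "- ((z - y) * \<zeta>) = - (z * \<zeta>) + y * \<zeta>"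
          by (simp add: algebra_simps)
        then show ?thesis
          by (simp only: cis_mult[symmetric] mult.assoc)
      qed
      then show "fourier (\<lambda>\<zeta>. cis (y * \<zeta>) * cnj (m \<zeta>)) z = fourier (\<lambda>\<zeta>. cnj (m \<zeta>)) (z - y)"
        by (simp only: fourier_def)
    qed
    finally show "f y * fourier (\<lambda>\<zeta>. m \<zeta> * cnj (fourier g \<zeta>)) y
        = f y * cnj (LINT z|lborel. g z * fourier (\<lambda>\<zeta>. cnj (m \<zeta>)) (z - y))"
      by metis
  qed simp
  finally show ?thesis .
qed

section \<open>Gaussian regularisation\<close>

definition gauss :: "real \<Rightarrow> real \<Rightarrow> complex" where
  "gauss \<sigma> x = of_real (exp (- (\<sigma> * x)\<^sup>2 / 2))"

lemma gauss_density:
  assumes "\<sigma> > 0"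
  shows "gauss \<sigma> x = of_real (sqrt (2 * pi) / \<sigma> * normal_density 0 (1 / \<sigma>) x)"
  using assms by (simp add: gauss_def normal_density_def real_sqrt_divide real_sqrt_mult field_simps
      power_divide power_mult_distrib)

lemma gauss_integrable: "\<sigma> > 0 \<Longrightarrow> integrable lborel (gauss \<sigma>)"
  using gauss_density[of \<sigma>, THEN ext] 
  by (metis (no_types, lifting) ext integrable_mult_right integrable_normal_density integrable_of_real zero_less_divide_1_iff)

lemma fourier_normal_density:
  assumes \<sigma>: "\<sigma> > 0"
  shows "(LINT x|lborel. cis (- (t * x)) * of_real (normal_density 0 \<sigma> x)) = gauss \<sigma> t"
proof -
  have "(LINT x|lborel. cis (- (t * x)) * of_real (normal_density 0 \<sigma> x))
      = \<sigma> *\<^sub>R (LINT x|lborel. cis (- (t * (\<sigma> * x))) * of_real (normal_density 0 \<sigma> (\<sigma> * x)))"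
    using lborel_integral_real_affine[of \<sigma> "\<lambda>x. cis (- (t * x)) * of_real (normal_density 0 \<sigma> x)" 0] \<sigma>
    by simp
  also have "\<dots> = (LINT x|lborel. \<sigma> *\<^sub>R (cis (- (t * (\<sigma> * x))) * of_real (normal_density 0 \<sigma> (\<sigma> * x))))"
    by simp
  also have "\<dots> = (LINT x|lborel. std_normal_density x *\<^sub>R iexp ((- (t * \<sigma>)) * x))"
  proof (rule Bochner_Integration.integral_cong)
    fix x
    have "normal_density 0 \<sigma> (\<sigma> * x) * \<sigma> = std_normal_density x"
      using \<sigma> by (simp add: normal_density_def real_sqrt_mult power_mult_distrib)
    then show "\<sigma> *\<^sub>R (cis (- (t * (\<sigma> * x))) * of_real (normal_density 0 \<sigma> (\<sigma> * x)))
        = std_normal_density x *\<^sub>R iexp ((- (t * \<sigma>)) * x)"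
      by (simp add: scaleR_conv_of_real cis_conv_exp mult_ac flip: of_real_mult)
  qed simp
  also have "\<dots> = char std_normal_distribution (- (t * \<sigma>))"
    unfolding char_def by (subst integral_density) auto
  also have "\<dots> = gauss \<sigma> t"
    by (simp add: char_std_normal_distribution gauss_def mult.commute exp_of_real)
  finally show ?thesis .
qed

lemma fourier_gauss:
  assumes \<sigma>: "\<sigma> > 0"
  shows "fourier (gauss \<sigma>) y = of_real (2 * pi * normal_density 0 \<sigma> y)"
proof -
  have "fourier (gauss \<sigma>) y
      = (LINT x|lborel. of_real (sqrt (2 * pi) / \<sigma>) * (cis (- (y * x)) * of_real (normal_density 0 (1 / \<sigma>) x)))"
    unfolding fourier_def by (rule Bochner_Integration.integral_cong) (auto simp: gauss_density[OF \<sigma>])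
  also have "\<dots> = of_real (sqrt (2 * pi) / \<sigma>) * gauss (1 / \<sigma>) y"
    using \<sigma> by (simp add: fourier_normal_density)
  also have "\<dots> = of_real (2 * pi * normal_density 0 \<sigma> y)"
    using \<sigma> by (simp add: gauss_def normal_density_def power_divide power_mult_distrib real_sqrt_mult
        exp_of_real flip: of_real_mult of_real_divide)
      (simp add: field_simps real_sqrt_mult[symmetric])
  finally show ?thesis .
qed


lemma integral_shifted_normal_density:
  assumes "\<sigma> > 0"
  shows "integrable lborel (\<lambda>z. normal_density 0 \<sigma> (z - y))"
    and "(LINT z|lborel. normal_density 0 \<sigma> (z - y)) = 1"
    and "integrable lborel (\<lambda>y. normal_density 0 \<sigma> (z - y))"
    and "(LINT y|lborel. normal_density 0 \<sigma> (z - y)) = 1"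
proof -
  have "(\<lambda>z. normal_density 0 \<sigma> (z - y)) = normal_density y \<sigma>"
    and "(\<lambda>y. normal_density 0 \<sigma> (z - y)) = normal_density z \<sigma>"
    by (auto simp: normal_density_def power2_commute)
  then show "integrable lborel (\<lambda>z. normal_density 0 \<sigma> (z - y))"
    and "(LINT z|lborel. normal_density 0 \<sigma> (z - y)) = 1"
    and "integrable lborel (\<lambda>y. normal_density 0 \<sigma> (z - y))"
    and "(LINT y|lborel. normal_density 0 \<sigma> (z - y)) = 1"
    using assms by auto
qed

text \<open>
  By the pairing formula the left side is a double integral of \<open>f y * cnj (f z)\<close> against a normal
  density in \<open>z - y\<close>; the arithmetic-geometric mean inequality decouples the two factors, and each of
  the two integrals in the density is one.
\<close>

lemma gauss_Bessel:
  assumes f: "integrable lborel f" and f2: "f \<in> L2" and \<sigma>: "\<sigma> > 0"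
  shows "integrable lborel (\<lambda>\<zeta>. exp (- (\<sigma> * \<zeta>)\<^sup>2 / 2) * (norm (fourier f \<zeta>))\<^sup>2)"
    and "(LINT \<zeta>|lborel. exp (- (\<sigma> * \<zeta>)\<^sup>2 / 2) * (norm (fourier f \<zeta>))\<^sup>2)
      \<le> 2 * pi * (LINT y|lborel. (norm (f y))\<^sup>2)"
proof -
  have [measurable]: "f \<in> borel_measurable borel" "fourier f \<in> borel_measurable borel"
    using f fourier_measurable by auto
  define n where "n = normal_density 0 \<sigma>"
  have [measurable]: "n \<in> borel_measurable borel"
    by (auto simp: n_def)
  have n0: "0 \<le> n x" for x
    by (simp add: n_def)
  have nle: "n x \<le> n 0" for x
    using \<sigma> by (simp add: n_def normal_density_def divide_simps mult_nonneg_nonneg)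
  note nint = integral_shifted_normal_density[OF \<sigma>, folded n_def]
  let ?A = "LINT y|lborel. (norm (f y))\<^sup>2"
  define v where "v y = (LINT z|lborel. (norm (f z))\<^sup>2 * n (z - y))" for y
  have v1: "integrable lborel (\<lambda>z. (norm (f z))\<^sup>2 * n (z - y))" for y
    by (rule Bochner_Integration.integrable_bound[OF integrable_mult_left[OF L2_integrable[OF f2], of "n 0"]])
       (use nle n0 in \<open>auto simp: abs_mult intro!: mult_left_mono\<close>)
  have v2: "integrable lborel (\<lambda>z. norm (f z) * n (z - y))" for y
    by (rule Bochner_Integration.integrable_bound[OF integrable_mult_left[OF integrable_norm[OF f], of "n 0"]])
       (use nle n0 in \<open>auto simp: abs_mult intro!: mult_left_mono\<close>)
  have V: "integrable (lborel \<Otimes>\<^sub>M lborel) (case_prod (\<lambda>z y. (norm (f z))\<^sup>2 * n (z - y)))"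
  proof (rule lborel_pair.Fubini_integrable)
    show "integrable lborel (\<lambda>z. LINT y|lborel. norm (case_prod (\<lambda>z y. (norm (f z))\<^sup>2 * n (z - y)) (z, y)))"
      using L2_integrable[OF f2] nint(4) n0 by (simp add: abs_mult)
    show "AE z in lborel. integrable lborel (\<lambda>y. case_prod (\<lambda>z y. (norm (f z))\<^sup>2 * n (z - y)) (z, y))"
      using nint(3) by auto
  qed measurable
  have v_int: "integrable lborel v"
    unfolding v_def using lborel_pair.integrable_snd[OF V] by simp
  have v_eq: "(LINT y|lborel. v y) = ?A"
    unfolding v_def using lborel_pair.Fubini_integral[OF V] nint(4) by simp
  define J where "J y = f y * cnj (LINT z|lborel. f z * fourier (\<lambda>\<zeta>. cnj (gauss \<sigma> \<zeta>)) (z - y))" for y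
  have Fg: "fourier (\<lambda>\<zeta>. cnj (gauss \<sigma> \<zeta>)) x = of_real (2 * pi * n x)" for x
  proof -
    have "(\<lambda>\<zeta>. cnj (gauss \<sigma> \<zeta>)) = gauss \<sigma>"
      by (simp add: gauss_def fun_eq_iff)
    then show ?thesis
      using fourier_gauss[OF \<sigma>] by (simp add: n_def)
  qed
  have J: "norm (J y) \<le> pi * ((norm (f y))\<^sup>2 + v y)" for y
  proof -
    have "norm (LINT z|lborel. f z * fourier (\<lambda>\<zeta>. cnj (gauss \<sigma> \<zeta>)) (z - y))
        \<le> (LINT z|lborel. norm (f z * fourier (\<lambda>\<zeta>. cnj (gauss \<sigma> \<zeta>)) (z - y)))"
      by (rule integral_norm_bound)
    also have "\<dots> = (LINT z|lborel. (2 * pi) * (norm (f z) * n (z - y)))"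
      unfolding Fg using n0 by (intro Bochner_Integration.integral_cong) (auto simp: norm_mult)
    also have "\<dots> = 2 * pi * (LINT z|lborel. norm (f z) * n (z - y))"
      by simp
    finally have "norm (J y) \<le> norm (f y) * (2 * pi * (LINT z|lborel. norm (f z) * n (z - y)))"
      by (auto simp: J_def norm_mult intro!: mult_left_mono)
    also have "\<dots> = pi * (LINT z|lborel. 2 * norm (f y) * (norm (f z) * n (z - y)))"
      by simp
    also have "\<dots> \<le> pi * (LINT z|lborel. (norm (f y))\<^sup>2 * n (z - y) + (norm (f z))\<^sup>2 * n (z - y))"
    proof (intro mult_left_mono integral_mono)
      fix z
      have "2 * norm (f y) * norm (f z) * n (z - y) \<le> ((norm (f y))\<^sup>2 + (norm (f z))\<^sup>2) * n (z - y)"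
        using sum_squares_bound[of "norm (f y)" "norm (f z)"] n0 by (intro mult_right_mono) auto
      then show "2 * norm (f y) * (norm (f z) * n (z - y))
          \<le> (norm (f y))\<^sup>2 * n (z - y) + (norm (f z))\<^sup>2 * n (z - y)"
        by (simp add: algebra_simps)
    qed (use v1 v2 nint in auto)
    also have "(LINT z|lborel. (norm (f y))\<^sup>2 * n (z - y) + (norm (f z))\<^sup>2 * n (z - y))
        = (norm (f y))\<^sup>2 + v y"
      using v1 nint by (simp add: v_def)
    finally show ?thesis .
  qed
  have Jint: "integrable lborel (\<lambda>y. pi * ((norm (f y))\<^sup>2 + v y))"
    using L2_integrable[OF f2] v_int by simp
  let ?g = "\<lambda>\<zeta>. exp (- (\<sigma> * \<zeta>)\<^sup>2 / 2) * (norm (fourier f \<zeta>))\<^sup>2"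
  have g_eq: "gauss \<sigma> \<zeta> * fourier f \<zeta> * cnj (fourier f \<zeta>) = of_real (?g \<zeta>)" for \<zeta>
    by (simp add: gauss_def mult.assoc complex_norm_square[symmetric] exp_of_real)
  show i: "integrable lborel ?g"
  proof (rule Bochner_Integration.integrable_bound)
    show "integrable lborel (\<lambda>\<zeta>. norm (gauss \<sigma> \<zeta>) * (LINT y|lborel. norm (f y))\<^sup>2)"
      using gauss_integrable[OF \<sigma>] by simp
    show "AE \<zeta> in lborel. norm (?g \<zeta>) \<le> norm (norm (gauss \<sigma> \<zeta>) * (LINT y|lborel. norm (f y))\<^sup>2)"
      using norm_fourier_le[OF f] by (auto simp: gauss_def abs_mult intro!: mult_left_mono power_mono)
  qed auto
  have "(LINT \<zeta>|lborel. ?g \<zeta>) = norm (complex_of_real (LINT \<zeta>|lborel. ?g \<zeta>))"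
    by (simp only: norm_of_real) (intro abs_of_nonneg[symmetric] Bochner_Integration.integral_nonneg, simp)
  also have "complex_of_real (LINT \<zeta>|lborel. ?g \<zeta>)
      = (LINT \<zeta>|lborel. gauss \<sigma> \<zeta> * fourier f \<zeta> * cnj (fourier f \<zeta>))"
    unfolding g_eq by (rule Bochner_Integration.integral_of_real[OF i, symmetric])
  also have "\<dots> = (LINT y|lborel. J y)"
    unfolding J_def by (rule fourier_pairing[OF gauss_integrable[OF \<sigma>] f f])
  also have "norm \<dots> \<le> (LINT y|lborel. pi * ((norm (f y))\<^sup>2 + v y))"
    by (rule norm_integral_le[OF Jint AE_I2[OF J]])
  also have "\<dots> = 2 * pi * ?A"
    using L2_integrable[OF f2] v_int v_eq by simp
  finally show "(LINT \<zeta>|lborel. ?g \<zeta>) \<le> 2 * pi * ?A" .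
qed

lemma LIMSEQ_inverse_Suc: "(\<lambda>n. inverse (real (Suc n))) \<longlonglongrightarrow> 0"
  by (rule LIMSEQ_inverse_real_of_nat)

lemma gauss_tendsto_1: "(\<lambda>n. exp (- (inverse (real (Suc n)) * x)\<^sup>2 / 2)) \<longlonglongrightarrow> 1"
proof -
  have "(\<lambda>n. exp (- (inverse (real (Suc n)) * x)\<^sup>2 / 2)) \<longlonglongrightarrow> exp (- (0 * x)\<^sup>2 / 2)"
    by (intro tendsto_intros LIMSEQ_inverse_Suc) auto
  then show ?thesis by simp
qed

text \<open>
  One half of Plancherel's theorem. The Gaussian bound does not depend on the width, because the normal
  density always has mass one, so the weight can be removed by Fatou's lemma.
\<close>

lemma fourier_Bessel:
  assumes f: "integrable lborel f" and f2: "f \<in> L2"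
  shows "fourier f \<in> L2"
    and "(LINT \<zeta>|lborel. (norm (fourier f \<zeta>))\<^sup>2) \<le> 2 * pi * (LINT y|lborel. (norm (f y))\<^sup>2)"
proof -
  let ?g = "\<lambda>n \<zeta>. exp (- (inverse (real (Suc n)) * \<zeta>)\<^sup>2 / 2) * (norm (fourier f \<zeta>))\<^sup>2"
  have lim: "(\<lambda>n. ?g n \<zeta>) \<longlonglongrightarrow> (norm (fourier f \<zeta>))\<^sup>2" for \<zeta>
    using tendsto_mult[OF gauss_tendsto_1[of \<zeta>] tendsto_const] by simp
  have *: "integrable lborel (?g n)"
    "(LINT \<zeta>|lborel. ?g n \<zeta>) \<le> 2 * pi * (LINT y|lborel. (norm (f y))\<^sup>2)" for n
    using gauss_Bessel[OF f f2, of "inverse (real (Suc n))"] by auto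
  show "fourier f \<in> L2"
    using integrable_Fatou(1)[OF *(1) _ lim *(2)] fourier_measurable[OF f] by (auto simp: L2_def)
  show "(LINT \<zeta>|lborel. (norm (fourier f \<zeta>))\<^sup>2) \<le> 2 * pi * (LINT y|lborel. (norm (f y))\<^sup>2)"
    using integrable_Fatou(2)[OF *(1) _ lim *(2)] by auto
qed

text \<open>
  Gaussian summation of \<open>g\<close>'s transform reproduces averages of \<open>H\<close> against normal densities that
  concentrate at a point, so continuity of \<open>H\<close> gives equality at every point and not just almost
  everywhere.
\<close>

lemma fourier_inversion:
  assumes g: "integrable lborel g" and H: "integrable lborel H"
    and cont: "continuous_on UNIV H" and B: "\<And>\<zeta>. norm (H \<zeta>) \<le> B"
    and eq: "AE y in lborel. g y = (1 / (2 * pi)) *\<^sub>R (LINT \<zeta>|lborel. cis (\<zeta> * y) * H \<zeta>)"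
  shows "fourier g \<zeta>\<^sub>0 = H \<zeta>\<^sub>0"
proof -
  have [measurable]: "g \<in> borel_measurable borel" "H \<in> borel_measurable borel"
      "fourier H \<in> borel_measurable borel"
    using g H fourier_measurable by auto
  have "continuous_on UNIV (gauss \<sigma>)" for \<sigma>
    unfolding gauss_def by (intro continuous_intros) auto
  then have [measurable]: "gauss \<sigma> \<in> borel_measurable borel" for \<sigma>
    by (rule borel_measurable_continuous_onI)
  have key: "(LINT y|lborel. gauss \<sigma> y * (cis (- (\<zeta>\<^sub>0 * y)) * g y))
      = (LINT x|lborel. H (\<zeta>\<^sub>0 + \<sigma> * x) * of_real (std_normal_density x))" if \<sigma>: "\<sigma> > 0" for \<sigma>
  proof -
    define m where "m y = cis (\<zeta>\<^sub>0 * y) * gauss \<sigma> y" for y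
    have m: "integrable lborel m"
      unfolding m_def by (rule integrable_cis_mult[OF gauss_integrable[OF \<sigma>]]) auto
    have [measurable]: "m \<in> borel_measurable borel"
      using m by auto
    have Fm: "fourier m \<zeta> = of_real (2 * pi * normal_density 0 \<sigma> (\<zeta> - \<zeta>\<^sub>0))" for \<zeta>
    proof -
      have "cis (- (\<zeta> * y)) * m y = cis (- ((\<zeta> - \<zeta>\<^sub>0) * y)) * gauss \<sigma> y" for y
      proof -
        have "- ((\<zeta> - \<zeta>\<^sub>0) * y) = - (\<zeta> * y) + \<zeta>\<^sub>0 * y"
          by (simp add: algebra_simps)
        then show ?thesis
          by (simp only: cis_mult[symmetric] mult.assoc m_def)
      qed
      then have "fourier m \<zeta> = fourier (gauss \<sigma>) (\<zeta> - \<zeta>\<^sub>0)"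
        by (simp only: fourier_def)
      then show ?thesis
        using fourier_gauss[OF \<sigma>] by simp
    qed
    have "(LINT y|lborel. gauss \<sigma> y * (cis (- (\<zeta>\<^sub>0 * y)) * g y))
        = (LINT y|lborel. (1 / (2 * pi)) *\<^sub>R (m (- y) * fourier H (- y)))"
    proof (rule integral_cong_AE)
      show "AE y in lborel. gauss \<sigma> y * (cis (- (\<zeta>\<^sub>0 * y)) * g y)
          = (1 / (2 * pi)) *\<^sub>R (m (- y) * fourier H (- y))"
        using eq
      proof eventually_elim
        case (elim y)
        have "fourier H (- y) = (LINT \<zeta>|lborel. cis (\<zeta> * y) * H \<zeta>)"
          by (simp add: fourier_def mult.commute)
        then show ?case
          unfolding elim by (simp add: m_def gauss_def)
      qed
    qed measurable
    also have "\<dots> = (1 / (2 * pi)) *\<^sub>R (LINT y|lborel. m (- y) * fourier H (- y))"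
      by (rule integral_scaleR_right)
    also have "(LINT y|lborel. m (- y) * fourier H (- y)) = (LINT y|lborel. m y * fourier H y)"
      using lborel_integral_real_affine[of "-1" "\<lambda>y. m y * fourier H y" 0] by simp
    also have "\<dots> = (LINT \<zeta>|lborel. H \<zeta> * fourier m \<zeta>)"
      by (rule fourier_multiplication_formula[OF m H])
    also have "\<dots> = \<sigma> *\<^sub>R (LINT x|lborel. H (\<zeta>\<^sub>0 + \<sigma> * x) * fourier m (\<zeta>\<^sub>0 + \<sigma> * x))"
      using lborel_integral_real_affine[of \<sigma> "\<lambda>\<zeta>. H \<zeta> * fourier m \<zeta>" "\<zeta>\<^sub>0"] \<sigma> by simp
    also have "(1 / (2 * pi)) *\<^sub>R \<dots>
        = (LINT x|lborel. (1 / (2 * pi)) *\<^sub>R \<sigma> *\<^sub>R (H (\<zeta>\<^sub>0 + \<sigma> * x) * fourier m (\<zeta>\<^sub>0 + \<sigma> * x)))"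
      by (simp only: integral_scaleR_right)
    also have "\<dots> = (LINT x|lborel. H (\<zeta>\<^sub>0 + \<sigma> * x) * of_real (std_normal_density x))"
    proof (rule Bochner_Integration.integral_cong)
      fix x
      have "normal_density 0 \<sigma> (\<sigma> * x) * \<sigma> = std_normal_density x"
        using \<sigma> by (simp add: normal_density_def real_sqrt_mult power_mult_distrib)
      then have "complex_of_real (normal_density 0 \<sigma> (\<sigma> * x)) * of_real \<sigma> = of_real (std_normal_density x)"
        by (metis of_real_mult)
      then show "(1 / (2 * pi)) *\<^sub>R \<sigma> *\<^sub>R (H (\<zeta>\<^sub>0 + \<sigma> * x) * fourier m (\<zeta>\<^sub>0 + \<sigma> * x))
          = H (\<zeta>\<^sub>0 + \<sigma> * x) * of_real (std_normal_density x)"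
        by (simp add: Fm scaleR_conv_of_real field_simps)
    qed simp
    finally show ?thesis .
  qed
  define \<sigma> where "\<sigma> n = inverse (real (Suc n))" for n
  have \<sigma>: "\<sigma> n > 0" for n
    by (simp add: \<sigma>_def)
  have gauss_le: "norm (gauss s y) \<le> 1" for s y
    by (simp add: gauss_def)
  have "(\<lambda>n. LINT y|lborel. gauss (\<sigma> n) y * (cis (- (\<zeta>\<^sub>0 * y)) * g y)) \<longlonglongrightarrow> fourier g \<zeta>\<^sub>0"
    unfolding fourier_def
  proof (rule integral_dominated_convergence[where w = "\<lambda>y. norm (g y)"])
    have "(\<lambda>n. gauss (\<sigma> n) y * (cis (- (\<zeta>\<^sub>0 * y)) * g y)) \<longlonglongrightarrow> of_real 1 * (cis (- (\<zeta>\<^sub>0 * y)) * g y)" for y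
      unfolding gauss_def \<sigma>_def by (intro tendsto_mult tendsto_of_real gauss_tendsto_1 tendsto_const)
    then show "AE y in lborel. (\<lambda>n. gauss (\<sigma> n) y * (cis (- (\<zeta>\<^sub>0 * y)) * g y))
        \<longlonglongrightarrow> cis (- (\<zeta>\<^sub>0 * y)) * g y"
      by simp
    show "AE y in lborel. norm (gauss (\<sigma> n) y * (cis (- (\<zeta>\<^sub>0 * y)) * g y)) \<le> norm (g y)" for n
      using gauss_le by (auto simp: norm_mult intro!: mult_left_le_one_le)
  qed (use g in auto)
  moreover have "(\<lambda>n. LINT x|lborel. H (\<zeta>\<^sub>0 + \<sigma> n * x) * of_real (std_normal_density x))
      \<longlonglongrightarrow> (LINT x|lborel. H \<zeta>\<^sub>0 * complex_of_real (std_normal_density x))"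
  proof (rule integral_dominated_convergence[where w = "\<lambda>x. B * std_normal_density x"])
    have "(\<lambda>n. H (\<zeta>\<^sub>0 + \<sigma> n * x)) \<longlonglongrightarrow> H \<zeta>\<^sub>0" for x
    proof (rule continuous_on_tendsto_compose[OF cont])
      have "(\<lambda>n. \<zeta>\<^sub>0 + \<sigma> n * x) \<longlonglongrightarrow> \<zeta>\<^sub>0 + 0 * x"
        unfolding \<sigma>_def by (intro tendsto_intros LIMSEQ_inverse_Suc)
      then show "(\<lambda>n. \<zeta>\<^sub>0 + \<sigma> n * x) \<longlonglongrightarrow> \<zeta>\<^sub>0" by simp
    qed auto
    then show "AE x in lborel. (\<lambda>n. H (\<zeta>\<^sub>0 + \<sigma> n * x) * of_real (std_normal_density x))
        \<longlonglongrightarrow> H \<zeta>\<^sub>0 * of_real (std_normal_density x)"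
      by (intro AE_I2 tendsto_intros)
    show "AE x in lborel. norm (H (\<zeta>\<^sub>0 + \<sigma> n * x) * of_real (std_normal_density x))
        \<le> B * std_normal_density x" for n
      using B by (auto simp: norm_mult intro!: mult_right_mono)
  qed auto
  moreover have "(LINT x|lborel. H \<zeta>\<^sub>0 * complex_of_real (std_normal_density x)) = H \<zeta>\<^sub>0"
    by (simp only: integral_mult_right_zero Bochner_Integration.integral_of_real integral_normal_density) simp
  ultimately show ?thesis
    using key[OF \<sigma>] by (simp add: LIMSEQ_unique)
qed

lemma fourier_shift:
  "fourier (\<lambda>y. f (y + h)) \<zeta> = cis (\<zeta> * h) * fourier f \<zeta>"
proof -
  have "fourier (\<lambda>y. f (y + h)) \<zeta>
      = (LINT y|lborel. (\<lambda>z. cis (- (\<zeta> * (z - h))) * f z) (y + h))"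
    by (simp add: fourier_def)
  also have "\<dots> = (LINT z|lborel. cis (- (\<zeta> * (z - h))) * f z)"
    by (rule integral_shift)
  also have "\<dots> = (LINT z|lborel. cis (\<zeta> * h) * (cis (- (\<zeta> * z)) * f z))"
    by (intro Bochner_Integration.integral_cong refl)
       (simp add: mult.assoc[symmetric] cis_mult right_diff_distrib)
  finally show ?thesis
    by (simp add: fourier_def)
qed

section \<open>Functions that are Lipschitz under translation in \<open>L\<^sup>2\<close>\<close>

text \<open>
  These functions form \<open>H\<^sup>1\<close>. Difference quotients replace the weak derivative here because a bound for
  them passes through a Lipschitz nonlinearity pointwise.
\<close>

definition L2_Lipschitz :: "real \<Rightarrow> (real \<Rightarrow> complex) \<Rightarrow> bool" where
  "L2_Lipschitz K f \<longleftrightarrow> f \<in> L2 \<and> (\<forall>h. (LINT x|lborel. (norm (f (x + h) - f x))\<^sup>2) \<le> K * h\<^sup>2)"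

lemma norm_cis_minus_1_square: "(norm (cis t - 1))\<^sup>2 = (2 * sin (t / 2))\<^sup>2"
proof -
  have "(norm (cis t - 1))\<^sup>2 = (cos t - 1)\<^sup>2 + (sin t)\<^sup>2"
    by (simp add: cmod_power2)
  also have "\<dots> = 2 - 2 * cos t"
    using sin_cos_squared_add[of t] by (simp add: power2_eq_square algebra_simps)
  also have "\<dots> = (2 * sin (t / 2))\<^sup>2"
    using cos_double_sin[of "t / 2"] by (simp add: power2_eq_square)
  finally show ?thesis .
qed

lemma difference_quotient_cis_tendsto:
  "(\<lambda>n. (norm (cis (\<zeta> * inverse (real (Suc n))) - 1))\<^sup>2 / (inverse (real (Suc n)))\<^sup>2) \<longlonglongrightarrow> \<zeta>\<^sup>2"
proof -
  have "((\<lambda>h. 2 * sin (\<zeta> * h / 2)) has_field_derivative \<zeta>) (at 0)"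
    by (auto intro!: derivative_eq_intros)
  then have "((\<lambda>h. (2 * sin (\<zeta> * h / 2)) / h) \<longlongrightarrow> \<zeta>) (at 0)"
    by (simp add: DERIV_def)
  then have "(\<lambda>n. (2 * sin (\<zeta> * inverse (real (Suc n)) / 2)) / inverse (real (Suc n))) \<longlonglongrightarrow> \<zeta>"
    by (rule filterlim_compose) (auto simp: filterlim_at LIMSEQ_inverse_Suc simp del: of_nat_Suc)
  from tendsto_power[OF this, of 2] show ?thesis
    by (simp only: norm_cis_minus_1_square power_divide)
qed

text \<open>
  Bessel's inequality for the difference quotients bounds \<open>\<zeta> * fourier f \<zeta>\<close> in \<open>L\<^sup>2\<close>, and
  \<open>1 / (1 + \<zeta>\<^sup>2)\<close> is integrable.
\<close>

lemma fourier_integrable_of_L2_Lipschitz: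
  assumes f: "integrable lborel f" and lip: "L2_Lipschitz K f"
  shows "integrable lborel (fourier f)"
    and "(LINT \<zeta>|lborel. norm (fourier f \<zeta>)) \<le> pi + 2 * pi * ((LINT y|lborel. (norm (f y))\<^sup>2) + K)"
proof -
  have f2: "f \<in> L2"
    using lip by (auto simp: L2_Lipschitz_def)
  have m[measurable]: "fourier f \<in> borel_measurable borel"
    using f fourier_measurable by auto
  define h where "h n = inverse (real (Suc n))" for n
  have h: "h n > 0" for n
    by (simp add: h_def)
  let ?g = "\<lambda>n \<zeta>. (norm (cis (\<zeta> * h n) - 1))\<^sup>2 / (h n)\<^sup>2 * (norm (fourier f \<zeta>))\<^sup>2"
  have D: "integrable lborel (?g n) \<and> (LINT \<zeta>|lborel. ?g n \<zeta>) \<le> 2 * pi * K" for n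
  proof -
    let ?D = "\<lambda>y. f (y + h n) - f y"
    have Di: "integrable lborel ?D"
      using f integrable_shift[OF f] by auto
    have D2: "?D \<in> L2"
      using L2_shift(1)[OF f2] f2 by (rule L2_diff)
    have FD: "fourier ?D \<zeta> = (cis (\<zeta> * h n) - 1) * fourier f \<zeta>" for \<zeta>
      using fourier_diff[OF integrable_shift[OF f, of "h n"] f, of \<zeta>]
      by (simp add: fourier_shift algebra_simps)
    have geq: "?g n \<zeta> = (norm (fourier ?D \<zeta>))\<^sup>2 / (h n)\<^sup>2" for \<zeta>
      by (simp add: FD norm_mult power_mult_distrib)
    have "(LINT \<zeta>|lborel. (norm (fourier ?D \<zeta>))\<^sup>2) \<le> 2 * pi * (LINT y|lborel. (norm (?D y))\<^sup>2)"
      by (rule fourier_Bessel(2)[OF Di D2])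
    also have "\<dots> \<le> 2 * pi * (K * (h n)\<^sup>2)"
      using lip by (auto simp: L2_Lipschitz_def)
    finally show ?thesis
      using h[of n] L2_integrable[OF fourier_Bessel(1)[OF Di D2]]
      unfolding geq by (simp add: field_simps)
  qed
  have lim: "(\<lambda>n. ?g n \<zeta>) \<longlonglongrightarrow> \<zeta>\<^sup>2 * (norm (fourier f \<zeta>))\<^sup>2" for \<zeta>
    unfolding h_def by (intro tendsto_mult tendsto_const difference_quotient_cis_tendsto)
  have M: "integrable lborel (\<lambda>\<zeta>. \<zeta>\<^sup>2 * (norm (fourier f \<zeta>))\<^sup>2)"
    "(LINT \<zeta>|lborel. \<zeta>\<^sup>2 * (norm (fourier f \<zeta>))\<^sup>2) \<le> 2 * pi * K"
    using integrable_Fatou[of lborel ?g, OF _ _ lim, of "2 * pi * K"] D by auto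
  have eq: "(norm (of_real \<zeta> * fourier f \<zeta>))\<^sup>2 = \<zeta>\<^sup>2 * (norm (fourier f \<zeta>))\<^sup>2" for \<zeta>
    by (simp add: norm_mult power_mult_distrib)
  have "(\<lambda>\<zeta>. of_real \<zeta> * fourier f \<zeta>) \<in> L2"
    using M(1) unfolding L2_def by (simp add: eq)
  note * = integrable_of_weighted_L2[OF fourier_Bessel(1)[OF f f2] this, of 1]
  show "integrable lborel (fourier f)"
    by (rule *(1)) simp
  show "(LINT \<zeta>|lborel. norm (fourier f \<zeta>)) \<le> pi + 2 * pi * ((LINT y|lborel. (norm (f y))\<^sup>2) + K)"
    using *(2) M(2) fourier_Bessel(2)[OF f f2] unfolding eq by (simp add: distrib_left)
qed

section \<open>Smooth functions and test functions\<close>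

lemma smooth_coinduct:
  assumes "f \<in> S" and "\<And>s x. s \<in> S \<Longrightarrow> s field_differentiable at x"
    and "\<And>s. s \<in> S \<Longrightarrow> deriv s \<in> S"
  shows "smooth f"
proof -
  have "(deriv ^^ j) f \<in> S" for j
    by (induction j) (use assms in auto)
  then show ?thesis
    using assms(2) by (auto simp: smooth_def)
qed

lemma smooth_differentiable: "smooth f \<Longrightarrow> f field_differentiable at x"
  unfolding smooth_def by (metis funpow_0)

lemma smooth_DERIV: "smooth f \<Longrightarrow> (f has_field_derivative deriv f x) (at x)"
  using smooth_differentiable field_differentiable_derivI by blast

lemma smooth_deriv: "smooth f \<Longrightarrow> smooth (deriv f)"
  unfolding smooth_def by (metis comp_apply funpow_Suc_right)

lemma smooth_isCont: "smooth f \<Longrightarrow> isCont f x"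
  using smooth_DERIV DERIV_isCont by blast

lemma smooth_continuous: "smooth f \<Longrightarrow> continuous_on S f"
  using smooth_isCont continuous_at_imp_continuous_on by blast

lemma smooth_antiderivative:
  assumes F: "\<And>x. (F has_field_derivative f x) (at x)" and f: "smooth f"
  shows "smooth F"
proof (rule smooth_coinduct[of F "insert F {g. smooth g}"])
  have "deriv F = f"
    using F by (auto intro!: DERIV_imp_deriv)
  then show "deriv s \<in> insert F {g. smooth g}" if "s \<in> insert F {g. smooth g}" for s
    using that f smooth_deriv by auto
  show "s field_differentiable at x" if "s \<in> insert F {g. smooth g}" for s x
    using that F smooth_differentiable by (auto simp: field_differentiable_def)
qed auto

lemma smooth_add:
  assumes "smooth f" "smooth g"
  shows "smooth (\<lambda>x. f x + g x)"
proof (rule smooth_coinduct)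
  let ?S = "{\<lambda>x. a x + b x |a b. smooth a \<and> smooth b}"
  show "(\<lambda>x. f x + g x) \<in> ?S"
    using assms by blast
  fix s assume "s \<in> ?S"
  then obtain a b where s: "s = (\<lambda>x. a x + b x)" "smooth a" "smooth b"
    by blast
  have D: "(s has_field_derivative deriv a x + deriv b x) (at x)" for x
    unfolding s(1) by (intro derivative_intros smooth_DERIV s)
  then show "s field_differentiable at x" for x
    by (auto simp: field_differentiable_def)
  have "deriv s = (\<lambda>x. deriv a x + deriv b x)"
    using D by (auto intro!: DERIV_imp_deriv)
  then show "deriv s \<in> ?S"
    using s smooth_deriv by blast
qed

lemma smooth_affine:
  assumes "smooth f"
  shows "smooth (\<lambda>x. c * f (a * x + b))"
proof (rule smooth_coinduct)
  let ?S = "{\<lambda>x. c * f (a * x + b) |c f. smooth f}"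
  show "(\<lambda>x. c * f (a * x + b)) \<in> ?S"
    using assms by blast
  fix s assume "s \<in> ?S"
  then obtain c f where s: "s = (\<lambda>x. c * f (a * x + b))" "smooth f"
    by blast
  have D: "(s has_field_derivative (c * a) * deriv f (a * x + b)) (at x)" for x
  proof -
    have "((\<lambda>x. f (a * x + b)) has_field_derivative deriv f (a * x + b) * a) (at x)"
      by (rule DERIV_chain2[OF smooth_DERIV[OF s(2)]]) (auto intro!: derivative_eq_intros)
    from DERIV_cmult[OF this, of c] show ?thesis
      by (simp add: s(1) mult_ac)
  qed
  then show "s field_differentiable at x" for x
    by (auto simp: field_differentiable_def)
  have "deriv s = (\<lambda>x. (c * a) * deriv f (a * x + b))"
    using D by (auto intro!: DERIV_imp_deriv)
  then show "deriv s \<in> ?S"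
    using smooth_deriv[OF s(2)] by (intro CollectI exI conjI)
qed

text \<open>The derivatives of a product stay among the finite sums of products.\<close>

inductive_set sums_of_products :: "(real \<Rightarrow> real) set" where
  product: "smooth f \<Longrightarrow> smooth g \<Longrightarrow> (\<lambda>x. f x * g x) \<in> sums_of_products"
| sum: "s \<in> sums_of_products \<Longrightarrow> t \<in> sums_of_products \<Longrightarrow> (\<lambda>x. s x + t x) \<in> sums_of_products"

lemma smooth_mult:
  assumes "smooth f" "smooth g"
  shows "smooth (\<lambda>x. f x * g x)"
proof (rule smooth_coinduct)
  show "(\<lambda>x. f x * g x) \<in> sums_of_products"
    using assms by (rule product)
  have *: "(\<forall>x. s field_differentiable at x) \<and> deriv s \<in> sums_of_products"
    if "s \<in> sums_of_products" for s
    using that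
  proof induction
    case (product f g)
    have D: "((\<lambda>x. f x * g x) has_field_derivative deriv f x * g x + f x * deriv g x) (at x)" for x
      using DERIV_mult[OF smooth_DERIV[OF product(1), of x] smooth_DERIV[OF product(2), of x]]
      by (simp add: add.commute mult.commute)
    then have "deriv (\<lambda>x. f x * g x) = (\<lambda>x. deriv f x * g x + f x * deriv g x)"
      by (auto intro!: DERIV_imp_deriv)
    then show ?case
      using D product smooth_deriv
      by (auto simp: field_differentiable_def intro!: sums_of_products.intros)
  next
    case (sum s t)
    have "deriv (\<lambda>x. s x + t x) = (\<lambda>x. deriv s x + deriv t x)"
      using sum.IH by (auto intro!: deriv_add)
    then show ?case
      using sum.IH by (auto intro!: sums_of_products.intros field_differentiable_add)
  qed
  then show "s \<in> sums_of_products \<Longrightarrow> s field_differentiable at x"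
    and "s \<in> sums_of_products \<Longrightarrow> deriv s \<in> sums_of_products" for s x
    by auto
qed

lemma poly_div_exp_tendsto_0: "((\<lambda>t. t ^ k * poly p t / exp t) \<longlongrightarrow> 0) (at_top :: real filter)"
proof (induction p arbitrary: k)
  case 0
  then show ?case by simp
next
  case (pCons a p)
  have "((\<lambda>t. a * (t ^ k / exp t) + t ^ Suc k * poly p t / exp t) \<longlongrightarrow> a * 0 + 0) (at_top :: real filter)"
    by (intro tendsto_intros tendsto_power_div_exp_0 pCons.IH)
  then show ?case
    by (simp add: field_simps)
qed

text \<open>
  Up to the polynomial factor this is the classical function that is flat at the origin. With the
  factor, the family is closed under differentiation.
\<close>

definition flat :: "real poly \<Rightarrow> real \<Rightarrow> real" where
  "flat p x = (if x > 0 then poly p (1 / x) * exp (- (1 / x)) else 0)"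

lemma flat_DERIV:
  "(flat p has_field_derivative flat ([:0, 0, 1:] * (p - pderiv p)) x) (at x)"
proof (cases x "0::real" rule: linorder_cases)
  case less
  have "((\<lambda>x. 0) has_field_derivative 0) (at x)"
    by simp
  then show ?thesis
    by (rule DERIV_cong[OF has_field_derivative_transform_within_open[of _ _ _ "{..<0}"]])
       (use less in \<open>auto simp: flat_def\<close>)
next
  case greater
  have "((\<lambda>x. poly p (1 / x) * exp (- (1 / x))) has_field_derivative
      (poly (pderiv p) (1 / x) * (- 1 / x\<^sup>2)) * exp (- (1 / x)) + poly p (1 / x) * (exp (- (1 / x)) * (1 / x\<^sup>2))) (at x)"
    using greater
    by (auto intro!: derivative_eq_intros DERIV_chain2[OF poly_DERIV] simp: power2_eq_square)
  then show ?thesis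
    by (rule DERIV_cong[OF has_field_derivative_transform_within_open[of _ _ _ "{0<..}"]])
       (use greater in \<open>auto simp: flat_def field_simps power2_eq_square\<close>)
next
  case equal
  have "((\<lambda>h. flat p h / h) \<longlongrightarrow> 0) (at 0)"
  proof (rule filterlim_split_at)
    have "\<forall>\<^sub>F h in at_left 0. 0 = flat p h / h"
      unfolding eventually_at_filter by (simp add: flat_def)
    then show "((\<lambda>h. flat p h / h) \<longlongrightarrow> 0) (at_left 0)"
      by (rule Lim_transform_eventually[OF tendsto_const])
    have "((\<lambda>h. (1 / h) ^ 1 * poly p (1 / h) / exp (1 / h)) \<longlongrightarrow> 0) (at_right (0 :: real))"
      by (rule filterlim_compose[OF poly_div_exp_tendsto_0])
         (simp add: filterlim_inverse_at_top_right flip: inverse_eq_divide)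
    moreover have "\<forall>\<^sub>F h in at_right 0. (1 / h) ^ 1 * poly p (1 / h) / exp (1 / h) = flat p h / h"
      unfolding eventually_at_filter by (simp add: flat_def exp_minus field_simps)
    ultimately show "((\<lambda>h. flat p h / h) \<longlongrightarrow> 0) (at_right 0)"
      by (rule Lim_transform_eventually)
  qed
  then show ?thesis
    using equal by (simp add: DERIV_def flat_def)
qed

lemma smooth_flat: "smooth (flat p)"
proof (rule smooth_coinduct)
  show "flat p \<in> range flat" by simp
  fix s assume "s \<in> range flat"
  then obtain p where "s = flat p" by blast
  moreover have "deriv (flat p) = flat ([:0, 0, 1:] * (p - pderiv p))"
    using flat_DERIV by (auto intro!: DERIV_imp_deriv)
  ultimately show "deriv s \<in> range flat" "s field_differentiable at x" for x
    using flat_DERIV[of p] by (auto simp: field_differentiable_def)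
qed

lemma antiderivative_exists:
  fixes f :: "real \<Rightarrow> real"
  assumes "smooth f"
  obtains F where "\<And>x. (F has_field_derivative f x) (at x)" and "F 0 = 0" and "smooth F"
proof -
  have "\<exists>F. \<forall>x. -\<infinity> < ereal x \<longrightarrow> ereal x < \<infinity> \<longrightarrow> (F has_vector_derivative f x) (at x)"
    by (rule einterval_antiderivative) (use assms smooth_isCont in auto)
  then obtain G where G: "(G has_field_derivative f x) (at x)" for x
    by (auto simp: has_real_derivative_iff_has_vector_derivative)
  define F where "F x = G x - G 0" for x
  have F: "(F has_field_derivative f x) (at x)" for x
    using DERIV_diff[OF G DERIV_const[of "G 0"]] by (simp add: F_def[abs_def])
  show ?thesis
    using that[OF F _ smooth_antiderivative[OF F assms]] by (simp add: F_def)
qed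

text \<open>
  A smooth ramp: the antiderivative of a smooth step. It vanishes on the left half-line and is affine
  with slope one beyond 1, so that second differences of it are compactly supported.
\<close>

lemma smooth_ramp_exists:
  obtains \<Phi> S :: "real \<Rightarrow> real" and c where "smooth \<Phi>"
    and "\<And>x. (\<Phi> has_field_derivative S x) (at x)"
    and "\<And>x. x \<le> 0 \<Longrightarrow> \<Phi> x = 0" and "\<And>x. x \<ge> 1 \<Longrightarrow> \<Phi> x = x + c"
    and "\<And>x. x \<le> 0 \<Longrightarrow> S x = 0" and "\<And>x. x \<ge> 1 \<Longrightarrow> S x = 1"
    and "\<And>x. 0 \<le> S x" and "\<And>x. S x \<le> 1" and "continuous_on UNIV S"
proof -
  define b where "b x = flat 1 x * flat 1 (1 - x)" for x
  have "smooth (\<lambda>x. 1 * flat 1 ((- 1) * x + 1))"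
    by (rule smooth_affine[OF smooth_flat])
  then have b: "smooth b"
    using smooth_mult[OF smooth_flat[of 1], of "\<lambda>x. flat 1 (1 - x)"] by (simp add: b_def[abs_def])
  have b_out: "b x = 0" if "x \<le> 0 \<or> x \<ge> 1" for x
    using that by (auto simp: b_def flat_def)
  have b_pos: "b x > 0" if "0 < x" "x < 1" for x
    using that by (auto simp: b_def flat_def)
  have b_nonneg: "b x \<ge> 0" for x
    using b_out[of x] b_pos[of x] by (cases "0 < x \<and> x < 1") auto
  obtain E where E: "\<And>x. (E has_field_derivative b x) (at x)" "E 0 = 0" "smooth E"
    using antiderivative_exists[OF b] by blast
  have const: "G x = G y" if "x \<le> y" "\<And>z. x < z \<Longrightarrow> z < y \<Longrightarrow> (G has_field_derivative 0) (at z)"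
      "continuous_on UNIV G" for G :: "real \<Rightarrow> real" and x y
  proof (cases "x = y")
    case False
    with that(1) have "x < y" by simp
    then show ?thesis
      using DERIV_isconst2[of x y G y] that continuous_on_subset[OF that(3)] by auto
  qed simp
  have E_le0: "E x = 0" if "x \<le> 0" for x
    using const[OF that, of E] E b_out smooth_continuous[OF E(3)] by (metis less_imp_le)
  have E_ge1: "E x = E 1" if "x \<ge> 1" for x
    using const[OF that, of E] E b_out smooth_continuous[OF E(3)] by (metis less_imp_le)
  have E_mono: "E x \<le> E y" if "x \<le> y" for x y
    by (rule DERIV_nonneg_imp_nondecreasing[OF that]) (use E b_nonneg in blast)
  have E1: "E 1 > 0"
  proof -
    have "E (1/4) < E (3/4)"
      by (rule DERIV_pos_imp_increasing) (use E b_pos in \<open>auto intro!: exI\<close>)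
    then show ?thesis
      using E_mono[of 0 "1/4"] E_mono[of "3/4" 1] E(2) by linarith
  qed
  define S where "S x = inverse (E 1) * E x" for x
  have S: "smooth S"
    using smooth_affine[OF E(3), of "inverse (E 1)" 1 0] by (simp add: S_def[abs_def])
  have S0: "S x = 0" if "x \<le> 0" for x
    using E_le0[OF that] by (simp add: S_def)
  have S1: "S x = 1" if "x \<ge> 1" for x
    using E_ge1[OF that] E1 by (simp add: S_def)
  have S_nonneg: "0 \<le> S x" for x
    using E_mono[of "min x 0" x] E_le0[of "min x 0"] E1 by (simp add: S_def)
  have S_le: "S x \<le> 1" for x
    using E_mono[of x "max x 1"] E_ge1[of "max x 1"] E1 by (simp add: S_def field_simps)
  obtain \<Phi> where \<Phi>: "\<And>x. (\<Phi> has_field_derivative S x) (at x)" "\<Phi> 0 = 0" "smooth \<Phi>"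
    using antiderivative_exists[OF S] by blast
  have "\<Phi> x = 0" if "x \<le> 0" for x
    using const[OF that, of \<Phi>] \<Phi> S0 smooth_continuous[OF \<Phi>(3)] by (metis less_imp_le)
  moreover have "\<Phi> x = x + (\<Phi> 1 - 1)" if "x \<ge> 1" for x
  proof -
    have "\<Phi> 1 - 1 = \<Phi> x - x"
    proof (rule const[OF that])
      show "((\<lambda>x. \<Phi> x - x) has_field_derivative 0) (at z)" if "1 < z" "z < x" for z
        using DERIV_diff[OF \<Phi>(1) DERIV_ident, of z] S1[of z] that by simp
      show "continuous_on UNIV (\<lambda>x. \<Phi> x - x)"
        by (intro continuous_intros smooth_continuous \<Phi>)
    qed
    then show ?thesis by simp
  qed
  ultimately show ?thesis
    using that[OF \<Phi>(3,1)] S0 S1 S_nonneg S_le smooth_continuous[OF S] by blast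
qed

section \<open>Weak derivatives and translations\<close>

lemma L2_integrable_on:
  assumes f: "f \<in> L2" and A: "A \<in> sets borel" "emeasure lborel A < \<infinity>"
  shows "integrable lborel (\<lambda>x. indicator A x *\<^sub>R f x)"
proof (rule Bochner_Integration.integrable_bound)
  show "integrable lborel (\<lambda>x. indicator A x + (norm (f x))\<^sup>2)"
    using A by (intro Bochner_Integration.integrable_add L2_integrable[OF f]) auto
  show "(\<lambda>x. indicator A x *\<^sub>R f x) \<in> borel_measurable lborel"
    using A L2_measurable[OF f] by auto
  have "norm (f x) \<le> 1 + (norm (f x))\<^sup>2" for x
    using sum_squares_bound[of "norm (f x)" 1] norm_ge_zero[of "f x"] by (simp, linarith)
  then show "AE x in lborel. norm (indicator A x *\<^sub>R f x) \<le> norm (indicator A x + (norm (f x))\<^sup>2)"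
    by (auto simp: indicator_def)
qed

text \<open>
  The Borel sets over which the integral of \<open>w\<close>, cut off to a bounded interval, vanishes form a Dynkin
  system, and it contains the half-open intervals.
\<close>

lemma AE_zero_of_interval_integrals:
  fixes w :: "real \<Rightarrow> real"
  assumes w: "\<And>a b. integrable lborel (\<lambda>x. indicator {a<..b} x *\<^sub>R w x)"
    and zero: "\<And>a b. a \<le> b \<Longrightarrow> (LINT x|lborel. indicator {a<..b} x *\<^sub>R w x) = 0"
  shows "AE x in lborel. w x = 0"
proof -
  have "AE x in lborel. indicator {- real n<..real n} x *\<^sub>R w x = 0" for n
  proof -
    define v where "v x = indicator {- real n<..real n} x *\<^sub>R w x" for x
    have v: "integrable lborel v"
      using w by (simp add: v_def[abs_def])
    have vA: "integrable lborel (\<lambda>x. indicator A x *\<^sub>R v x)" if "A \<in> sets borel" for A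
      using integrable_mult_indicator[OF _ v] that by auto
    have v0: "(LINT x|lborel. v x) = 0"
      unfolding v_def by (rule zero) simp
    have "(LINT x|lborel. indicator A x *\<^sub>R v x) = 0" if "A \<in> sets borel" for A
    proof -
      have gen: "A \<in> sigma_sets UNIV (range (\<lambda>(a, b). {a<..b::real}))"
        using that by (simp add: borel_sigma_sets_Ioc sets_measure_of)
      have "Int_stable (range (\<lambda>(a, b). {a<..b::real}))"
        by (auto simp: Int_stable_def)
      moreover have "range (\<lambda>(a, b). {a<..b::real}) \<subseteq> Pow UNIV"
        by simp
      ultimately show ?thesis
        using gen
      proof (induction rule: sigma_sets_induct_disjoint)
        fix A assume "A \<in> range (\<lambda>(a, b). {a<..b::real})"
        then obtain a b where A: "A = {a<..b}" by auto
        define a' b' where "a' = max a (- real n)" and "b' = max a' (min b (real n))"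
        have "indicator A x *\<^sub>R v x = indicator {a'<..b'} x *\<^sub>R w x" for x
          by (auto simp: A v_def a'_def b'_def indicator_def)
        then show "(LINT x|lborel. indicator A x *\<^sub>R v x) = 0"
          using zero[of a' b'] by (simp add: b'_def)
      next
        show "(LINT x|lborel. indicator {} x *\<^sub>R v x) = 0" by simp
      next
        fix A assume A: "A \<in> sigma_sets UNIV (range (\<lambda>(a, b). {a<..b::real}))"
          "(LINT x|lborel. indicator A x *\<^sub>R v x) = 0"
        then have "A \<in> sets borel"
          by (simp add: borel_sigma_sets_Ioc sets_measure_of)
        moreover have "(LINT x|lborel. indicator (UNIV - A) x *\<^sub>R v x)
            = (LINT x|lborel. v x - indicator A x *\<^sub>R v x)"
          by (intro Bochner_Integration.integral_cong) (auto simp: indicator_def)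
        ultimately show "(LINT x|lborel. indicator (UNIV - A) x *\<^sub>R v x) = 0"
          using A(2) v v0 vA[of A] by simp
      next
        fix A :: "nat \<Rightarrow> real set"
        assume A: "disjoint_family A" "range A \<subseteq> sigma_sets UNIV (range (\<lambda>(a, b). {a<..b::real}))"
          "\<And>i. (LINT x|lborel. indicator (A i) x *\<^sub>R v x) = 0"
        have [measurable]: "A i \<in> sets borel" for i
          using A(2) by (simp add: borel_sigma_sets_Ioc sets_measure_of image_subset_iff)
        have "(LINT x:(\<Union>i. A i)|lborel. v x) = (\<Sum>i. (LINT x:A i|lborel. v x))"
          using A(1) vA by (intro lebesgue_integral_countable_add)
            (auto simp: set_integrable_def disjoint_family_on_def)
        then show "(LINT x|lborel. indicator (\<Union>i. A i) x *\<^sub>R v x) = 0"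
          using A(3) by (simp add: set_lebesgue_integral_def)
      qed
    qed
    then have "AE x in lborel. v x = 0"
      using density_unique_real[OF v integrable_zero] by (simp add: set_lebesgue_integral_def)
    then show ?thesis
      by (simp add: v_def)
  qed
  then have "AE x in lborel. \<forall>n. indicator {- real n<..real n} x *\<^sub>R w x = 0"
    unfolding AE_all_countable by blast
  then show ?thesis
  proof eventually_elim
    case (elim x)
    obtain n where "\<bar>x\<bar> < real n"
      using reals_Archimedean2 by blast
    with elim[rule_format, of n] show ?case
      by (auto simp: indicator_def split: if_splits)
  qed
qed


lemma test_function_integrable_mult:
  assumes \<phi>: "\<phi> \<in> borel_measurable borel" "\<And>x. \<bar>\<phi> x\<bar> \<le> B" "\<And>x. x \<notin> {a..b} \<Longrightarrow> \<phi> x = 0"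
    and f: "f \<in> L2"
  shows "integrable lborel (\<lambda>x. \<phi> x *\<^sub>R f x)"
proof (rule Bochner_Integration.integrable_bound)
  show "integrable lborel (\<lambda>x. B *\<^sub>R (indicator {a..b} x *\<^sub>R f x))"
    by (intro integrable_scaleR_right L2_integrable_on[OF f]) (auto simp: emeasure_lborel_Icc_eq)
  show "(\<lambda>x. \<phi> x *\<^sub>R f x) \<in> borel_measurable lborel"
    using \<phi>(1) L2_measurable[OF f] by auto
  have "\<bar>\<phi> x\<bar> * norm (f x) \<le> \<bar>B\<bar> * norm (f x)" for x
    using \<phi>(2)[of x] by (intro mult_right_mono) auto
  then show "AE x in lborel. norm (\<phi> x *\<^sub>R f x) \<le> norm (B *\<^sub>R (indicator {a..b} x *\<^sub>R f x))"
    using \<phi>(3) by (intro AE_I2) (auto simp: indicator_def)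
qed

lemma ramp_difference_integral:
  fixes y h :: real
  assumes "h \<ge> 0"
  shows "(LINT \<rho>|lborel. indicator {0..h} \<rho> * indicator {..<y} \<rho>) = max 0 y - max 0 (y - h)"
proof -
  have "(LINT \<rho>|lborel. indicator {0..h} \<rho> * indicator {..<y} \<rho>) = measure lborel ({0..h} \<inter> {..<y})"
    by (simp add: indicator_inter_arith[symmetric])
  also have "{0..h} \<inter> {..<y} = (if y \<le> h then {0..<y} else {0..h})"
    by auto
  also have "measure lborel \<dots> = max 0 y - max 0 (y - h)"
    using assms by (cases "y \<ge> 0") auto
  finally show ?thesis .
qed

text \<open>
  Testing against smooth approximations of a trapezoid: the derivative tends to the difference of the
  indicators of \<open>{a<..b}\<close> and its translate, and the trapezoid is the integral of the translates in
  between.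
\<close>

lemma weak_derivative_increment_interval:
  assumes f: "f \<in> L2" and g: "g \<in> L2" and fg: "has_weak_derivative f g"
    and h: "h > 0" and ab: "a \<le> b"
  shows "(LINT x|lborel. indicator {a<..b} x *\<^sub>R (f (x + h) - f x))
    = (LINT x|lborel. indicator {a<..b} x *\<^sub>R (LINT \<rho>|lborel. indicator {0..h} \<rho> *\<^sub>R g (x + \<rho>)))"
proof -
  have [measurable]: "f \<in> borel_measurable borel" "g \<in> borel_measurable borel"
    using f g by auto
  obtain \<Phi> S :: "real \<Rightarrow> real" and c where \<Phi>: "smooth \<Phi>"
    and D\<Phi>: "\<And>x. (\<Phi> has_field_derivative S x) (at x)"
    and \<Phi>0: "\<And>x. x \<le> 0 \<Longrightarrow> \<Phi> x = 0" and \<Phi>1: "\<And>x. x \<ge> 1 \<Longrightarrow> \<Phi> x = x + c"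
    and S0: "\<And>x. x \<le> 0 \<Longrightarrow> S x = 0" and S1: "\<And>x. x \<ge> 1 \<Longrightarrow> S x = 1"
    and S_nonneg: "\<And>x. 0 \<le> S x" and S_le: "\<And>x. S x \<le> 1" and S_cont: "continuous_on UNIV S"
    using smooth_ramp_exists by blast
  define m where "m n = real (Suc n)" for n
  have m: "m n \<ge> 1" for n
    by (simp add: m_def)
  have m_lim: "filterlim m at_top sequentially"
    unfolding m_def by (rule filterlim_compose[OF filterlim_real_sequentially filterlim_Suc])
  \<comment> \<open>the rescaled ramp starting at \<open>p\<close>\<close>
  define R where "R n p x = \<Phi> (m n * (x - p)) / m n" for n p x
  define T where "T n p x = S (m n * (x - p))" for n p x
  have R_smooth: "smooth (\<lambda>x. R n p x)" for n p
    using smooth_affine[OF \<Phi>, of "1 / m n" "m n" "- m n * p"] by (simp add: R_def algebra_simps)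
  have R_DERIV: "(R n p has_field_derivative T n p x) (at x)" for n p x
  proof -
    have "((\<lambda>x. \<Phi> (m n * (x - p))) has_field_derivative S (m n * (x - p)) * m n) (at x)"
      by (rule DERIV_chain2[OF D\<Phi>]) (auto intro!: derivative_eq_intros)
    from DERIV_cdivide[OF this, of "m n"] show ?thesis
      using m[of n] by (simp add: R_def[abs_def] T_def)
  qed
  have R_left: "R n p x = 0" if "x \<le> p" for n p x
    using that m[of n] by (auto simp: R_def intro!: \<Phi>0 mult_nonneg_nonpos)
  have R_right: "R n p x = x - p + c / m n" if "x \<ge> p + 1" for n p x
  proof -
    have "1 * 1 \<le> m n * (x - p)"
      using that m[of n] by (intro mult_mono) auto
    then show ?thesis
      using m[of n] by (simp add: R_def \<Phi>1 field_simps)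
  qed
  have T_bounds: "0 \<le> T n p x" "T n p x \<le> 1" for n p x
    using S_nonneg S_le by (auto simp: T_def)
  have T_lim: "(\<lambda>n. T n p x) \<longlonglongrightarrow> indicator {p<..} x" for p x
  proof (cases "x > p")
    case True
    have "\<forall>\<^sub>F n in sequentially. 1 / (x - p) \<le> m n"
      using m_lim by (simp add: filterlim_at_top)
    then have "\<forall>\<^sub>F n in sequentially. 1 = T n p x"
    proof eventually_elim
      case (elim n)
      then have "1 \<le> m n * (x - p)"
        using True by (simp add: field_simps)
      then show ?case
        by (simp add: T_def S1)
    qed
    then show ?thesis
      using True by (simp add: Lim_transform_eventually[OF tendsto_const])
  next
    case False
    then have "T n p x = 0" for n
      using m[of n] by (auto simp: T_def intro!: S0 mult_nonneg_nonpos)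
    then show ?thesis
      using False by simp
  qed
  have R_lim: "(\<lambda>n. R n p x) \<longlonglongrightarrow> max 0 (x - p)" for p x
  proof (cases "x > p")
    case True
    have "\<forall>\<^sub>F n in sequentially. 1 / (x - p) \<le> m n"
      using m_lim by (simp add: filterlim_at_top)
    then have ev: "\<forall>\<^sub>F n in sequentially. x - p + c / m n = R n p x"
    proof eventually_elim
      case (elim n)
      then have "1 \<le> m n * (x - p)"
        using True by (simp add: field_simps)
      then show ?case
        using m[of n] by (simp add: R_def \<Phi>1 field_simps)
    qed
    have "(\<lambda>n. x - p + c / m n) \<longlonglongrightarrow> x - p + 0"
      by (intro tendsto_intros tendsto_divide_0[OF tendsto_const] filterlim_at_top_imp_at_infinity m_lim)
    from Lim_transform_eventually[OF this ev] show ?thesis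
      using True by simp
  next
    case False
    then show ?thesis
      using R_left by simp
  qed
  define \<phi> where "\<phi> n x = R n a x - R n b x - R n (a + h) x + R n (b + h) x" for n x
  define \<psi> where "\<psi> n x = T n a x - T n b x - T n (a + h) x + T n (b + h) x" for n x
  have \<phi>_DERIV: "(\<phi> n has_field_derivative \<psi> n x) (at x)" for n x
    unfolding \<phi>_def[abs_def] \<psi>_def by (intro derivative_intros R_DERIV)
  have \<psi>_deriv: "deriv (\<phi> n) = \<psi> n" for n
    using \<phi>_DERIV by (auto intro!: DERIV_imp_deriv)
  have \<phi>_out: "\<phi> n x = 0" if "x \<notin> {a..b + h + 1}" for n x
  proof -
    have "x < a \<or> x > b + h + 1"
      using that by auto
    then show ?thesis
      using ab h by (auto simp: \<phi>_def R_left R_right)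
  qed
  have \<psi>_out: "\<psi> n x = 0" if "x \<notin> {a..b + h + 1}" for n x
  proof -
    have "T n p x = 0" if "x \<le> p" for p
      using that m[of n] by (auto simp: T_def intro!: S0 mult_nonneg_nonpos)
    moreover have "T n p x = 1" if "x \<ge> p + 1" for p
    proof -
      have "1 * 1 \<le> m n * (x - p)"
        using that m[of n] by (intro mult_mono) auto
      then show ?thesis
        by (simp add: T_def S1)
    qed
    moreover have "x < a \<or> x > b + h + 1"
      using that by auto
    ultimately show ?thesis
      using ab h by (auto simp: \<psi>_def)
  qed
  have \<psi>_bound: "\<bar>\<psi> n x\<bar> \<le> 2" for n x
    using T_bounds(1)[of n a x] T_bounds(2)[of n a x] T_bounds(1)[of n b x] T_bounds(2)[of n b x]
      T_bounds(1)[of n "a+h" x] T_bounds(2)[of n "a+h" x] T_bounds(1)[of n "b+h" x] T_bounds(2)[of n "b+h" x]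
    unfolding \<psi>_def by linarith
  \<comment> \<open>\<open>\<phi> n\<close> has slope at most two and vanishes at \<open>a - 1\<close>\<close>
  define B where "B = 2 * (b + h + 2 - a)"
  have \<phi>_bound: "\<bar>\<phi> n x\<bar> \<le> B" for n x
  proof (cases "x \<in> {a..b + h + 1}")
    case True
    have "norm (\<phi> n x - \<phi> n (a - 1)) \<le> 2 * norm (x - (a - 1))"
      by (rule field_differentiable_bound[of UNIV _ "\<psi> n"])
         (use \<phi>_DERIV \<psi>_bound has_field_derivative_at_within in auto)
    moreover have "\<phi> n (a - 1) = 0"
      by (rule \<phi>_out) simp
    ultimately have "\<bar>\<phi> n x\<bar> \<le> 2 * \<bar>x - (a - 1)\<bar>"
      by simp
    also have "\<dots> \<le> B"
      using True by (auto simp: B_def)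
    finally show ?thesis .
  next
    case False
    then show ?thesis
      using ab h by (auto simp: \<phi>_out B_def)
  qed
  have \<phi>_smooth: "smooth (\<phi> n)" for n
  proof -
    have neg: "smooth (\<lambda>x. - k x)" if "smooth k" for k
      using smooth_affine[OF that, of "-1" 1 0] by simp
    have "smooth (\<lambda>x. ((R n a x + - R n b x) + - R n (a + h) x) + R n (b + h) x)"
      by (intro smooth_add neg R_smooth)
    then show ?thesis
      by (simp add: \<phi>_def[abs_def])
  qed
  have "test_function (\<phi> n)" for n
    unfolding test_function_def
  proof
    have "closure {x. \<phi> n x \<noteq> 0} \<subseteq> {a..b + h + 1}"
      by (rule closure_minimal) (use \<phi>_out[of _ n] in blast, simp)
    then show "compact (closure {x. \<phi> n x \<noteq> 0})"
      by (meson closed_closure compact_Icc compact_Int_closed inf.absorb_iff2 compact_eq_bounded_closed bounded_subset)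
  qed (rule \<phi>_smooth)
  then have eq: "(LINT x|lborel. \<psi> n x *\<^sub>R f x) = - (LINT x|lborel. \<phi> n x *\<^sub>R g x)" for n
    using fg unfolding has_weak_derivative_def \<psi>_deriv[symmetric] by blast
  have T_cont: "continuous_on UNIV (T n p)" for n p
    unfolding T_def by (intro continuous_intros continuous_on_compose2[OF S_cont]) auto
  have [measurable]: "\<psi> n \<in> borel_measurable borel" "\<phi> n \<in> borel_measurable borel" for n
  proof -
    show "\<psi> n \<in> borel_measurable borel"
      unfolding \<psi>_def by (intro borel_measurable_continuous_onI continuous_intros T_cont)
    show "\<phi> n \<in> borel_measurable borel"
      by (intro borel_measurable_continuous_onI smooth_continuous \<phi>_smooth)
  qed
  have dom: "integrable lborel (\<lambda>x. B' * norm (indicator {a..b + h + 1} x *\<^sub>R k x))" if "k \<in> L2" for k B'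
    by (intro integrable_mult_right integrable_norm L2_integrable_on that) (auto simp: emeasure_lborel_Icc_eq)
  define trap where "trap x = max 0 (x - a) - max 0 (x - b) - max 0 (x - (a + h)) + max 0 (x - (b + h))" for x
  define jump where "jump x = (indicator {a<..b} x - indicator {a<..b} (x - h) :: real)" for x
  have "(\<lambda>n. LINT x|lborel. \<psi> n x *\<^sub>R f x) \<longlonglongrightarrow> (LINT x|lborel. jump x *\<^sub>R f x)"
  proof (rule integral_dominated_convergence[OF _ _ dom[OF f, of 2]])
    have "(\<lambda>n. \<psi> n x) \<longlonglongrightarrow> jump x" for x
    proof -
      have "(\<lambda>n. \<psi> n x) \<longlonglongrightarrow> indicator {a<..} x - indicator {b<..} x - indicator {a + h<..} x + indicator {b + h<..} x"
        unfolding \<psi>_def by (intro tendsto_intros T_lim)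
      also have "indicator {a<..} x - indicator {b<..} x - indicator {a + h<..} x + indicator {b + h<..} x = jump x"
        using ab by (auto simp: jump_def indicator_def)
      finally show ?thesis .
    qed
    then show "AE x in lborel. (\<lambda>n. \<psi> n x *\<^sub>R f x) \<longlonglongrightarrow> jump x *\<^sub>R f x"
      by (intro AE_I2 tendsto_intros)
    have "norm (\<psi> n x *\<^sub>R f x) \<le> 2 * norm (indicator {a..b + h + 1} x *\<^sub>R f x)" for n x
      using \<psi>_bound[of n x] \<psi>_out[of x n] by (auto simp: indicator_def intro!: mult_right_mono)
    then show "AE x in lborel. norm (\<psi> n x *\<^sub>R f x) \<le> 2 * norm (indicator {a..b + h + 1} x *\<^sub>R f x)" for n
      by simp
  qed (auto simp: jump_def)
  moreover have "(\<lambda>n. LINT x|lborel. \<phi> n x *\<^sub>R g x) \<longlonglongrightarrow> (LINT x|lborel. trap x *\<^sub>R g x)"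
  proof (rule integral_dominated_convergence[OF _ _ dom[OF g, of B]])
    have "(\<lambda>n. \<phi> n x) \<longlonglongrightarrow> trap x" for x
      unfolding \<phi>_def trap_def by (intro tendsto_intros R_lim)
    then show "AE x in lborel. (\<lambda>n. \<phi> n x *\<^sub>R g x) \<longlonglongrightarrow> trap x *\<^sub>R g x"
      by (intro AE_I2 tendsto_intros)
    have "norm (\<phi> n x *\<^sub>R g x) \<le> B * norm (indicator {a..b + h + 1} x *\<^sub>R g x)" for n x
      using \<phi>_bound[of n x] \<phi>_out[of x n] by (auto simp: indicator_def intro!: mult_right_mono)
    then show "AE x in lborel. norm (\<phi> n x *\<^sub>R g x) \<le> B * norm (indicator {a..b + h + 1} x *\<^sub>R g x)" for n
      by simp
  qed (auto simp: trap_def)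
  ultimately have jump_trap: "(LINT x|lborel. jump x *\<^sub>R f x) = - (LINT x|lborel. trap x *\<^sub>R g x)"
    unfolding eq using LIMSEQ_unique tendsto_minus by blast
  \<comment> \<open>the left side, after translating the second indicator\<close>
  have If: "integrable lborel (\<lambda>x. indicator {a<..b} x *\<^sub>R f x)"
    by (rule L2_integrable_on[OF f]) (use ab in \<open>auto simp: emeasure_lborel_Ioc\<close>)
  have Ifh: "integrable lborel (\<lambda>x. indicator {a<..b} x *\<^sub>R f (x + h))"
    by (rule L2_integrable_on[OF L2_shift(1)[OF f]]) (use ab in \<open>auto simp: emeasure_lborel_Ioc\<close>)
  have shift: "(LINT x|lborel. indicator {a<..b} (x - h) *\<^sub>R f x) = (LINT x|lborel. indicator {a<..b} x *\<^sub>R f (x + h))"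
    using integral_shift[of "\<lambda>x. indicator {a<..b} (x - h) *\<^sub>R f x" h] by simp
  have "integrable lborel (\<lambda>x. indicator {a<..b} (x - h) *\<^sub>R f x)"
    using integrable_shift[OF Ifh, of "- h"] by simp
  then have lhs: "(LINT x|lborel. jump x *\<^sub>R f x) = - (LINT x|lborel. indicator {a<..b} x *\<^sub>R (f (x + h) - f x))"
    using If Ifh shift by (simp add: jump_def scaleR_diff_left scaleR_diff_right)
  \<comment> \<open>the right side, by Fubini\<close>
  define G where "G x \<rho> = (indicator {0..h} \<rho> * indicator {a<..b} (x - \<rho>)) *\<^sub>R g x" for x \<rho>
  have trap_eq: "(LINT \<rho>|lborel. indicator {0..h} \<rho> * indicator {a<..b} (x - \<rho>)) = trap x" for x
  proof -
    have i: "integrable lborel (\<lambda>\<rho>. indicator {0..h} \<rho> * indicator {..<y} \<rho> :: real)" for y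
    proof (rule Bochner_Integration.integrable_bound)
      show "integrable lborel (indicator {0..h} :: real \<Rightarrow> real)"
        by (simp add: emeasure_lborel_Icc_eq)
    qed (auto simp: indicator_def)
    have "indicator {a<..b} (x - \<rho>) = (indicator {..<x - a} \<rho> - indicator {..<x - b} \<rho> :: real)" for \<rho>
      using ab by (auto simp: indicator_def)
    then have "(LINT \<rho>|lborel. indicator {0..h} \<rho> * indicator {a<..b} (x - \<rho>) :: real)
        = (LINT \<rho>|lborel. indicator {0..h} \<rho> * indicator {..<x - a} \<rho> - indicator {0..h} \<rho> * indicator {..<x - b} \<rho>)"
      by (simp add: right_diff_distrib)
    also have "\<dots> = trap x"
      unfolding Bochner_Integration.integral_diff[OF i i] ramp_difference_integral[OF less_imp_le[OF h]] trap_def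
        diff_diff_eq by linarith
    finally show ?thesis .
  qed
  have trap_int: "integrable lborel (\<lambda>\<rho>. indicator {0..h} \<rho> * indicator {a<..b} (x - \<rho>) :: real)" for x
  proof (rule Bochner_Integration.integrable_bound)
    show "integrable lborel (indicator {0..h} :: real \<Rightarrow> real)"
      by (simp add: emeasure_lborel_Icc_eq)
  qed (auto simp: indicator_def)
  have G: "integrable (lborel \<Otimes>\<^sub>M lborel) (case_prod G)"
  proof (rule Bochner_Integration.integrable_bound)
    have "integrable (lborel \<Otimes>\<^sub>M lborel) (\<lambda>(x, \<rho>). norm (indicator {a..b + h} x *\<^sub>R g x) * indicator {0..h} \<rho>)"
    proof (rule lborel_pair.Fubini_integrable)
      have i: "integrable lborel (\<lambda>x. norm (indicator {a..b + h} x *\<^sub>R g x))"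
        by (intro integrable_norm L2_integrable_on g) (auto simp: emeasure_lborel_Icc_eq)
      then show "integrable lborel (\<lambda>x. LINT \<rho>|lborel. norm (case (x, \<rho>) of (x, \<rho>) \<Rightarrow>
          norm (indicator {a..b + h} x *\<^sub>R g x) * indicator {0..h} \<rho>))"
        by (simp add: abs_mult)
      show "AE x in lborel. integrable lborel (\<lambda>\<rho>. case (x, \<rho>) of (x, \<rho>) \<Rightarrow>
          norm (indicator {a..b + h} x *\<^sub>R g x) * indicator {0..h} \<rho>)"
        by (auto simp: emeasure_lborel_Icc_eq intro!: integrable_mult_right)
    qed measurable
    then show "integrable (lborel \<Otimes>\<^sub>M lborel) (\<lambda>(x, \<rho>). norm (indicator {a..b + h} x *\<^sub>R g x) * indicator {0..h} \<rho>)" .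
    show "case_prod G \<in> borel_measurable (lborel \<Otimes>\<^sub>M lborel)"
      unfolding G_def by measurable
    show "AE z in lborel \<Otimes>\<^sub>M lborel. norm (case_prod G z)
        \<le> norm (case z of (x, \<rho>) \<Rightarrow> norm (indicator {a..b + h} x *\<^sub>R g x) * indicator {0..h} \<rho>)"
      by (intro AE_I2) (auto simp: G_def indicator_def split: if_splits)
  qed
  have "(LINT x|lborel. trap x *\<^sub>R g x) = (LINT x|lborel. LINT \<rho>|lborel. G x \<rho>)"
    unfolding G_def trap_eq[symmetric]
    by (intro Bochner_Integration.integral_cong refl integral_scaleR_left[symmetric] trap_int)
  also have "\<dots> = (LINT \<rho>|lborel. LINT x|lborel. G x \<rho>)"
    by (rule lborel_pair.Fubini_integral[OF G, symmetric])
  also have "\<dots> = (LINT \<rho>|lborel. LINT x|lborel. G (x + \<rho>) \<rho>)"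
    by (rule Bochner_Integration.integral_cong[OF refl], rule integral_shift[symmetric])
  also have "\<dots> = (LINT x|lborel. LINT \<rho>|lborel. G (x + \<rho>) \<rho>)"
  proof (rule lborel_pair.Fubini_integral)
    show "integrable (lborel \<Otimes>\<^sub>M lborel) (\<lambda>(x, \<rho>). G (x + \<rho>) \<rho>)"
    proof (rule Bochner_Integration.integrable_bound)
      have "integrable (lborel \<Otimes>\<^sub>M lborel) (\<lambda>(\<rho>, x). norm (G (x + \<rho>) \<rho>))"
      proof (rule lborel_pair.Fubini_integrable)
        have "integrable lborel (\<lambda>\<rho>. LINT x|lborel. norm (G x \<rho>))"
          by (intro lborel_pair.integrable_snd) (use integrable_norm[OF G] in \<open>simp add: split_beta'\<close>)
        then show "integrable lborel (\<lambda>\<rho>. LINT x|lborel. norm (case (\<rho>, x) of (\<rho>, x) \<Rightarrow> norm (G (x + \<rho>) \<rho>)))"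
          using integral_shift[of "\<lambda>x. norm (G x \<rho>)" \<rho> for \<rho>] by simp
        have "AE \<rho> in lborel. integrable lborel (\<lambda>x. G x \<rho>)"
          using lborel_pair.AE_integrable_snd[OF G] .
        then show "AE \<rho> in lborel. integrable lborel (\<lambda>x. case (\<rho>, x) of (\<rho>, x) \<Rightarrow> norm (G (x + \<rho>) \<rho>))"
          by eventually_elim (auto intro!: integrable_shift[of "\<lambda>x. norm (G x \<rho>)" for \<rho>])
      qed (simp add: G_def)
      then show "integrable (lborel \<Otimes>\<^sub>M lborel) (\<lambda>(x, \<rho>). norm (G (x + \<rho>) \<rho>))"
        using lborel_pair.integrable_product_swap_iff[of "\<lambda>(\<rho>, x). norm (G (x + \<rho>) \<rho>)"] by (simp add: split_beta')
      show "(\<lambda>(x, \<rho>). G (x + \<rho>) \<rho>) \<in> borel_measurable (lborel \<Otimes>\<^sub>M lborel)"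
        unfolding G_def by measurable
    qed auto
  qed
  also have "\<dots> = (LINT x|lborel. indicator {a<..b} x *\<^sub>R (LINT \<rho>|lborel. indicator {0..h} \<rho> *\<^sub>R g (x + \<rho>)))"
    by (intro Bochner_Integration.integral_cong refl)
       (simp add: G_def mult.commute flip: integral_scaleR_right)
  finally show ?thesis
    using jump_trap lhs by simp
qed


lemma integral_square_le:
  fixes k :: "real \<Rightarrow> real"
  assumes h: "h > 0" and k: "integrable lborel (\<lambda>\<rho>. indicator {0..h} \<rho> * k \<rho>)"
    and k2: "integrable lborel (\<lambda>\<rho>. indicator {0..h} \<rho> * (k \<rho>)\<^sup>2)"
  shows "(LINT \<rho>|lborel. indicator {0..h} \<rho> * k \<rho>)\<^sup>2 \<le> h * (LINT \<rho>|lborel. indicator {0..h} \<rho> * (k \<rho>)\<^sup>2)"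
proof -
  define I where "I = (LINT \<rho>|lborel. indicator {0..h} \<rho> * k \<rho>)"
  define J where "J = (LINT \<rho>|lborel. indicator {0..h} \<rho> * (k \<rho>)\<^sup>2)"
  have one: "integrable lborel (indicator {0..h} :: real \<Rightarrow> real)" "(LINT \<rho>|lborel. indicator {0..h} \<rho>) = h"
    using h by (auto simp: emeasure_lborel_Icc_eq)
  \<comment> \<open>the variance of \<open>k\<close> over the interval is nonnegative\<close>
  have "0 \<le> (LINT \<rho>|lborel. indicator {0..h} \<rho> * (k \<rho> - I / h)\<^sup>2)"
    by (rule Bochner_Integration.integral_nonneg) auto
  also have "\<dots> = (LINT \<rho>|lborel. indicator {0..h} \<rho> * (k \<rho>)\<^sup>2
      - (2 * I / h) * (indicator {0..h} \<rho> * k \<rho>) + (I / h)\<^sup>2 * indicator {0..h} \<rho>)"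
    by (intro Bochner_Integration.integral_cong) (auto simp: power2_eq_square algebra_simps)
  also have "\<dots> = J - (2 * I / h) * I + (I / h)\<^sup>2 * h"
    using k k2 one by (simp add: I_def J_def)
  also have "\<dots> = J - I\<^sup>2 / h"
    using h by (simp add: power2_eq_square field_simps)
  finally show ?thesis
    using h by (simp add: I_def J_def field_simps)
qed

text \<open>
  The increment of \<open>f\<close> is almost everywhere the integral of its weak derivative, so that Minkowski's
  integral inequality bounds it in \<open>L\<^sup>2\<close>.
\<close>

lemma weak_derivative_increment:
  assumes f: "f \<in> L2" and g: "g \<in> L2" and fg: "has_weak_derivative f g" and h: "h > 0"
  shows "(LINT x|lborel. (norm (f (x + h) - f x))\<^sup>2) \<le> (LINT x|lborel. (norm (g x))\<^sup>2) * h\<^sup>2"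
proof -
  have [measurable]: "f \<in> borel_measurable borel" "g \<in> borel_measurable borel"
    using f g by auto
  define I where "I x = (LINT \<rho>|lborel. indicator {0..h} \<rho> *\<^sub>R g (x + \<rho>))" for x
  have [measurable]: "I \<in> borel_measurable borel"
    unfolding I_def by measurable
  define Q where "Q x = (LINT \<rho>|lborel. indicator {0..h} \<rho> * (norm (g (x + \<rho>)))\<^sup>2)" for x
  have Q: "integrable (lborel \<Otimes>\<^sub>M lborel) (\<lambda>(\<rho>, x). indicator {0..h} \<rho> * (norm (g (x + \<rho>)))\<^sup>2)"
  proof (rule lborel_pair.Fubini_integrable)
    show "integrable lborel (\<lambda>\<rho>. LINT x|lborel. norm (case (\<rho>, x) of (\<rho>, x) \<Rightarrow> indicator {0..h} \<rho> * (norm (g (x + \<rho>)))\<^sup>2))"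
      by (simp add: abs_mult L2_shift(2)[OF g] emeasure_lborel_Icc_eq)
    show "AE \<rho> in lborel. integrable lborel (\<lambda>x. case (\<rho>, x) of (\<rho>, x) \<Rightarrow> indicator {0..h} \<rho> * (norm (g (x + \<rho>)))\<^sup>2)"
      using L2_integrable[OF L2_shift(1)[OF g]] by simp
  qed measurable
  have Q_int: "integrable lborel Q"
    unfolding Q_def using lborel_pair.integrable_snd[OF Q] by simp
  have Q_eq: "(LINT x|lborel. Q x) = h * (LINT x|lborel. (norm (g x))\<^sup>2)"
    unfolding Q_def using lborel_pair.Fubini_integral[OF Q] h by (simp add: L2_shift(2)[OF g])
  have gi: "integrable lborel (\<lambda>\<rho>. indicator {0..h} \<rho> *\<^sub>R g (x + \<rho>))" for x
    using L2_integrable_on[OF L2_shift(1)[OF g, of x], of "{0..h}"]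
    by (simp add: add.commute emeasure_lborel_Icc_eq)
  have I_le: "(norm (I x))\<^sup>2 \<le> h * Q x" for x
  proof -
    have 1: "integrable lborel (\<lambda>\<rho>. indicator {0..h} \<rho> * norm (g (x + \<rho>)))"
      using integrable_norm[OF gi[of x]] by simp
    have 2: "integrable lborel (\<lambda>\<rho>. indicator {0..h} \<rho> * (norm (g (x + \<rho>)))\<^sup>2)"
      using integrable_mult_indicator[OF _ L2_integrable[OF L2_shift(1)[OF g, of x]], of "{0..h}"]
      by (simp add: add.commute)
    have "norm (I x) \<le> (LINT \<rho>|lborel. norm (indicator {0..h} \<rho> *\<^sub>R g (x + \<rho>)))"
      unfolding I_def by (rule integral_norm_bound)
    then have "norm (I x) \<le> (LINT \<rho>|lborel. indicator {0..h} \<rho> * norm (g (x + \<rho>)))"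
      by simp
    then have "(norm (I x))\<^sup>2 \<le> (LINT \<rho>|lborel. indicator {0..h} \<rho> * norm (g (x + \<rho>)))\<^sup>2"
      by (intro power_mono) auto
    also have "\<dots> \<le> h * Q x"
      unfolding Q_def by (rule integral_square_le[OF h 1 2])
    finally show ?thesis .
  qed
  have I2: "I \<in> L2" "(LINT x|lborel. (norm (I x))\<^sup>2) \<le> (LINT x|lborel. h * Q x)"
    using L2_bound[OF _ integrable_mult_right[OF Q_int] AE_I2[OF I_le]] by auto
  define w where "w x = f (x + h) - f x - I x" for x
  have D2: "(\<lambda>x. f (x + h) - f x) \<in> L2"
    using L2_shift(1)[OF f] f by (rule L2_diff)
  have w2: "w \<in> L2"
    unfolding w_def using D2 I2(1) by (rule L2_diff)
  have wi: "integrable lborel (\<lambda>x. indicator {a<..b} x *\<^sub>R w x)" for a b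
    by (cases "a \<le> b") (auto intro!: L2_integrable_on[OF w2] simp: emeasure_lborel_Ioc)
  have w0: "(LINT x|lborel. indicator {a<..b} x *\<^sub>R w x) = 0" if "a \<le> b" for a b
  proof -
    have "(LINT x|lborel. indicator {a<..b} x *\<^sub>R w x)
        = (LINT x|lborel. indicator {a<..b} x *\<^sub>R (f (x + h) - f x) - indicator {a<..b} x *\<^sub>R I x)"
      by (simp add: w_def scaleR_diff_right)
    also have "\<dots> = (LINT x|lborel. indicator {a<..b} x *\<^sub>R (f (x + h) - f x))
        - (LINT x|lborel. indicator {a<..b} x *\<^sub>R I x)"
      using that by (intro Bochner_Integration.integral_diff L2_integrable_on D2 I2)
        (auto simp: emeasure_lborel_Ioc)
    also have "\<dots> = 0"
      using weak_derivative_increment_interval[OF f g fg h that] by (simp add: I_def)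
    finally show ?thesis .
  qed
  have "AE x in lborel. Re (w x) = 0"
  proof (rule AE_zero_of_interval_integrals)
    show "integrable lborel (\<lambda>x. indicator {a<..b} x *\<^sub>R Re (w x))" for a b
      using integrable_Re[OF wi[of a b]] by simp
    show "(LINT x|lborel. indicator {a<..b} x *\<^sub>R Re (w x)) = 0" if "a \<le> b" for a b
      using integral_Re[OF wi[of a b]] w0[OF that] by simp
  qed
  moreover have "AE x in lborel. Im (w x) = 0"
  proof (rule AE_zero_of_interval_integrals)
    show "integrable lborel (\<lambda>x. indicator {a<..b} x *\<^sub>R Im (w x))" for a b
      using integrable_Im[OF wi[of a b]] by simp
    show "(LINT x|lborel. indicator {a<..b} x *\<^sub>R Im (w x)) = 0" if "a \<le> b" for a b
      using integral_Im[OF wi[of a b]] w0[OF that] by simp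
  qed
  ultimately have ae: "AE x in lborel. f (x + h) - f x = I x"
    by eventually_elim (simp add: w_def complex_eq_iff)
  have "(LINT x|lborel. (norm (f (x + h) - f x))\<^sup>2) = (LINT x|lborel. (norm (I x))\<^sup>2)"
    by (rule integral_cong_AE) (use ae in auto)
  also have "\<dots> \<le> (LINT x|lborel. h * Q x)"
    by (rule I2)
  also have "\<dots> = (LINT x|lborel. (norm (g x))\<^sup>2) * h\<^sup>2"
    using Q_eq by (simp add: power2_eq_square)
  finally show "(LINT x|lborel. (norm (f (x + h) - f x))\<^sup>2) \<le> (LINT x|lborel. (norm (g x))\<^sup>2) * h\<^sup>2" .
qed

lemma L2_Lipschitz_of_weak_derivative:
  assumes f: "f \<in> L2" and g: "g \<in> L2" and fg: "has_weak_derivative f g"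
  shows "L2_Lipschitz (LINT x|lborel. (norm (g x))\<^sup>2) f"
  unfolding L2_Lipschitz_def
proof (intro conjI allI f)
  fix h :: real
  consider "h > 0" | "h = 0" | "h < 0"
    by linarith
  then show "(LINT x|lborel. (norm (f (x + h) - f x))\<^sup>2) \<le> (LINT x|lborel. (norm (g x))\<^sup>2) * h\<^sup>2"
  proof cases
    case 1
    then show ?thesis
      by (rule weak_derivative_increment[OF f g fg])
  next
    case 3
    have "(LINT x|lborel. (norm (f (x + h) - f x))\<^sup>2) = (LINT x|lborel. (norm (f x - f (x + (- h))))\<^sup>2)"
      using integral_shift[of "\<lambda>x. (norm (f (x + h) - f x))\<^sup>2" "- h"] by simp
    also have "\<dots> = (LINT x|lborel. (norm (f (x + (- h)) - f x))\<^sup>2)"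
      by (simp add: norm_minus_commute)
    also have "\<dots> \<le> (LINT x|lborel. (norm (g x))\<^sup>2) * (- h)\<^sup>2"
      using 3 by (intro weak_derivative_increment[OF f g fg]) simp
    finally show ?thesis
      by simp
  qed simp
qed

lemma test_function_integrable:
  assumes "test_function \<phi>" "f \<in> L2"
  shows "integrable lborel (\<lambda>x. \<phi> x *\<^sub>R f x)" and "integrable lborel (\<lambda>x. deriv \<phi> x *\<^sub>R f x)"
proof -
  have \<phi>: "smooth \<phi>" "compact (closure {x. \<phi> x \<noteq> 0})"
    using assms(1) by (auto simp: test_function_def)
  obtain B where B: "\<And>x. x \<in> closure {x. \<phi> x \<noteq> 0} \<Longrightarrow> \<bar>x\<bar> \<le> B"
    using compact_imp_bounded[OF \<phi>(2)] by (auto simp: bounded_real)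
  have out: "\<phi> x = 0" if "x \<notin> {- B..B}" for x
  proof (rule ccontr)
    assume "\<phi> x \<noteq> 0"
    then have "x \<in> closure {x. \<phi> x \<noteq> 0}"
      by (intro subsetD[OF closure_subset]) simp
    from B[OF this] that show False
      by auto
  qed
  have out': "deriv \<phi> x = 0" if "x \<notin> {- B..B}" for x
  proof (rule DERIV_imp_deriv)
    have "((\<lambda>x. 0) has_field_derivative 0) (at x)"
      by simp
    then show "(\<phi> has_field_derivative 0) (at x)"
      by (rule has_field_derivative_transform_within_open[of _ _ _ "- {- B..B}"])
         (use that out in \<open>auto intro: open_Compl\<close>)
  qed
  have *: "integrable lborel (\<lambda>x. k x *\<^sub>R f x)"
    if "smooth k" "\<And>x. x \<notin> {- B..B} \<Longrightarrow> k x = 0" for k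
  proof -
    have "bounded (k ` {- B..B})"
      by (intro compact_imp_bounded compact_continuous_image smooth_continuous that) simp
    then obtain M where M: "\<And>x. x \<in> {- B..B} \<Longrightarrow> \<bar>k x\<bar> \<le> M"
      unfolding bounded_real by blast
    show ?thesis
    proof (rule test_function_integrable_mult[of k "max M 0" "- B" B])
      show "\<bar>k x\<bar> \<le> max M 0" for x
        using M[of x] that(2)[of x] by fastforce
      show "k \<in> borel_measurable borel"
        by (intro borel_measurable_continuous_onI smooth_continuous that)
    qed (use that assms in auto)
  qed
  show "integrable lborel (\<lambda>x. \<phi> x *\<^sub>R f x)" "integrable lborel (\<lambda>x. deriv \<phi> x *\<^sub>R f x)"
    by (rule *; use \<phi> out out' smooth_deriv in blast)+
qed

lemma H1_diff:
  assumes "f \<in> H1" "g \<in> H1"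
  shows "(\<lambda>x. f x - g x) \<in> H1"
proof -
  obtain f' g' where *: "f \<in> L2" "g \<in> L2" "f' \<in> L2" "g' \<in> L2"
    "has_weak_derivative f f'" "has_weak_derivative g g'"
    using assms by (auto simp: H1_def)
  have "has_weak_derivative (\<lambda>x. f x - g x) (\<lambda>x. f' x - g' x)"
    using * test_function_integrable
    by (auto simp: has_weak_derivative_def scaleR_diff_right)
  then show ?thesis
    using * by (auto simp: H1_def intro!: L2_diff bexI[of _ "\<lambda>x. f' x - g' x"])
qed

lemma Sigma_space_diff:
  assumes "f \<in> Sigma_space" "g \<in> Sigma_space"
  shows "(\<lambda>x. f x - g x) \<in> Sigma_space"
proof -
  have "(\<lambda>x. of_real x * f x - of_real x * g x) \<in> L2"
    using assms by (intro L2_diff) (auto simp: Sigma_space_def)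
  then show ?thesis
    using assms H1_diff by (auto simp: Sigma_space_def right_diff_distrib)
qed

lemma H1_L2_Lipschitz:
  assumes "f \<in> H1"
  shows "L2_Lipschitz ((H1_norm f)\<^sup>2) f"
proof -
  have f: "f \<in> L2" and "\<exists>g. g \<in> L2 \<and> has_weak_derivative f g"
    using assms by (auto simp: H1_def)
  from this(2) have g: "weak_derivative f \<in> L2 \<and> has_weak_derivative f (weak_derivative f)"
    unfolding weak_derivative_def by (rule someI_ex)
  have "(L2_norm (weak_derivative f))\<^sup>2 \<le> (H1_norm f)\<^sup>2"
    by (simp add: H1_norm_def)
  then have "(L2_norm (weak_derivative f))\<^sup>2 * h\<^sup>2 \<le> (H1_norm f)\<^sup>2 * h\<^sup>2" for h :: real
    by (intro mult_right_mono) auto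
  then show ?thesis
    using L2_Lipschitz_of_weak_derivative[OF f conjunct1[OF g] conjunct2[OF g]]
    unfolding L2_Lipschitz_def L2_norm_square[symmetric] by (meson order_trans)
qed

text \<open>
  The \<open>L\<^sup>1\<close> bound is linear in the norm because the scaling parameter of the weighted estimate may be
  chosen as the norm itself; continuity in \<open>\<Sigma>\<close> therefore implies continuity in \<open>L\<^sup>1\<close>.
\<close>

lemma Sigma_space_bounds:
  assumes "f \<in> Sigma_space"
  shows "f \<in> L2" and "integrable lborel f"
    and "L2_Lipschitz ((Sigma_norm f)\<^sup>2) f"
    and "(LINT x|lborel. (norm (f x))\<^sup>2) \<le> (Sigma_norm f)\<^sup>2"
    and "(LINT x|lborel. norm (f x)) \<le> (pi + 2) * Sigma_norm f"
    and "0 \<le> Sigma_norm f"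
proof -
  have *: "f \<in> H1" "f \<in> L2" "(\<lambda>x. of_real x * f x) \<in> L2"
    using assms by (auto simp: Sigma_space_def H1_def)
  show "f \<in> L2" by fact
  show i: "integrable lborel f"
    by (rule integrable_of_weighted_L2(1)[OF *(2,3), of 1]) simp
  let ?x = "L2_norm (\<lambda>x. of_real x * f x)"
  have h0: "0 \<le> H1_norm f"
    by (simp add: H1_norm_def)
  have h1: "H1_norm f \<le> Sigma_norm f" "?x \<le> Sigma_norm f"
    using h0 by (auto simp: Sigma_norm_def)
  show s0: "0 \<le> Sigma_norm f"
    using h0 h1 by linarith
  have sq: "(H1_norm f)\<^sup>2 \<le> (Sigma_norm f)\<^sup>2" "?x\<^sup>2 \<le> (Sigma_norm f)\<^sup>2"
    using h1 h0 by (auto intro!: power_mono)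
  show "L2_Lipschitz ((Sigma_norm f)\<^sup>2) f"
    using H1_L2_Lipschitz[OF *(1)] mult_right_mono[OF sq(1)] unfolding L2_Lipschitz_def
    by (meson order_trans zero_le_power2)
  have "(L2_norm f)\<^sup>2 \<le> (H1_norm f)\<^sup>2"
    by (simp add: H1_norm_def)
  then show f2: "(LINT x|lborel. (norm (f x))\<^sup>2) \<le> (Sigma_norm f)\<^sup>2"
    using sq by (simp add: L2_norm_square)
  have bound: "(LINT x|lborel. norm (f x)) \<le> c * pi + 2 * (Sigma_norm f)\<^sup>2 / c" if "c > 0" for c
  proof -
    have "((LINT x|lborel. (norm (f x))\<^sup>2) + (LINT x|lborel. (norm (of_real x * f x))\<^sup>2)) / c
        \<le> 2 * (Sigma_norm f)\<^sup>2 / c"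
      using f2 sq(2) that by (intro divide_right_mono) (auto simp: L2_norm_square)
    then show ?thesis
      using integrable_of_weighted_L2(2)[OF *(2,3) that] by linarith
  qed
  show "(LINT x|lborel. norm (f x)) \<le> (pi + 2) * Sigma_norm f"
  proof (cases "Sigma_norm f = 0")
    case True
    have "(LINT x|lborel. norm (f x)) \<le> 0 + e" if "e > 0" for e
      using bound[of "e / pi"] that True by simp
    then have "(LINT x|lborel. norm (f x)) \<le> 0"
      by (rule field_le_epsilon)
    then show ?thesis
      using True by simp
  next
    case False
    then show ?thesis
      using bound[of "Sigma_norm f"] s0 by (simp add: power2_eq_square algebra_simps)
  qed
qed

section \<open>The dispersive estimate\<close>

lemma Fresnel_tail_bound:
  fixes a b :: real
  assumes "1 \<le> a" "a \<le> b"
  shows "norm (integral {a..b} (\<lambda>x. cis (x\<^sup>2))) \<le> 1"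
proof -
  \<comment> \<open>one integration by parts: \<open>F\<close> is the boundary term, and the remainder is dominated by the
    derivative of \<open>- 1 / (2 * x)\<close>\<close>
  define F where "F x = - \<i> * of_real (1 / (2 * x)) * cis (x\<^sup>2)" for x :: real
  define F' where "F' x = cis (x\<^sup>2) + \<i> * of_real (1 / (2 * x\<^sup>2)) * cis (x\<^sup>2)" for x :: real
  have cis_deriv: "((\<lambda>x. cis (x\<^sup>2)) has_vector_derivative (2 * x) *\<^sub>R (\<i> * cis (x\<^sup>2))) (at x within S)" for x S
  proof -
    have "((\<lambda>x. exp (\<i> * of_real (x\<^sup>2))) has_vector_derivative (\<i> * of_real (2 * x)) * exp (\<i> * of_real (x\<^sup>2))) (at x within S)"
      by (auto intro!: derivative_eq_intros has_vector_derivative_real_field simp: field_simps)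
    then show ?thesis
      by (simp add: cis_conv_exp scaleR_conv_of_real mult_ac)
  qed
  have F: "(F has_vector_derivative F' x) (at x within {a..b})" if "x \<in> {a..b}" for x
  proof -
    have "x \<noteq> 0"
      using that assms by auto
    then have "((\<lambda>x. 1 / (2 * x)) has_real_derivative (- 1 / (2 * x\<^sup>2))) (at x within {a..b})"
      by (auto intro!: derivative_eq_intros simp: power2_eq_square)
    from has_vector_derivative_scaleR[OF this cis_deriv[of x "{a..b}"]]
    have "((\<lambda>x. (1 / (2 * x)) *\<^sub>R cis (x\<^sup>2)) has_vector_derivative
        (1 / (2 * x)) *\<^sub>R (2 * x) *\<^sub>R (\<i> * cis (x\<^sup>2)) + (- 1 / (2 * x\<^sup>2)) *\<^sub>R cis (x\<^sup>2)) (at x within {a..b})" .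
    from has_vector_derivative_mult_right[OF this, of "- \<i>"] show ?thesis
      using \<open>x \<noteq> 0\<close> by (simp add: F_def[abs_def] F'_def scaleR_conv_of_real mult.assoc algebra_simps)
  qed
  have 1: "(F' has_integral F b - F a) {a..b}"
    by (rule fundamental_theorem_of_calculus[OF assms(2) F])
  have "((\<lambda>x. 1 / (2 * x\<^sup>2)) has_integral (- (1 / (2 * b)) - - (1 / (2 * a)))) {a..b}"
  proof (rule fundamental_theorem_of_calculus[OF assms(2)])
    fix x assume "x \<in> {a..b}"
    then have "((\<lambda>x. - (1 / (2 * x))) has_real_derivative (1 / (2 * x\<^sup>2))) (at x within {a..b})"
      using assms by (auto intro!: derivative_eq_intros simp: power2_eq_square)
    then show "((\<lambda>x. - (1 / (2 * x))) has_vector_derivative 1 / (2 * x\<^sup>2)) (at x within {a..b})"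
      by (simp add: has_real_derivative_iff_has_vector_derivative)
  qed
  then have 2: "(\<lambda>x. 1 / (2 * x\<^sup>2)) integrable_on {a..b}"
    "integral {a..b} (\<lambda>x. 1 / (2 * x\<^sup>2)) = 1 / (2 * a) - 1 / (2 * b)"
    by (auto simp: has_integral_iff)
  have 3: "(\<lambda>x. cis (x\<^sup>2)) integrable_on {a..b}"
    by (intro integrable_continuous_interval continuous_intros)
  have "integral {a..b} (\<lambda>x. cis (x\<^sup>2)) = (F b - F a) + integral {a..b} (\<lambda>x. cis (x\<^sup>2) - F' x)"
    using 1 3 by (simp add: has_integral_iff integral_diff)
  also have "norm \<dots> \<le> (norm (F b) + norm (F a)) + integral {a..b} (\<lambda>x. 1 / (2 * x\<^sup>2))"
  proof (intro norm_triangle_mono norm_triangle_ineq4)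
    show "norm (integral {a..b} (\<lambda>x. cis (x\<^sup>2) - F' x)) \<le> integral {a..b} (\<lambda>x. 1 / (2 * x\<^sup>2))"
    proof (rule integral_norm_bound_integral)
      show "(\<lambda>x. cis (x\<^sup>2) - F' x) integrable_on {a..b}"
        using 1 3 by (auto intro!: integrable_diff simp: has_integral_iff)
    qed (use 2 in \<open>auto simp: F'_def norm_mult norm_divide norm_power\<close>)
  qed
  also have "\<dots> \<le> 1 / (2 * b) + 1 / (2 * a) + (1 / (2 * a) - 1 / (2 * b))"
    using assms 2(2) by (simp add: F_def norm_mult norm_divide)
  also have "\<dots> \<le> 1"
    using assms by simp
  finally show ?thesis .
qed

lemma Fresnel_bound_from_0:
  assumes "0 \<le> c"
  shows "norm (integral {0..c} (\<lambda>x. cis (x\<^sup>2))) \<le> 2"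
proof -
  have int: "(\<lambda>x. cis (x\<^sup>2)) integrable_on {a..b}" for a b :: real
    by (intro integrable_continuous_interval continuous_intros)
  have short: "norm (integral {0..d} (\<lambda>x. cis (x\<^sup>2))) \<le> d" if "0 \<le> d" for d
  proof -
    have "continuous_on {0..d} (\<lambda>x. cis (x\<^sup>2))"
      by (intro continuous_intros)
    then show ?thesis
      using integral_bound[of 0 d "\<lambda>x. cis (x\<^sup>2)" 1] that by simp
  qed
  show ?thesis
  proof (cases "c \<le> 1")
    case True
    then show ?thesis
      using short[OF assms] by simp
  next
    case False
    then have "integral {0..c} (\<lambda>x. cis (x\<^sup>2)) = integral {0..1} (\<lambda>x. cis (x\<^sup>2)) + integral {1..c} (\<lambda>x. cis (x\<^sup>2))"
      using Henstock_Kurzweil_Integration.integral_combine[OF _ _ int, of 0 1 c] by simp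
    then show ?thesis
      using norm_triangle_mono[OF short[of 1] Fresnel_tail_bound[of 1 c]] False by simp
  qed
qed

lemma Fresnel_bound:
  "norm (LINT x|lborel. indicator {a..b} x *\<^sub>R cis (x\<^sup>2)) \<le> 4"
proof -
  have int: "(\<lambda>x. cis (x\<^sup>2)) integrable_on {a..b}" for a b :: real
    by (intro integrable_continuous_interval continuous_intros)
  have "(LINT x|lborel. indicator {a..b} x *\<^sub>R cis (x\<^sup>2)) = integral {a..b} (\<lambda>x. cis (x\<^sup>2))"
    using set_borel_integral_eq_integral(2)[of "{a..b}" "\<lambda>x. cis (x\<^sup>2)"]
      borel_integrable_compact[of "{a..b}" "\<lambda>x. cis (x\<^sup>2)"]
    by (simp add: set_lebesgue_integral_def set_integrable_def continuous_intros)
  moreover have "norm (integral {a..b} (\<lambda>x. cis (x\<^sup>2))) \<le> 4"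
  proof -
    have *: "norm (integral {c..d} (\<lambda>x. cis (x\<^sup>2))) \<le> 4" if "0 \<le> c" "c \<le> d" for c d
    proof -
      have "integral {c..d} (\<lambda>x. cis (x\<^sup>2)) = integral {0..d} (\<lambda>x. cis (x\<^sup>2)) - integral {0..c} (\<lambda>x. cis (x\<^sup>2))"
        using Henstock_Kurzweil_Integration.integral_combine[OF that int] by (simp add: algebra_simps)
      then show ?thesis
        using norm_triangle_ineq4[of "integral {0..d} (\<lambda>x. cis (x\<^sup>2))" "integral {0..c} (\<lambda>x. cis (x\<^sup>2))"]
          Fresnel_bound_from_0[of d] Fresnel_bound_from_0[of c] that by simp
    qed
    have reflect: "integral {c..d} (\<lambda>x. cis (x\<^sup>2)) = integral {- d..- c} (\<lambda>x. cis (x\<^sup>2))" for c d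
      using Henstock_Kurzweil_Integration.integral_reflect_real[of d c "\<lambda>x. cis (x\<^sup>2)"] by simp
    consider "b < a" | "0 \<le> a" "a \<le> b" | "b \<le> 0" "a \<le> b" | "a < 0" "0 < b"
      by linarith
    then show ?thesis
    proof cases
      case 2
      then show ?thesis by (rule *)
    next
      case 3
      then show ?thesis
        unfolding reflect[of a b] by (intro *) auto
    next
      case 4
      then have "integral {a..b} (\<lambda>x. cis (x\<^sup>2)) = integral {a..0} (\<lambda>x. cis (x\<^sup>2)) + integral {0..b} (\<lambda>x. cis (x\<^sup>2))"
        using Henstock_Kurzweil_Integration.integral_combine[OF _ _ int, of a 0 b] by simp
      then show ?thesis
        unfolding reflect[of a 0]
        using norm_triangle_mono[OF Fresnel_bound_from_0[of "- a"] Fresnel_bound_from_0[of b]] 4 by simp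
    qed simp
  qed
  ultimately show ?thesis
    by simp
qed

text \<open>The truncation makes the multiplier of the Schroedinger group integrable.\<close>

definition truncated_phase :: "real \<Rightarrow> real \<Rightarrow> real \<Rightarrow> complex" where
  "truncated_phase R \<tau> \<zeta> = indicator {- R..R} \<zeta> *\<^sub>R cis (\<tau> * \<zeta>\<^sup>2)"

lemma truncated_phase_integrable: "integrable lborel (truncated_phase R \<tau>)"
  unfolding truncated_phase_def
  using borel_integrable_compact[of "{- R..R}" "\<lambda>\<zeta>. cis (\<tau> * \<zeta>\<^sup>2)"]
  by (simp add: set_integrable_def continuous_intros)

lemma cnj_truncated_phase: "cnj (truncated_phase R \<tau> \<zeta>) = truncated_phase R (- \<tau>) \<zeta>"
  by (simp add: truncated_phase_def cis_cnj)

text \<open>Completing the square reduces the transform to a Fresnel integral.\<close>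

lemma fourier_truncated_phase:
  assumes "\<tau> \<noteq> 0"
  shows "norm (fourier (truncated_phase R \<tau>) x) \<le> 4 * \<bar>\<tau>\<bar> powr (- 1 / 2)"
proof -
  have pos: "norm (fourier (truncated_phase R \<tau>) x) \<le> 4 * \<bar>\<tau>\<bar> powr (- 1 / 2)" if \<tau>: "\<tau> > 0" for \<tau> x
  proof -
    define r where "r = sqrt \<tau>"
    have r: "r > 0" "r\<^sup>2 = \<tau>"
      using \<tau> by (auto simp: r_def)
    define t where "t = x / (2 * r)"
    have phase: "cis (- (x * \<zeta>)) * truncated_phase R \<tau> \<zeta>
        = cis (- t\<^sup>2) * (indicator {r * (- R) - t..r * R - t} (r * \<zeta> - t) *\<^sub>R cis ((r * \<zeta> - t)\<^sup>2))" for \<zeta>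
    proof -
      have "- (x * \<zeta>) + \<tau> * \<zeta>\<^sup>2 = - t\<^sup>2 + (r * \<zeta> - t)\<^sup>2"
        using r by (simp add: t_def power2_diff power_mult_distrib)
      then have "cis (- (x * \<zeta>)) * cis (\<tau> * \<zeta>\<^sup>2) = cis (- t\<^sup>2) * cis ((r * \<zeta> - t)\<^sup>2)"
        unfolding cis_mult by (rule arg_cong)
      moreover have "indicator {- R..R} \<zeta> = (indicator {r * (- R) - t..r * R - t} (r * \<zeta> - t) :: real)"
      proof -
        have "- R \<le> \<zeta> \<longleftrightarrow> r * (- R) \<le> r * \<zeta>" "\<zeta> \<le> R \<longleftrightarrow> r * \<zeta> \<le> r * R"
          using r(1) by (simp_all only: mult_le_cancel_left_pos)
        then show ?thesis
          by (auto simp: indicator_def)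
      qed
      ultimately show ?thesis
        by (simp add: truncated_phase_def)
    qed
    have "fourier (truncated_phase R \<tau>) x
        = cis (- t\<^sup>2) * (LINT \<zeta>|lborel. indicator {r * (- R) - t..r * R - t} (r * \<zeta> - t) *\<^sub>R cis ((r * \<zeta> - t)\<^sup>2))"
      unfolding fourier_def phase by (rule integral_mult_right_zero)
    also have "(LINT \<zeta>|lborel. indicator {r * (- R) - t..r * R - t} (r * \<zeta> - t) *\<^sub>R cis ((r * \<zeta> - t)\<^sup>2))
        = (1 / r) *\<^sub>R (LINT \<eta>|lborel. indicator {r * (- R) - t..r * R - t} \<eta> *\<^sub>R cis (\<eta>\<^sup>2))"
      using lborel_integral_real_affine[of r "\<lambda>\<eta>. indicator {r * (- R) - t..r * R - t} \<eta> *\<^sub>R cis (\<eta>\<^sup>2)" "- t"] r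
      by (simp add: algebra_simps)
    finally have "norm (fourier (truncated_phase R \<tau>) x)
        = (1 / r) * norm (LINT \<eta>|lborel. indicator {r * (- R) - t..r * R - t} \<eta> *\<^sub>R cis (\<eta>\<^sup>2))"
      using r by (simp add: norm_mult)
    also have "\<dots> \<le> (1 / r) * 4"
      using r by (intro mult_left_mono Fresnel_bound) auto
    also have "1 / r = \<bar>\<tau>\<bar> powr (- 1 / 2)"
      using \<tau> by (simp add: r_def powr_half_sqrt[symmetric] powr_minus_divide[symmetric])
    finally show ?thesis
      by simp
  qed
  show ?thesis
  proof (cases "\<tau> > 0")
    case False
    have "cnj (fourier (truncated_phase R (- \<tau>)) (- x)) = (LINT \<zeta>|lborel. cnj (cis (- (- x * \<zeta>)) * truncated_phase R (- \<tau>) \<zeta>))"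
      unfolding fourier_def by (rule Bochner_Integration.integral_cnj[symmetric])
    also have "\<dots> = fourier (truncated_phase R \<tau>) x"
      by (simp add: fourier_def cnj_truncated_phase cis_cnj)
    finally show ?thesis
      using pos[of "- \<tau>" "- x"] False assms by (metis abs_minus_cancel complex_mod_cnj neg_0_less_iff_less not_less_iff_gr_or_eq)
  qed (rule pos)
qed

text \<open>
  The truncation in frequency is harmless because the kernel is bounded uniformly in it; this is the
  decay of the free evolution from \<open>L\<^sup>1\<close> to \<open>L\<^sup>\<infinity>\<close>, paired with a second integrable function.
\<close>

lemma dispersive_pairing:
  assumes f: "integrable lborel f" and g: "integrable lborel g" and \<tau>: "\<tau> \<noteq> 0"
  shows "norm (LINT \<zeta>|lborel. truncated_phase R \<tau> \<zeta> * fourier f \<zeta> * cnj (fourier g \<zeta>))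
    \<le> 4 * \<bar>\<tau>\<bar> powr (- 1 / 2) * (LINT y|lborel. norm (f y)) * (LINT y|lborel. norm (g y))"
proof -
  define C where "C = 4 * \<bar>\<tau>\<bar> powr (- 1 / 2)"
  define N where "N = (LINT y|lborel. norm (g y))"
  have inner: "norm (LINT z|lborel. g z * fourier (\<lambda>\<zeta>. cnj (truncated_phase R \<tau> \<zeta>)) (z - y)) \<le> C * N" for y
  proof -
    have "norm (LINT z|lborel. g z * fourier (\<lambda>\<zeta>. cnj (truncated_phase R \<tau> \<zeta>)) (z - y))
        \<le> (LINT z|lborel. norm (g z) * C)"
    proof (rule norm_integral_le)
      have "norm (fourier (\<lambda>\<zeta>. cnj (truncated_phase R \<tau> \<zeta>)) z) \<le> C" for z
        using fourier_truncated_phase[of "- \<tau>" R z] \<tau> by (simp add: C_def cnj_truncated_phase)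
      then show "AE z in lborel. norm (g z * fourier (\<lambda>\<zeta>. cnj (truncated_phase R \<tau> \<zeta>)) (z - y)) \<le> norm (g z) * C"
        by (auto simp: norm_mult intro!: mult_left_mono)
    qed (use g in simp)
    then show ?thesis
      by (simp add: N_def mult.commute)
  qed
  have "norm (LINT \<zeta>|lborel. truncated_phase R \<tau> \<zeta> * fourier f \<zeta> * cnj (fourier g \<zeta>))
      \<le> (LINT y|lborel. norm (f y) * (C * N))"
    unfolding fourier_pairing[OF truncated_phase_integrable f g]
  proof (rule norm_integral_le)
    show "AE y in lborel. norm (f y * cnj (LINT z|lborel. g z * fourier (\<lambda>\<zeta>. cnj (truncated_phase R \<tau> \<zeta>)) (z - y)))
        \<le> norm (f y) * (C * N)"
      using inner by (auto simp: norm_mult intro!: mult_left_mono)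
  qed (use f in simp)
  then show ?thesis
    by (simp add: C_def N_def mult_ac)
qed

section \<open>Oscillatory tails in \<open>L\<^sup>2\<close>\<close>

lemma power_tail_integral:
  fixes T :: real
  assumes "T \<ge> 1"
  shows "integrable lborel (\<lambda>s. indicator {T..} s * s powr (- 5 / 2))"
    and "(LINT s|lborel. indicator {T..} s * s powr (- 5 / 2)) = 2 / 3 * T powr (- 3 / 2)"
proof -
  have hi: "((\<lambda>s. s powr (- 5 / 2)) has_integral 2 / 3 * T powr (- 3 / 2)) {T..}"
    using has_integral_powr_to_inf[of "- 5 / 2" T] assms by (simp add: field_simps)
  have "(\<integral>\<^sup>+ s. ennreal (indicator {T..} s * s powr (- 5 / 2)) \<partial>lborel) = ennreal (2 / 3 * T powr (- 3 / 2))"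
  proof (rule nn_integral_has_integral_lborel)
    show "((\<lambda>s. indicator {T..} s * s powr (- 5 / 2)) has_integral 2 / 3 * T powr (- 3 / 2)) UNIV"
      by (rule has_integral_eq[OF _ iffD2[OF has_integral_restrict_UNIV hi]]) (auto simp: indicator_def)
  qed auto
  then have "has_bochner_integral lborel (\<lambda>s. indicator {T..} s * s powr (- 5 / 2)) (2 / 3 * T powr (- 3 / 2))"
    by (intro has_bochner_integral_nn_integral) auto
  then show "integrable lborel (\<lambda>s. indicator {T..} s * s powr (- 5 / 2))"
    and "(LINT s|lborel. indicator {T..} s * s powr (- 5 / 2)) = 2 / 3 * T powr (- 3 / 2)"
    by (auto simp: has_bochner_integral_iff)
qed

lemma inverse_sqrt_integral:
  fixes T :: real
  assumes "T \<ge> 1"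
  shows "integrable lborel (\<lambda>x. indicator {- T..T} x * \<bar>x\<bar> powr (- 1 / 2))"
    and "(LINT x|lborel. indicator {- T..T} x * \<bar>x\<bar> powr (- 1 / 2)) = 4 * T powr (1 / 2)"
proof -
  define k where "k x = indicator {0..T} x * x powr (- 1 / 2)" for x :: real
  have hi: "((\<lambda>x. x powr (- 1 / 2)) has_integral 2 * T powr (1 / 2)) {0..T}"
    using has_integral_powr_from_0[of "- 1 / 2" T] assms by (simp add: field_simps)
  have "(\<integral>\<^sup>+ x. ennreal (k x) \<partial>lborel) = ennreal (2 * T powr (1 / 2))"
  proof (rule nn_integral_has_integral_lborel)
    show "(k has_integral 2 * T powr (1 / 2)) UNIV"
      by (rule has_integral_eq[OF _ iffD2[OF has_integral_restrict_UNIV hi]]) (auto simp: k_def indicator_def)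
  qed (auto simp: k_def[abs_def])
  then have "has_bochner_integral lborel k (2 * T powr (1 / 2))"
    by (intro has_bochner_integral_nn_integral) (auto simp: k_def[abs_def])
  then have k: "integrable lborel k" "(LINT x|lborel. k x) = 2 * T powr (1 / 2)"
    by (auto simp: has_bochner_integral_iff)
  have k': "integrable lborel (\<lambda>x. k (- x))" "(LINT x|lborel. k (- x)) = 2 * T powr (1 / 2)"
    using lborel_integrable_real_affine[OF k(1), of "-1" 0] lborel_integral_real_affine[of "-1" k 0] k(2)
    by auto
  have eq: "(\<lambda>x. indicator {- T..T} x * \<bar>x\<bar> powr (- 1 / 2)) = (\<lambda>x. k x + k (- x))"
    by (auto simp: k_def indicator_def fun_eq_iff)
  show "integrable lborel (\<lambda>x. indicator {- T..T} x * \<bar>x\<bar> powr (- 1 / 2))"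
    and "(LINT x|lborel. indicator {- T..T} x * \<bar>x\<bar> powr (- 1 / 2)) = 4 * T powr (1 / 2)"
    unfolding eq using k k' by auto
qed

text \<open>Split at \<open>\<bar>s - r\<bar> = T\<close>: near the singularity \<open>r powr (- 5 / 2)\<close> is at most its value at \<open>T\<close>, and far from
  it the singular factor is.\<close>

lemma fractional_convolution_bound:
  fixes T s :: real
  assumes T: "T \<ge> 1"
  shows "integrable lborel (\<lambda>r. indicator {T..} r * r powr (- 5 / 2) * \<bar>s - r\<bar> powr (- 1 / 2))"
    and "(LINT r|lborel. indicator {T..} r * r powr (- 5 / 2) * \<bar>s - r\<bar> powr (- 1 / 2)) \<le> 14 / 3 * T powr (- 2)"
proof -
  define J where "J r = indicator {T..} r * r powr (- 5 / 2) * \<bar>s - r\<bar> powr (- 1 / 2)" for r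
  define N where "N x = indicator {- T..T} x * \<bar>x\<bar> powr (- 1 / 2)" for x
  define M where "M r = T powr (- 5 / 2) * N (s - r)
      + T powr (- 1 / 2) * (indicator {T..} r * r powr (- 5 / 2))" for r
  have N: "integrable lborel (\<lambda>r. N (s - r))" "(LINT r|lborel. N (s - r)) = 4 * T powr (1 / 2)"
    using lborel_integrable_real_affine[OF inverse_sqrt_integral(1)[OF T, folded N_def], of "-1" s]
      lborel_integral_real_affine[of "-1" N s] inverse_sqrt_integral(2)[OF T, folded N_def]
    by auto
  have le: "J r \<le> M r" for r
  proof (cases "r \<ge> T \<and> r \<noteq> s")
    case True
    then have r: "r > 0" "r \<noteq> s"
      using T by auto
    show ?thesis
    proof (cases "\<bar>s - r\<bar> \<le> T")
      case near: True
      have "r powr (- 5 / 2) \<le> T powr (- 5 / 2)"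
        using True T by (intro powr_mono2') auto
      then have "J r \<le> T powr (- 5 / 2) * N (s - r)"
        using near True by (auto simp: J_def N_def abs_le_iff intro!: mult_right_mono)
      also have "\<dots> \<le> M r"
        by (simp add: M_def)
      finally show ?thesis .
    next
      case False
      then have "\<bar>s - r\<bar> powr (- 1 / 2) \<le> T powr (- 1 / 2)"
        using T by (intro powr_mono2') auto
      then have "J r \<le> r powr (- 5 / 2) * T powr (- 1 / 2)"
        using True by (auto simp: J_def intro!: mult_left_mono)
      also have "\<dots> \<le> M r"
        using True by (simp add: M_def N_def)
      finally show ?thesis .
    qed
  next
    case False
    then have "J r = 0"
      by (auto simp: J_def)
    then show ?thesis
      by (simp add: M_def N_def)
  qed
  have Mi: "integrable lborel M"
    unfolding M_def using N(1) power_tail_integral(1)[OF T] by auto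
  have J0: "0 \<le> J r" for r
    by (simp add: J_def)
  have i: "integrable lborel J"
  proof (rule Bochner_Integration.integrable_bound[OF Mi])
    show "AE r in lborel. norm (J r) \<le> norm (M r)"
      using le J0 by (intro AE_I2) (metis abs_of_nonneg order_trans real_norm_def)
  qed (simp add: J_def[abs_def])
  then show "integrable lborel (\<lambda>r. indicator {T..} r * r powr (- 5 / 2) * \<bar>s - r\<bar> powr (- 1 / 2))"
    by (simp add: J_def[abs_def])
  have "(LINT r|lborel. J r) \<le> (LINT r|lborel. M r)"
    by (rule integral_mono[OF i Mi le])
  also have "\<dots> = T powr (- 5 / 2) * (4 * T powr (1 / 2)) + T powr (- 1 / 2) * (2 / 3 * T powr (- 3 / 2))"
    unfolding M_def using N power_tail_integral[OF T] by simp
  also have "T powr (- 5 / 2) * (4 * T powr (1 / 2)) = 4 * T powr (- 2)"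
    by (simp add: powr_add[symmetric])
  also have "T powr (- 1 / 2) * (2 / 3 * T powr (- 3 / 2)) = 2 / 3 * T powr (- 2)"
    by (simp add: powr_add[symmetric])
  finally show "(LINT r|lborel. indicator {T..} r * r powr (- 5 / 2) * \<bar>s - r\<bar> powr (- 1 / 2)) \<le> 14 / 3 * T powr (- 2)"
    by (simp add: J_def[abs_def])
qed


text \<open>
  The argument is \<open>TT\<^sup>*\<close>: expanding the square and integrating in frequency first, the dispersive
  estimate replaces the pairing of the times \<open>s\<close> and \<open>r\<close> by \<open>\<bar>s - r\<bar> powr (- 1 / 2)\<close>. Compared with
  Minkowski's inequality this gains \<open>T powr (- 1 / 4)\<close>. It is the dual Strichartz estimate for the
  exponents \<open>(4, \<infinity>)\<close>; the power bound for the \<open>L\<^sup>1\<close> norms turns the fractional integration in time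
  into an elementary integral.
\<close>

lemma oscillatory_tail_L2:
  fixes q :: "real \<Rightarrow> real \<Rightarrow> complex" and T A :: real
  defines "D \<equiv> \<lambda>s \<zeta>. indicator {T..} s *\<^sub>R (cis (s * \<zeta>\<^sup>2) * fourier (q s) \<zeta>)"
  assumes T: "T \<ge> 1" and A: "A \<ge> 0"
    and q: "\<And>s. s \<ge> T \<Longrightarrow> integrable lborel (q s)"
    and qA: "\<And>s. s \<ge> T \<Longrightarrow> (LINT y|lborel. norm (q s y)) \<le> A * s powr (- 5 / 2)"
    and meas: "(\<lambda>(s, \<zeta>). D s \<zeta>) \<in> borel_measurable (lborel \<Otimes>\<^sub>M lborel)"
  shows "\<And>\<zeta>. integrable lborel (\<lambda>s. D s \<zeta>)"
    and "\<And>\<zeta>. norm (LINT s|lborel. D s \<zeta>) \<le> 2 / 3 * A * T powr (- 3 / 2)"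
    and "(\<lambda>\<zeta>. LINT s|lborel. D s \<zeta>) \<in> L2"
    and "(LINT \<zeta>|lborel. (norm (LINT s|lborel. D s \<zeta>))\<^sup>2) \<le> 112 / 9 * A\<^sup>2 * T powr (- 7 / 2)"
proof -
  define w where "w s = A * (indicator {T..} s * s powr (- 5 / 2))" for s
  have w: "integrable lborel w" "(LINT s|lborel. w s) = 2 / 3 * A * T powr (- 3 / 2)"
    using power_tail_integral[OF T] by (auto simp: w_def[abs_def])
  have w0: "0 \<le> w s" for s
    using A by (simp add: w_def)
  have [measurable]: "w \<in> borel_measurable borel"
    using w by auto
  have D2[measurable]: "(\<lambda>p. D (fst p) (snd p)) \<in> borel_measurable (lborel \<Otimes>\<^sub>M lborel)"
    using meas by (simp add: split_beta')
  have D_swap[measurable]: "(\<lambda>p. D (snd p) (fst p)) \<in> borel_measurable (lborel \<Otimes>\<^sub>M lborel)"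
    using measurable_compose[OF measurable_Pair[OF measurable_snd measurable_fst] D2] by simp
  have D1[measurable]: "(\<lambda>s. D s \<zeta>) \<in> borel_measurable borel" for \<zeta>
    using measurable_compose[OF measurable_Pair2' D2, of \<zeta>] by simp
  have D1'[measurable]: "D s \<in> borel_measurable borel" for s
    using measurable_compose[OF measurable_Pair1' D2, of s] by simp
  have D_le: "norm (D s \<zeta>) \<le> w s" for s \<zeta>
    using order_trans[OF norm_fourier_le[OF q] qA, of s \<zeta>]
    by (auto simp: D_def w_def norm_mult indicator_def)
  show Di: "integrable lborel (\<lambda>s. D s \<zeta>)" for \<zeta>
    by (rule Bochner_Integration.integrable_bound[OF w(1)]) (use D_le w0 in auto)
  define I where "I \<zeta> = (LINT s|lborel. D s \<zeta>)" for \<zeta>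
  have I_meas[measurable]: "I \<in> borel_measurable borel"
    unfolding I_def by measurable
  have I_le: "norm (I \<zeta>) \<le> 2 / 3 * A * T powr (- 3 / 2)" for \<zeta>
    unfolding I_def w(2)[symmetric] by (rule norm_integral_le[OF w(1)]) (use D_le in auto)
  then show "norm (LINT s|lborel. D s \<zeta>) \<le> 2 / 3 * A * T powr (- 3 / 2)" for \<zeta>
    by (simp add: I_def)
  define M where "M = 2 / 3 * A * T powr (- 3 / 2)"
  have M0: "0 \<le> M"
    using A by (simp add: M_def)
  define cut where "cut R \<zeta> = complex_of_real (indicator {- R..R} \<zeta>)" for R \<zeta> :: real
  have cuti: "integrable lborel (\<lambda>\<zeta>. norm (cut R \<zeta>))" for R
    by (simp add: cut_def emeasure_lborel_Icc_eq)
  have [measurable]: "cut R \<in> borel_measurable borel" for R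
    unfolding cut_def by measurable
  have pair: "integrable (lborel \<Otimes>\<^sub>M lborel) (\<lambda>(\<zeta>, s). F \<zeta> s)"
    if m: "(\<lambda>(\<zeta>, s). F \<zeta> s) \<in> borel_measurable (lborel \<Otimes>\<^sub>M lborel)"
      and le: "\<And>\<zeta> s. norm (F \<zeta> s) \<le> norm (cut R \<zeta>) * (B * w s)" and B: "0 \<le> B"
    for F :: "real \<Rightarrow> real \<Rightarrow> complex" and R B
  proof (rule Bochner_Integration.integrable_bound[OF _ m])
    show "integrable (lborel \<Otimes>\<^sub>M lborel) (\<lambda>(\<zeta>, s). norm (cut R \<zeta>) * (B * w s))"
    proof (rule lborel_pair.Fubini_integrable)
      show "integrable lborel (\<lambda>\<zeta>. LINT s|lborel. norm (case (\<zeta>, s) of (\<zeta>, s) \<Rightarrow> norm (cut R \<zeta>) * (B * w s)))"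
        using cuti[of R] w0 B by (simp add: abs_mult)
      show "AE \<zeta> in lborel. integrable lborel (\<lambda>s. case (\<zeta>, s) of (\<zeta>, s) \<Rightarrow> norm (cut R \<zeta>) * (B * w s))"
        using w by auto
    qed measurable
    show "AE p in lborel \<Otimes>\<^sub>M lborel. norm (case p of (\<zeta>, s) \<Rightarrow> F \<zeta> s)
        \<le> norm (case p of (\<zeta>, s) \<Rightarrow> norm (cut R \<zeta>) * (B * w s))"
      using le w0 B by (auto simp: abs_mult)
  qed
  have bound: "integrable lborel (\<lambda>\<zeta>. indicator {- R..R} \<zeta> * (norm (I \<zeta>))\<^sup>2)
      \<and> (LINT \<zeta>|lborel. indicator {- R..R} \<zeta> * (norm (I \<zeta>))\<^sup>2) \<le> 112 / 9 * A\<^sup>2 * T powr (- 7 / 2)" for R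
  proof -
    \<comment> \<open>the pairing of the time \<open>s\<close> with the whole tail\<close>
    define k where "k s = (LINT \<zeta>|lborel. cut R \<zeta> * cnj (I \<zeta>) * D s \<zeta>)" for s
    have k_le: "norm (k s) \<le> (56 / 3 * A * T powr (- 2)) * w s" for s
    proof (cases "s \<ge> T")
      case False
      then have "D s \<zeta> = 0" for \<zeta>
        by (simp add: D_def)
      then show ?thesis
        using A w0 by (simp add: k_def)
    next
      case s: True
      define P where "P r = (LINT \<zeta>|lborel. cut R \<zeta> * D s \<zeta> * cnj (D r \<zeta>))" for r
      have "k s = (LINT \<zeta>|lborel. LINT r|lborel. cut R \<zeta> * D s \<zeta> * cnj (D r \<zeta>))"
        unfolding k_def
      proof (intro Bochner_Integration.integral_cong refl)
        fix \<zeta>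
        have "cut R \<zeta> * cnj (I \<zeta>) * D s \<zeta> = cut R \<zeta> * D s \<zeta> * (LINT r|lborel. cnj (D r \<zeta>))"
          by (simp add: I_def mult_ac)
        then show "cut R \<zeta> * cnj (I \<zeta>) * D s \<zeta> = (LINT r|lborel. cut R \<zeta> * D s \<zeta> * cnj (D r \<zeta>))"
          by simp
      qed
      also have "\<dots> = (LINT r|lborel. P r)"
        unfolding P_def
      proof (rule lborel_pair.Fubini_integral[symmetric], rule pair[where B = "w s"])
        show "norm (cut R \<zeta> * D s \<zeta> * cnj (D r \<zeta>)) \<le> norm (cut R \<zeta>) * (w s * w r)" for \<zeta> r
          using D_le w0 by (auto simp: norm_mult mult.assoc intro!: mult_left_mono mult_mono)
        show "(\<lambda>(\<zeta>, r). cut R \<zeta> * D s \<zeta> * cnj (D r \<zeta>)) \<in> borel_measurable (lborel \<Otimes>\<^sub>M lborel)"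
          unfolding split_beta' by measurable
      qed (rule w0)
      finally have k_eq: "k s = (LINT r|lborel. P r)" .
      have P: "norm (P r) \<le> 4 * w s * A * (indicator {T..} r * r powr (- 5 / 2) * \<bar>s - r\<bar> powr (- 1 / 2))"
        if "r \<noteq> s" for r
      proof (cases "r \<ge> T")
        case False
        then have "D r \<zeta> = 0" for \<zeta>
          by (simp add: D_def)
        then show ?thesis
          using False by (simp add: P_def)
      next
        case r: True
        have "cut R \<zeta> * D s \<zeta> * cnj (D r \<zeta>)
            = truncated_phase R (s - r) \<zeta> * fourier (q s) \<zeta> * cnj (fourier (q r) \<zeta>)" for \<zeta>
        proof -
          have "cis ((s - r) * \<zeta>\<^sup>2) = cis (s * \<zeta>\<^sup>2) * cnj (cis (r * \<zeta>\<^sup>2))"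
            by (simp add: cis_cnj cis_mult left_diff_distrib)
          then show ?thesis
            using s r by (simp add: D_def cut_def truncated_phase_def scaleR_conv_of_real mult_ac)
        qed
        then have "norm (P r) \<le> 4 * \<bar>s - r\<bar> powr (- 1 / 2) * (LINT y|lborel. norm (q s y)) * (LINT y|lborel. norm (q r y))"
          unfolding P_def using dispersive_pairing[OF q[OF s] q[OF r], of "s - r" R] that by simp
        also have "\<dots> \<le> 4 * \<bar>s - r\<bar> powr (- 1 / 2) * (A * s powr (- 5 / 2)) * (A * r powr (- 5 / 2))"
          using qA[OF s] qA[OF r] A
          by (intro mult_mono mult_nonneg_nonneg order_refl) (auto intro!: Bochner_Integration.integral_nonneg)
        also have "\<dots> = 4 * w s * A * (indicator {T..} r * r powr (- 5 / 2) * \<bar>s - r\<bar> powr (- 1 / 2))"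
          using s r by (simp add: w_def)
        finally show ?thesis .
      qed
      have "norm (k s) \<le> (LINT r|lborel. 4 * w s * A * (indicator {T..} r * r powr (- 5 / 2) * \<bar>s - r\<bar> powr (- 1 / 2)))"
        unfolding k_eq
      proof (rule norm_integral_le)
        show "integrable lborel (\<lambda>r. 4 * w s * A * (indicator {T..} r * r powr (- 5 / 2) * \<bar>s - r\<bar> powr (- 1 / 2)))"
          by (intro integrable_mult_right fractional_convolution_bound(1)[OF T])
        show "AE r in lborel. norm (P r) \<le> 4 * w s * A * (indicator {T..} r * r powr (- 5 / 2) * \<bar>s - r\<bar> powr (- 1 / 2))"
          using AE_lborel_singleton[of s] by eventually_elim (rule P)
      qed
      also have "\<dots> \<le> 4 * w s * A * (14 / 3 * T powr (- 2))"
        unfolding integral_mult_right_zero using fractional_convolution_bound(2)[OF T] w0 A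
        by (intro mult_left_mono) auto
      finally show ?thesis
        by (simp add: mult_ac)
    qed
    have "(LINT \<zeta>|lborel. cut R \<zeta> * cnj (I \<zeta>) * I \<zeta>) = (LINT \<zeta>|lborel. LINT s|lborel. cut R \<zeta> * cnj (I \<zeta>) * D s \<zeta>)"
      by (simp add: I_def)
    also have "\<dots> = (LINT s|lborel. k s)"
      unfolding k_def
    proof (rule lborel_pair.Fubini_integral[symmetric], rule pair[where B = M])
      show "norm (cut R \<zeta> * cnj (I \<zeta>) * D s \<zeta>) \<le> norm (cut R \<zeta>) * (M * w s)" for \<zeta> s
        using D_le I_le[folded M_def] M0 by (auto simp: norm_mult mult.assoc intro!: mult_left_mono mult_mono)
      show "(\<lambda>(\<zeta>, s). cut R \<zeta> * cnj (I \<zeta>) * D s \<zeta>) \<in> borel_measurable (lborel \<Otimes>\<^sub>M lborel)"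
        unfolding split_beta' by measurable
    qed (rule M0)
    finally have eq: "(LINT \<zeta>|lborel. cut R \<zeta> * cnj (I \<zeta>) * I \<zeta>) = (LINT s|lborel. k s)" .
    let ?g = "\<lambda>\<zeta>. indicator {- R..R} \<zeta> * (norm (I \<zeta>))\<^sup>2"
    have gi: "integrable lborel ?g"
    proof (rule Bochner_Integration.integrable_bound)
      show "integrable lborel (\<lambda>\<zeta>. norm (cut R \<zeta>) * M\<^sup>2)"
        using cuti by simp
      show "AE \<zeta> in lborel. norm (?g \<zeta>) \<le> norm (norm (cut R \<zeta>) * M\<^sup>2)"
        using I_le[folded M_def] by (auto simp: cut_def abs_mult intro!: mult_left_mono power_mono)
    qed measurable
    have "complex_of_real (LINT \<zeta>|lborel. ?g \<zeta>) = (LINT \<zeta>|lborel. cut R \<zeta> * cnj (I \<zeta>) * I \<zeta>)"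
      unfolding Bochner_Integration.integral_of_real[OF gi, symmetric]
    proof (intro Bochner_Integration.integral_cong refl)
      fix \<zeta>
      have "cut R \<zeta> * cnj (I \<zeta>) * I \<zeta> = complex_of_real (indicator {- R..R} \<zeta>) * (I \<zeta> * cnj (I \<zeta>))"
        by (simp only: cut_def mult.assoc mult.commute[of "cnj (I \<zeta>)"])
      then show "complex_of_real (?g \<zeta>) = cut R \<zeta> * cnj (I \<zeta>) * I \<zeta>"
        by (simp only: complex_norm_square[symmetric] of_real_mult)
    qed
    then have "complex_of_real (LINT \<zeta>|lborel. ?g \<zeta>) = (LINT s|lborel. k s)"
      unfolding eq .
    then have "(LINT \<zeta>|lborel. ?g \<zeta>) \<le> norm (LINT s|lborel. k s)"
      by (metis complex_Re_le_cmod Re_complex_of_real)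
    also have "\<dots> \<le> (LINT s|lborel. (56 / 3 * A * T powr (- 2)) * w s)"
      by (rule norm_integral_le) (use w k_le in auto)
    also have "\<dots> = 112 / 9 * A\<^sup>2 * (T powr (- 2) * T powr (- 3 / 2))"
      by (simp add: w(2) power2_eq_square)
    also have "T powr (- 2) * T powr (- 3 / 2) = T powr (- 7 / 2)"
      by (simp add: powr_add[symmetric])
    finally show ?thesis
      using gi by simp
  qed
  have lim: "(\<lambda>n. indicator {- real n..real n} \<zeta> * (norm (I \<zeta>))\<^sup>2) \<longlonglongrightarrow> (norm (I \<zeta>))\<^sup>2" for \<zeta>
  proof (rule tendsto_eventually)
    obtain N where "\<bar>\<zeta>\<bar> < real N"
      using reals_Archimedean2 by blast
    then show "\<forall>\<^sub>F n in sequentially. indicator {- real n..real n} \<zeta> * (norm (I \<zeta>))\<^sup>2 = (norm (I \<zeta>))\<^sup>2"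
      unfolding eventually_sequentially by (intro exI[of _ N]) (auto simp: indicator_def)
  qed
  note F = integrable_Fatou[OF conjunct1[OF bound] _ lim conjunct2[OF bound]]
  show "(\<lambda>\<zeta>. LINT s|lborel. D s \<zeta>) \<in> L2"
    using F(1) I_meas unfolding I_def by (auto simp: L2_def)
  show "(LINT \<zeta>|lborel. (norm (LINT s|lborel. D s \<zeta>))\<^sup>2) \<le> 112 / 9 * A\<^sup>2 * T powr (- 7 / 2)"
    using F(2) by (simp add: I_def)
qed

section \<open>The Riemann--Lebesgue lemma\<close>

text \<open>
  Translation by \<open>pi / \<zeta>\<close> changes the sign of the transform at \<open>\<zeta>\<close>, so the transform is at most half
  the \<open>L\<^sup>1\<close> modulus of continuity. On a bounded set that modulus is controlled by the \<open>L\<^sup>2\<close> one.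
\<close>

lemma Riemann_Lebesgue:
  assumes f: "integrable lborel f" and lip: "L2_Lipschitz K f"
  shows "(fourier f \<longlongrightarrow> 0) at_infinity"
proof (rule tendstoI)
  fix e :: real assume "e > 0"
  then have e4: "e / 4 > 0" by simp
  have [measurable]: "f \<in> borel_measurable borel"
    using f by auto
  have f2: "f \<in> L2"
    using lip by (auto simp: L2_Lipschitz_def)
  define tl where "tl R x = indicator (- {- R..R}) x * norm (f x)" for R x
  have tl_int: "integrable lborel (tl R)" for R
    unfolding tl_def[abs_def]
    by (rule Bochner_Integration.integrable_bound[OF integrable_norm[OF f]]) (auto simp: indicator_def)
  have "(\<lambda>n. LINT x|lborel. tl (real n) x) \<longlonglongrightarrow> (LINT x|(lborel :: real measure). 0)"
  proof (rule integral_dominated_convergence[where w = "\<lambda>x. norm (f x)"])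
    have "(\<lambda>n. tl (real n) x) \<longlonglongrightarrow> 0" for x
    proof (rule tendsto_eventually)
      obtain N where "\<bar>x\<bar> < real N"
        using reals_Archimedean2 by blast
      then show "\<forall>\<^sub>F n in sequentially. tl (real n) x = 0"
        unfolding eventually_sequentially by (intro exI[of _ N]) (auto simp: tl_def indicator_def)
    qed
    then show "AE x in lborel. (\<lambda>n. tl (real n) x) \<longlonglongrightarrow> 0"
      by simp
  qed (use f in \<open>auto simp: tl_def indicator_def\<close>)
  then have "\<forall>\<^sub>F n in sequentially. (LINT x|lborel. tl (real n) x) < e / 4"
    using e4 by (intro order_tendstoD(2)) auto
  then obtain N where N: "(LINT x|lborel. tl (real N) x) < e / 4"
    by (auto simp: eventually_sequentially)
  define R where "R = real N"
  \<comment> \<open>the level at which \<open>norm z \<le> c + (norm z)\<^sup>2 / c\<close> is applied on a ball slightly larger than the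
    one of radius \<open>R\<close>, beyond which little of \<open>f\<close> is left\<close>
  define c where "c = e / 4 / (2 * R + 2)"
  have R0: "R \<ge> 0" by (simp add: R_def)
  have c: "c > 0" "c * (2 * R + 2) = e / 4"
  proof -
    have "2 * R + 2 > 0"
      using R0 by simp
    then show "c > 0" "c * (2 * R + 2) = e / 4"
      using e4 by (simp_all add: c_def del: divide_divide_eq_left)
  qed
  have K: "0 \<le> K"
  proof -
    have "0 \<le> (LINT x|lborel. (norm (f (x + 1) - f x))\<^sup>2)"
      by (rule Bochner_Integration.integral_nonneg) auto
    also have "\<dots> \<le> K * 1\<^sup>2"
      using lip unfolding L2_Lipschitz_def by blast
    finally show ?thesis by simp
  qed
  have mod: "(LINT x|lborel. norm (f (x + h) - f x)) \<le> 3 * (e / 4) + K * h\<^sup>2 / c" if h: "\<bar>h\<bar> \<le> 1" for h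
  proof -
    define D where "D x = f (x + h) - f x" for x
    have D2: "D \<in> L2"
      unfolding D_def using L2_shift(1)[OF f2] f2 by (rule L2_diff)
    define G where "G x = c * indicator {- (R + 1)..R + 1} x + (norm (D x))\<^sup>2 / c + (tl R (x + h) + tl R x)" for x
    have 1: "integrable lborel (indicator {- (R + 1)..R + 1} :: real \<Rightarrow> real)"
      by (simp add: emeasure_lborel_Icc_eq)
    have G: "integrable lborel G"
      unfolding G_def using 1 L2_integrable[OF D2] tl_int integrable_shift[OF tl_int] by auto
    have le: "norm (D x) \<le> G x" for x
    proof (cases "x \<in> {- (R + 1)..R + 1}")
      case True
      have "c * norm (D x) \<le> c\<^sup>2 + (norm (D x))\<^sup>2"
      proof -
        have "0 \<le> c * norm (D x)"
          using c by simp
        then show ?thesis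
          using sum_squares_bound[of c "norm (D x)"] by linarith
      qed
      then have "norm (D x) \<le> c + (norm (D x))\<^sup>2 / c"
        using c by (simp add: field_simps power2_eq_square)
      moreover have "0 \<le> tl R (x + h) + tl R x"
        by (simp add: tl_def)
      ultimately show ?thesis
        using True by (simp add: G_def)
    next
      case False
      have "\<bar>x\<bar> > R + 1"
        using False by auto
      then have "\<bar>x + h\<bar> > R" "\<bar>x\<bar> > R"
        using h by linarith+
      then have "tl R (x + h) = norm (f (x + h))" "tl R x = norm (f x)"
        by (auto simp: tl_def indicator_def)
      moreover have "norm (D x) \<le> norm (f (x + h)) + norm (f x)"
        unfolding D_def by (rule norm_triangle_ineq4)
      moreover have "0 \<le> (norm (D x))\<^sup>2 / c"
        using c by simp
      ultimately show ?thesis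
        using False by (simp add: G_def)
    qed
    have "(LINT x|lborel. norm (D x)) \<le> (LINT x|lborel. G x)"
    proof (rule integral_mono[OF _ G le])
      show "integrable lborel (\<lambda>x. norm (D x))"
        unfolding D_def using f integrable_shift[OF f] by auto
    qed
    also have "\<dots> = c * (2 * R + 2) + (LINT x|lborel. (norm (D x))\<^sup>2) / c + 2 * (LINT x|lborel. tl R x)"
      unfolding G_def using 1 L2_integrable[OF D2] tl_int integrable_shift[OF tl_int] R0
      by (simp add: integral_shift)
    also have "\<dots> \<le> e / 4 + K * h\<^sup>2 / c + 2 * (e / 4)"
      using lip N c unfolding L2_Lipschitz_def D_def R_def
      by (intro add_mono divide_right_mono) auto
    finally show ?thesis
      by (simp add: D_def)
  qed
  \<comment> \<open>for large \<open>\<zeta>\<close> the translation \<open>pi / \<zeta>\<close> is at most one and the \<open>L\<^sup>2\<close> term is below \<open>e / 4\<close>\<close>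
  have "(\<lambda>\<zeta>. K * (pi / \<zeta>)\<^sup>2 / c) = (\<lambda>\<zeta>. (K * pi\<^sup>2 / c) * (inverse \<zeta>)\<^sup>2)"
    by (simp add: fun_eq_iff power_divide field_simps)
  then have "((\<lambda>\<zeta>. K * (pi / \<zeta>)\<^sup>2 / c) \<longlongrightarrow> (K * pi\<^sup>2 / c) * 0\<^sup>2) at_infinity"
    by (simp only:) (intro tendsto_intros tendsto_inverse_0)
  then have "\<forall>\<^sub>F \<zeta> in at_infinity. K * (pi / \<zeta>)\<^sup>2 / c < e / 4"
    using e4 by (intro order_tendstoD(2)) auto
  moreover have "\<forall>\<^sub>F \<zeta> :: real in at_infinity. \<bar>\<zeta>\<bar> \<ge> pi"
    by (auto simp: eventually_at_infinity)
  ultimately show "\<forall>\<^sub>F \<zeta> in at_infinity. dist (fourier f \<zeta>) 0 < e"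
  proof eventually_elim
    case (elim \<zeta>)
    have \<zeta>: "\<zeta> \<noteq> 0"
      using elim(2) pi_gt_zero by (metis abs_zero not_le)
    have h: "\<bar>pi / \<zeta>\<bar> \<le> 1"
      using elim(2) \<zeta> by (simp add: abs_divide divide_le_eq)
    have "cis (\<zeta> * (pi / \<zeta>)) = -1"
      using \<zeta> by simp
    then have "fourier (\<lambda>y. f (y + pi / \<zeta>) - f y) \<zeta> = - 2 * fourier f \<zeta>"
      using fourier_diff[OF integrable_shift[OF f] f, of "pi / \<zeta>" \<zeta>] by (simp add: fourier_shift)
    then have "2 * norm (fourier f \<zeta>) = norm (fourier (\<lambda>y. f (y + pi / \<zeta>) - f y) \<zeta>)"
      by (simp add: norm_mult)
    also have "\<dots> \<le> (LINT x|lborel. norm (f (x + pi / \<zeta>) - f x))"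
      by (rule norm_fourier_le) (use f integrable_shift[OF f] in auto)
    also have "\<dots> < 4 * (e / 4)"
      using mod[OF h] elim(1) by linarith
    finally show ?case
      using \<open>e > 0\<close> by simp
  qed
qed

section \<open>Families that are continuous in \<open>L\<^sup>1\<close>\<close>

definition L1_continuous_on :: "real set \<Rightarrow> (real \<Rightarrow> real \<Rightarrow> complex) \<Rightarrow> bool" where
  "L1_continuous_on S q \<longleftrightarrow> (\<forall>s\<in>S. integrable lborel (q s)) \<and>
     (\<forall>s\<in>S. ((\<lambda>r. LINT y|lborel. norm (q r y - q s y)) \<longlongrightarrow> 0) (at s within S))"

lemma fourier_jointly_continuous:
  assumes q: "L1_continuous_on S q"
  shows "continuous_on (S \<times> UNIV) (\<lambda>(s, \<zeta>). fourier (q s) \<zeta>)"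
proof -
  have "((\<lambda>(s, \<zeta>). fourier (q s) \<zeta>) \<longlongrightarrow> fourier (q s) \<zeta>) (at (s, \<zeta>) within S \<times> UNIV)" if s: "s \<in> S" for s \<zeta>
  proof -
    have int: "integrable lborel (q r)" if "r \<in> S" for r
      using q that by (auto simp: L1_continuous_on_def)
    let ?F = "at (s, \<zeta>) within S \<times> (UNIV :: real set)"
    have fst_lim: "(fst \<longlongrightarrow> s) ?F" and snd_lim: "(snd \<longlongrightarrow> \<zeta>) ?F"
      by (auto intro!: tendsto_eq_intros)
    have "((\<lambda>r. LINT y|lborel. norm (q r y - q s y)) \<longlongrightarrow> (LINT y|lborel. norm (q s y - q s y))) (at s within S)"
      using q s by (auto simp: L1_continuous_on_def)
    then have "((\<lambda>p. LINT y|lborel. norm (q (fst p) y - q s y)) \<longlongrightarrow> (LINT y|lborel. norm (q s y - q s y))) ?F"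
      using s fst_lim
      by (intro continuous_within_tendsto_compose[of s S "\<lambda>r. LINT y|lborel. norm (q r y - q s y)"])
         (auto simp: continuous_within eventually_at_filter intro!: always_eventually)
    then have 1: "((\<lambda>p. LINT y|lborel. norm (q (fst p) y - q s y)) \<longlongrightarrow> 0) ?F"
      by simp
    have "isCont (fourier (q s)) \<zeta>"
      using fourier_continuous[OF int[OF s]] by (simp add: continuous_on_eq_continuous_at)
    then have 2: "((\<lambda>p. fourier (q s) (snd p)) \<longlongrightarrow> fourier (q s) \<zeta>) ?F"
      using snd_lim by (rule isCont_tendsto_compose)
    have "((\<lambda>p. fourier (q (fst p)) (snd p) - fourier (q s) (snd p)) \<longlongrightarrow> 0) ?F"
    proof (rule Lim_null_comparison[OF _ 1])
      show "\<forall>\<^sub>F p in ?F. norm (fourier (q (fst p)) (snd p) - fourier (q s) (snd p))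
          \<le> (LINT y|lborel. norm (q (fst p) y - q s y))"
        unfolding eventually_at_filter
        using s int by (auto simp: fourier_diff[symmetric] intro!: always_eventually norm_fourier_le Bochner_Integration.integrable_diff)
    qed
    from tendsto_add[OF this 2] show ?thesis
      by (simp add: split_beta')
  qed
  then show ?thesis
    by (auto simp: continuous_on_def)
qed


lemma L1_continuous_onI:
  assumes "\<And>s. s \<in> S \<Longrightarrow> integrable lborel (q s)"
    and "\<And>s r. s \<in> S \<Longrightarrow> r \<in> S \<Longrightarrow> (LINT y|lborel. norm (q r y - q s y)) \<le> g s r"
    and "\<And>s. s \<in> S \<Longrightarrow> (g s \<longlongrightarrow> 0) (at s within S)"
  shows "L1_continuous_on S q"
  unfolding L1_continuous_on_def
proof (intro conjI ballI)
  fix s assume s: "s \<in> S"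
  show "((\<lambda>r. LINT y|lborel. norm (q r y - q s y)) \<longlongrightarrow> 0) (at s within S)"
  proof (rule Lim_null_comparison[OF _ assms(3)[OF s]])
    show "\<forall>\<^sub>F r in at s within S. norm (LINT y|lborel. norm (q r y - q s y)) \<le> g s r"
      unfolding eventually_at_filter using assms(2)[OF s] by (auto intro!: always_eventually)
  qed
qed (rule assms)

lemma fourier_continuous_in_time:
  assumes "L1_continuous_on S q"
  shows "continuous_on S (\<lambda>s. fourier (q s) \<zeta>)"
proof -
  have "continuous_on S ((\<lambda>(s, \<zeta>). fourier (q s) \<zeta>) \<circ> (\<lambda>s. (s, \<zeta>)))"
    by (rule continuous_on_compose)
       (auto intro!: continuous_intros continuous_on_subset[OF fourier_jointly_continuous[OF assms]])
  then show ?thesis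
    by (simp add: o_def)
qed

section \<open>The nonlinearity\<close>

lemma power_nonlinearity_diff:
  fixes x y :: complex
  assumes "norm x \<le> M" "norm y \<le> M"
  shows "norm (of_real (norm x ^ n) * x - of_real (norm y ^ n) * y) \<le> real (Suc n) * M ^ n * norm (x - y)"
proof (induction n)
  case (Suc n)
  have M: "0 \<le> M"
    using assms(1) norm_ge_zero order_trans by blast
  have "of_real (norm x ^ Suc n) * x - of_real (norm y ^ Suc n) * y
      = of_real (norm x) * (of_real (norm x ^ n) * x - of_real (norm y ^ n) * y)
        + of_real (norm x - norm y) * (of_real (norm y ^ n) * y)"
    by (simp add: algebra_simps)
  also have "norm \<dots> \<le> M * (real (Suc n) * M ^ n * norm (x - y)) + norm (x - y) * (M ^ n * M)"
  proof (intro norm_triangle_mono)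
    show "norm (of_real (norm x) * (of_real (norm x ^ n) * x - of_real (norm y ^ n) * y))
        \<le> M * (real (Suc n) * M ^ n * norm (x - y))"
      unfolding norm_mult using assms M Suc.IH by - (rule mult_mono; auto)
    have "\<bar>norm x - norm y\<bar> \<le> norm (x - y)"
      by (rule norm_triangle_ineq3)
    moreover have "norm y ^ n * norm y \<le> M ^ n * M"
      using assms M by (intro mult_mono power_mono) auto
    ultimately show "norm (of_real (norm x - norm y) * (of_real (norm y ^ n) * y)) \<le> norm (x - y) * (M ^ n * M)"
      unfolding norm_mult norm_of_real abs_norm_cancel power_abs by - (rule mult_mono; (auto simp: M))
  qed
  also have "\<dots> = real (Suc (Suc n)) * M ^ Suc n * norm (x - y)"
    by (simp add: algebra_simps)
  finally show ?case .
qed simp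

lemma cubic_eq: "cubic f y = of_real (norm (f y) ^ 2) * f y"
  by (simp add: cubic_def)

lemma quintic_eq: "quintic W \<gamma> s f y = of_real (W (y + \<gamma> * s)) * (of_real (norm (f y) ^ 4) * f y)"
  by (simp add: quintic_def)

lemma AE_shift:
  fixes P :: "real \<Rightarrow> bool"
  assumes "AE y in lborel. P y" and [measurable]: "Measurable.pred borel P"
  shows "AE y in lborel. P (y + h)"
  using AE_borel_affine[of 1 P h] assms by (simp add: add.commute)

text \<open>
  The constants \<open>w\<^sub>0\<close> and \<open>L\<close> depend on the potential alone, and \<open>a\<close> is the amplitude in the dispersive
  decay, a multiple of the size of the data.
\<close>

locale decaying_solution =
  fixes \<beta> \<gamma> :: real and W :: "real \<Rightarrow> real" and u :: "real \<Rightarrow> real \<Rightarrow> complex" and w\<^sub>0 L a :: real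
  assumes W_bound: "\<bar>W x\<bar> \<le> w\<^sub>0 * (1 / (1 + x\<^sup>2))"
    and W_Lipschitz: "\<bar>W x - W y\<bar> \<le> L * \<bar>x - y\<bar>"
    and u_continuous: "C_Sigma u"
    and mild: "mild_solution \<beta> \<gamma> W u"
    and decay: "t \<ge> 1 \<Longrightarrow> AE y in lborel. norm (u t y) \<le> a * t powr (- 1 / 2)"
    and a_nonneg: "0 \<le> a"
begin

lemma w0_nonneg: "0 \<le> w\<^sub>0"
  using W_bound[of 0] by simp

lemma W_le: "\<bar>W x\<bar> \<le> w\<^sub>0"
proof -
  have "1 / (1 + x\<^sup>2) \<le> 1"
    by (simp add: divide_le_eq add_pos_nonneg)
  then have "w\<^sub>0 * (1 / (1 + x\<^sup>2)) \<le> w\<^sub>0 * 1"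
    using w0_nonneg by (intro mult_left_mono)
  then show ?thesis
    using W_bound[of x] by simp
qed

lemma L_nonneg: "0 \<le> L"
  using W_Lipschitz[of 1 0] by simp

lemma W_measurable [measurable]: "W \<in> borel_measurable borel"
proof (rule borel_measurable_continuous_onI)
  have "L-lipschitz_on UNIV W"
    using W_Lipschitz L_nonneg by (auto simp: lipschitz_on_def dist_real_def)
  then show "continuous_on UNIV W"
    by (rule lipschitz_on_continuous_on)
qed

lemma u_Sigma: "t \<ge> 1 \<Longrightarrow> u t \<in> Sigma_space"
  using u_continuous by (simp add: C_Sigma_def)

lemma u_L2: "t \<ge> 1 \<Longrightarrow> u t \<in> L2"
  and u_integrable: "t \<ge> 1 \<Longrightarrow> integrable lborel (u t)"
  using Sigma_space_bounds u_Sigma by auto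

lemma u_measurable: "t \<ge> 1 \<Longrightarrow> u t \<in> borel_measurable borel"
  using u_L2 by auto

lemma u_bounded:
  assumes "t \<ge> 1"
  shows "AE y in lborel. norm (u t y) \<le> a"
  using decay[OF assms]
proof eventually_elim
  case (elim y)
  have "t powr (- 1 / 2) \<le> 1 powr (- 1 / 2)"
    using assms by (intro powr_mono2') auto
  then have "a * t powr (- 1 / 2) \<le> a * 1"
    using a_nonneg by (intro mult_left_mono) auto
  with elim show ?case
    by simp
qed

lemma u_difference_tendsto:
  assumes "s \<ge> 1"
  shows "((\<lambda>r. LINT y|lborel. norm (u r y - u s y)) \<longlongrightarrow> 0) (at s within {1..})"
proof (rule Lim_null_comparison)
  have "((\<lambda>r. (pi + 2) * Sigma_norm (\<lambda>y. u r y - u s y)) \<longlongrightarrow> (pi + 2) * 0) (at s within {1..})"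
    using u_continuous assms by (intro tendsto_mult tendsto_const) (simp add: C_Sigma_def)
  then show "((\<lambda>r. (pi + 2) * Sigma_norm (\<lambda>y. u r y - u s y)) \<longlongrightarrow> 0) (at s within {1..})"
    by simp
  show "\<forall>\<^sub>F r in at s within {1..}. norm (LINT y|lborel. norm (u r y - u s y))
      \<le> (pi + 2) * Sigma_norm (\<lambda>y. u r y - u s y)"
    unfolding eventually_at_filter
    using Sigma_space_bounds(5)[OF Sigma_space_diff[OF u_Sigma u_Sigma[OF assms]]]
    by (auto intro!: always_eventually)
qed

lemma cubic_bound:
  assumes s: "s \<ge> 1"
  shows "AE y in lborel. norm (cubic (u s) y) \<le> a\<^sup>2 * norm (u s y)"
  using u_bounded[OF s]
  by eventually_elim (auto simp: cubic_eq norm_mult norm_power intro!: mult_right_mono power_mono)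

lemma quintic_bound:
  assumes s: "s \<ge> 1"
  shows "AE y in lborel. norm (quintic W \<gamma> s (u s) y) \<le> w\<^sub>0 * a ^ 4 * norm (u s y)"
  using u_bounded[OF s]
proof eventually_elim
  case (elim y)
  have "norm (u s y) ^ 4 * norm (u s y) \<le> a ^ 4 * norm (u s y)"
    using elim by (intro mult_right_mono power_mono) auto
  then have "\<bar>W (y + \<gamma> * s)\<bar> * (norm (u s y) ^ 4 * norm (u s y)) \<le> w\<^sub>0 * (a ^ 4 * norm (u s y))"
    using W_le w0_nonneg by - (rule mult_mono; auto)
  then show ?case
    unfolding quintic_eq norm_mult norm_of_real power_abs abs_norm_cancel by (simp only: mult.assoc)
qed

lemma cubic_measurable: "s \<ge> 1 \<Longrightarrow> cubic (u s) \<in> borel_measurable borel"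
  unfolding cubic_def[abs_def] using u_measurable by measurable

lemma quintic_measurable: "s \<ge> 1 \<Longrightarrow> quintic W \<gamma> s (u s) \<in> borel_measurable borel"
  unfolding quintic_def[abs_def] using u_measurable by measurable

lemma cubic_integrable:
  assumes s: "s \<ge> 1"
  shows "integrable lborel (cubic (u s))"
proof (rule Bochner_Integration.integrable_bound)
  show "integrable lborel (\<lambda>y. a\<^sup>2 * norm (u s y))"
    using u_integrable[OF s] by simp
qed (use cubic_bound[OF s] cubic_measurable[OF s] in auto)

lemma quintic_integrable:
  assumes s: "s \<ge> 1"
  shows "integrable lborel (quintic W \<gamma> s (u s))"
proof (rule Bochner_Integration.integrable_bound)
  show "integrable lborel (\<lambda>y. w\<^sub>0 * a ^ 4 * norm (u s y))"
    using u_integrable[OF s] by simp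
  show "AE y in lborel. norm (quintic W \<gamma> s (u s) y) \<le> norm (w\<^sub>0 * a ^ 4 * norm (u s y))"
    using quintic_bound[OF s] by eventually_elim (rule order_trans, assumption, simp)
qed (use quintic_measurable[OF s] in auto)

text \<open>
  The integral of the majorant of the potential is invariant under translation, which is why the
  constant does not depend on \<open>\<gamma>\<close>.
\<close>

lemma quintic_L1:
  assumes s: "s \<ge> 1"
  shows "(LINT y|lborel. norm (quintic W \<gamma> s (u s) y)) \<le> w\<^sub>0 * pi * a ^ 5 * s powr (- 5 / 2)"
proof -
  have i: "integrable lborel (\<lambda>y. 1 / (1 + (y + \<gamma> * s)\<^sup>2))"
    by (rule integrable_shift[OF integrable_inverse_one_plus_square])
  have "(LINT y|lborel. norm (quintic W \<gamma> s (u s) y))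
      \<le> (LINT y|lborel. w\<^sub>0 * (a ^ 5 * s powr (- 5 / 2)) * (1 / (1 + (y + \<gamma> * s)\<^sup>2)))"
  proof (rule integral_mono_AE)
    show "AE y in lborel. norm (quintic W \<gamma> s (u s) y)
        \<le> w\<^sub>0 * (a ^ 5 * s powr (- 5 / 2)) * (1 / (1 + (y + \<gamma> * s)\<^sup>2))"
      using decay[OF s]
    proof eventually_elim
      case (elim y)
      have "norm (u s y) ^ 4 * norm (u s y) = norm (u s y) ^ 5"
        by (simp add: eval_nat_numeral)
      also have "\<dots> \<le> (a * s powr (- 1 / 2)) ^ 5"
        using elim by (intro power_mono) auto
      also have "\<dots> = a ^ 5 * s powr (- 5 / 2)"
        using s by (simp add: power_mult_distrib powr_power)
      finally have "\<bar>W (y + \<gamma> * s)\<bar> * (norm (u s y) ^ 4 * norm (u s y))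
          \<le> w\<^sub>0 * (1 / (1 + (y + \<gamma> * s)\<^sup>2)) * (a ^ 5 * s powr (- 5 / 2))"
        using W_bound[of "y + \<gamma> * s"] w0_nonneg by - (rule mult_mono; (auto simp: add_nonneg_nonneg))
      then show ?case
        unfolding quintic_eq norm_mult norm_of_real power_abs abs_norm_cancel by (simp add: mult_ac)
    qed
    show "integrable lborel (\<lambda>y. w\<^sub>0 * (a ^ 5 * s powr (- 5 / 2)) * (1 / (1 + (y + \<gamma> * s)\<^sup>2)))"
      by (rule integrable_mult_right[OF i])
  qed (use quintic_integrable[OF s] in auto)
  also have "\<dots> = w\<^sub>0 * (a ^ 5 * s powr (- 5 / 2)) * pi"
    unfolding integral_mult_right_zero integral_shift[of "\<lambda>y. 1 / (1 + y\<^sup>2)" "\<gamma> * s"]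
      integral_inverse_one_plus_square ..
  finally show ?thesis
    by (simp add: mult_ac)
qed

lemma cubic_L1_continuous: "L1_continuous_on {1..} (\<lambda>s. cubic (u s))"
proof (rule L1_continuous_onI[where g = "\<lambda>s r. 3 * a\<^sup>2 * (LINT y|lborel. norm (u r y - u s y))"])
  fix s r :: real assume sr: "s \<in> {1..}" "r \<in> {1..}"
  have "(LINT y|lborel. norm (cubic (u r) y - cubic (u s) y)) \<le> (LINT y|lborel. 3 * a\<^sup>2 * norm (u r y - u s y))"
  proof (rule integral_mono_AE)
    show "AE y in lborel. norm (cubic (u r) y - cubic (u s) y) \<le> 3 * a\<^sup>2 * norm (u r y - u s y)"
    proof -
      have "AE y in lborel. norm (u r y) \<le> a" "AE y in lborel. norm (u s y) \<le> a"
        using u_bounded sr by auto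
      then show ?thesis
      proof eventually_elim
        case (elim y)
        then show ?case
          using power_nonlinearity_diff[OF elim, of 2] unfolding cubic_eq by simp
      qed
    qed
  qed (use sr cubic_integrable u_integrable in auto)
  then show "(LINT y|lborel. norm (cubic (u r) y - cubic (u s) y)) \<le> 3 * a\<^sup>2 * (LINT y|lborel. norm (u r y - u s y))"
    by simp
next
  fix s :: real assume "s \<in> {1..}"
  then show "((\<lambda>r. 3 * a\<^sup>2 * (LINT y|lborel. norm (u r y - u s y))) \<longlongrightarrow> 0) (at s within {1..})"
    using tendsto_mult[OF tendsto_const u_difference_tendsto, of s "3 * a\<^sup>2"] by simp
qed (use cubic_integrable in auto)

lemma quintic_L1_continuous: "L1_continuous_on {1..} (\<lambda>s. quintic W \<gamma> s (u s))"
proof (rule L1_continuous_onI[where g = "\<lambda>s r. 5 * w\<^sub>0 * a ^ 4 * (LINT y|lborel. norm (u r y - u s y))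
      + L * \<bar>\<gamma> * r - \<gamma> * s\<bar> * (a ^ 4 * (LINT y|lborel. norm (u s y)))"])
  fix s r :: real assume sr: "s \<in> {1..}" "r \<in> {1..}"
  have "(LINT y|lborel. norm (quintic W \<gamma> r (u r) y - quintic W \<gamma> s (u s) y))
      \<le> (LINT y|lborel. 5 * w\<^sub>0 * a ^ 4 * norm (u r y - u s y) + L * \<bar>\<gamma> * r - \<gamma> * s\<bar> * (a ^ 4 * norm (u s y)))"
  proof (rule integral_mono_AE)
    have "AE y in lborel. norm (u r y) \<le> a" "AE y in lborel. norm (u s y) \<le> a"
      using u_bounded sr by auto
    then show "AE y in lborel. norm (quintic W \<gamma> r (u r) y - quintic W \<gamma> s (u s) y)
        \<le> 5 * w\<^sub>0 * a ^ 4 * norm (u r y - u s y) + L * \<bar>\<gamma> * r - \<gamma> * s\<bar> * (a ^ 4 * norm (u s y))"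
    proof eventually_elim
      case (elim y)
      let ?p = "\<lambda>z :: complex. of_real (norm z ^ 4) * z"
      have "quintic W \<gamma> r (u r) y - quintic W \<gamma> s (u s) y
          = of_real (W (y + \<gamma> * r)) * (?p (u r y) - ?p (u s y))
            + of_real (W (y + \<gamma> * r) - W (y + \<gamma> * s)) * ?p (u s y)"
        by (simp add: quintic_eq algebra_simps)
      also have "norm \<dots> \<le> w\<^sub>0 * (real (Suc 4) * a ^ 4 * norm (u r y - u s y))
          + (L * \<bar>\<gamma> * r - \<gamma> * s\<bar>) * (a ^ 4 * norm (u s y))"
      proof (intro norm_triangle_mono)
        show "norm (of_real (W (y + \<gamma> * r)) * (?p (u r y) - ?p (u s y)))
            \<le> w\<^sub>0 * (real (Suc 4) * a ^ 4 * norm (u r y - u s y))"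
          unfolding norm_mult norm_of_real
          using W_le w0_nonneg power_nonlinearity_diff[OF elim, of 4] by - (rule mult_mono; auto)
        have "norm (u s y) ^ 4 * norm (u s y) \<le> a ^ 4 * norm (u s y)"
          using elim by (intro mult_right_mono power_mono) auto
        then show "norm (of_real (W (y + \<gamma> * r) - W (y + \<gamma> * s)) * ?p (u s y))
            \<le> (L * \<bar>\<gamma> * r - \<gamma> * s\<bar>) * (a ^ 4 * norm (u s y))"
          unfolding norm_mult norm_of_real power_abs abs_norm_cancel
          using W_Lipschitz[of "y + \<gamma> * r" "y + \<gamma> * s"] L_nonneg by - (rule mult_mono; auto)
      qed
      finally show ?case
        by (simp add: mult_ac)
    qed
  qed (use sr quintic_integrable u_integrable in auto)
  also have "\<dots> = 5 * w\<^sub>0 * a ^ 4 * (LINT y|lborel. norm (u r y - u s y))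
      + L * \<bar>\<gamma> * r - \<gamma> * s\<bar> * (a ^ 4 * (LINT y|lborel. norm (u s y)))"
    using sr u_integrable by simp
  finally show "(LINT y|lborel. norm (quintic W \<gamma> r (u r) y - quintic W \<gamma> s (u s) y))
      \<le> 5 * w\<^sub>0 * a ^ 4 * (LINT y|lborel. norm (u r y - u s y))
        + L * \<bar>\<gamma> * r - \<gamma> * s\<bar> * (a ^ 4 * (LINT y|lborel. norm (u s y)))" .
next
  fix s :: real assume s: "s \<in> {1..}"
  have "((\<lambda>r. 5 * w\<^sub>0 * a ^ 4 * (LINT y|lborel. norm (u r y - u s y))
      + L * \<bar>\<gamma> * r - \<gamma> * s\<bar> * (a ^ 4 * (LINT y|lborel. norm (u s y)))) \<longlongrightarrow>
      5 * w\<^sub>0 * a ^ 4 * 0 + L * \<bar>\<gamma> * s - \<gamma> * s\<bar> * (a ^ 4 * (LINT y|lborel. norm (u s y)))) (at s within {1..})"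
    using s by (intro tendsto_intros u_difference_tendsto) auto
  then show "((\<lambda>r. 5 * w\<^sub>0 * a ^ 4 * (LINT y|lborel. norm (u r y - u s y))
      + L * \<bar>\<gamma> * r - \<gamma> * s\<bar> * (a ^ 4 * (LINT y|lborel. norm (u s y)))) \<longlongrightarrow> 0) (at s within {1..})"
    by simp
qed (use quintic_integrable in auto)

text \<open>With \<open>b = \<beta>\<close> this is the nonlinearity of the equation, and with \<open>b = 0\<close> its quintic part.\<close>

definition nonlinearity :: "real \<Rightarrow> real \<Rightarrow> real \<Rightarrow> complex" where
  "nonlinearity b s = (\<lambda>y. - of_real b * cubic (u s) y + quintic W \<gamma> s (u s) y)"

lemma nonlinearity_integrable: "s \<ge> 1 \<Longrightarrow> integrable lborel (nonlinearity b s)"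
  unfolding nonlinearity_def using cubic_integrable quintic_integrable by auto

lemma nonlinearity_bound:
  assumes s: "s \<ge> 1"
  shows "AE y in lborel. norm (nonlinearity b s y) \<le> (\<bar>b\<bar> * a\<^sup>2 + w\<^sub>0 * a ^ 4) * norm (u s y)"
  using cubic_bound[OF s] quintic_bound[OF s]
proof eventually_elim
  case (elim y)
  have "norm (nonlinearity b s y) \<le> \<bar>b\<bar> * norm (cubic (u s) y) + norm (quintic W \<gamma> s (u s) y)"
    unfolding nonlinearity_def using norm_triangle_ineq[of "- of_real b * cubic (u s) y"]
    by (simp add: norm_mult)
  also have "\<dots> \<le> \<bar>b\<bar> * (a\<^sup>2 * norm (u s y)) + w\<^sub>0 * a ^ 4 * norm (u s y)"
    using elim by (intro add_mono mult_left_mono) auto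
  finally show ?case
    by (simp add: algebra_simps)
qed

lemma nonlinearity_L2:
  assumes s: "s \<ge> 1"
  shows "nonlinearity b s \<in> L2"
    and "(LINT y|lborel. (norm (nonlinearity b s y))\<^sup>2) \<le> (\<bar>b\<bar> * a\<^sup>2 + w\<^sub>0 * a ^ 4)\<^sup>2 * (LINT y|lborel. (norm (u s y))\<^sup>2)"
proof -
  let ?c = "\<bar>b\<bar> * a\<^sup>2 + w\<^sub>0 * a ^ 4"
  have m: "nonlinearity b s \<in> borel_measurable borel"
    using nonlinearity_integrable[OF s] by auto
  have le: "AE y in lborel. (norm (nonlinearity b s y))\<^sup>2 \<le> ?c\<^sup>2 * (norm (u s y))\<^sup>2"
    using nonlinearity_bound[OF s, of b]
    by eventually_elim (auto simp flip: power_mult_distrib intro!: power_mono)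
  note * = L2_bound[OF m integrable_mult_right[OF L2_integrable[OF u_L2[OF s]]] le]
  show "nonlinearity b s \<in> L2"
    by (rule *(1))
  show "(LINT y|lborel. (norm (nonlinearity b s y))\<^sup>2) \<le> ?c\<^sup>2 * (LINT y|lborel. (norm (u s y))\<^sup>2)"
    using *(2) by simp
qed

lemma nonlinearity_increment:
  assumes s: "s \<ge> 1"
  shows "AE y in lborel. norm (nonlinearity b s (y + h) - nonlinearity b s y)
    \<le> (3 * \<bar>b\<bar> * a\<^sup>2 + 5 * w\<^sub>0 * a ^ 4) * norm (u s (y + h) - u s y) + L * a ^ 4 * (\<bar>h\<bar> * norm (u s y))"
proof -
  have [measurable]: "u s \<in> borel_measurable borel"
    by (rule u_measurable[OF s])
  have "AE y in lborel. norm (u s (y + h)) \<le> a"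
    by (rule AE_shift[OF u_bounded[OF s]]) measurable
  with u_bounded[OF s] show ?thesis
  proof eventually_elim
    case (elim y)
    let ?v = "u s (y + h)" and ?u = "u s y"
    let ?p = "\<lambda>n (z :: complex). of_real (norm z ^ n) * z"
    have eq: "nonlinearity b s (y + h) - nonlinearity b s y
        = of_real (- b) * (?p 2 ?v - ?p 2 ?u)
          + (of_real (W (y + h + \<gamma> * s)) * (?p 4 ?v - ?p 4 ?u)
          + of_real (W (y + h + \<gamma> * s) - W (y + \<gamma> * s)) * ?p 4 ?u)"
      by (simp add: nonlinearity_def quintic_eq cubic_eq algebra_simps)
    have "norm (of_real (- b) * (?p 2 ?v - ?p 2 ?u)
          + (of_real (W (y + h + \<gamma> * s)) * (?p 4 ?v - ?p 4 ?u)
          + of_real (W (y + h + \<gamma> * s) - W (y + \<gamma> * s)) * ?p 4 ?u))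
      \<le> \<bar>b\<bar> * (real (Suc 2) * a\<^sup>2 * norm (?v - ?u))
        + (w\<^sub>0 * (real (Suc 4) * a ^ 4 * norm (?v - ?u)) + (L * \<bar>h\<bar>) * (a ^ 4 * norm ?u))"
    proof (intro norm_triangle_mono)
      show "norm (of_real (- b) * (?p 2 ?v - ?p 2 ?u)) \<le> \<bar>b\<bar> * (real (Suc 2) * a\<^sup>2 * norm (?v - ?u))"
        unfolding norm_mult norm_of_real
        using power_nonlinearity_diff[OF elim(2,1), of 2] by - (rule mult_mono; auto)
      show "norm (of_real (W (y + h + \<gamma> * s)) * (?p 4 ?v - ?p 4 ?u)) \<le> w\<^sub>0 * (real (Suc 4) * a ^ 4 * norm (?v - ?u))"
        unfolding norm_mult norm_of_real
        using W_le w0_nonneg power_nonlinearity_diff[OF elim(2,1), of 4] by - (rule mult_mono; auto)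
      have "norm ?u ^ 4 * norm ?u \<le> a ^ 4 * norm ?u"
        using elim by (intro mult_right_mono power_mono) auto
      then show "norm (of_real (W (y + h + \<gamma> * s) - W (y + \<gamma> * s)) * ?p 4 ?u) \<le> (L * \<bar>h\<bar>) * (a ^ 4 * norm ?u)"
        unfolding norm_mult norm_of_real power_abs abs_norm_cancel
        using W_Lipschitz[of "y + h + \<gamma> * s" "y + \<gamma> * s"] L_nonneg by - (rule mult_mono; auto)
    qed
    then show ?case
      unfolding eq by (simp add: algebra_simps)
  qed
qed

lemma nonlinearity_Lipschitz:
  assumes s: "s \<ge> 1" and lip: "L2_Lipschitz K (u s)"
  shows "L2_Lipschitz (2 * (3 * \<bar>b\<bar> * a\<^sup>2 + 5 * w\<^sub>0 * a ^ 4)\<^sup>2 * K + 2 * (L * a ^ 4)\<^sup>2 * (LINT y|lborel. (norm (u s y))\<^sup>2))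
    (nonlinearity b s)"
  unfolding L2_Lipschitz_def
proof (intro conjI allI nonlinearity_L2(1)[OF s])
  fix h :: real
  let ?c = "3 * \<bar>b\<bar> * a\<^sup>2 + 5 * w\<^sub>0 * a ^ 4"
  let ?D = "\<lambda>y. u s (y + h) - u s y"
  have D2: "?D \<in> L2"
    by (intro L2_diff L2_shift(1) u_L2 s)
  have N2: "(\<lambda>y. nonlinearity b s (y + h) - nonlinearity b s y) \<in> L2"
    by (intro L2_diff L2_shift(1) nonlinearity_L2(1) s)
  have c0: "0 \<le> ?c"
    using w0_nonneg a_nonneg by simp
  have int: "integrable lborel (\<lambda>y. 2 * ?c\<^sup>2 * (norm (?D y))\<^sup>2 + 2 * (L * a ^ 4)\<^sup>2 * h\<^sup>2 * (norm (u s y))\<^sup>2)"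
    using L2_integrable[OF D2] L2_integrable[OF u_L2[OF s]]
    by (intro Bochner_Integration.integrable_add integrable_mult_right)
  have "(LINT y|lborel. (norm (nonlinearity b s (y + h) - nonlinearity b s y))\<^sup>2)
      \<le> (LINT y|lborel. 2 * ?c\<^sup>2 * (norm (?D y))\<^sup>2 + 2 * (L * a ^ 4)\<^sup>2 * h\<^sup>2 * (norm (u s y))\<^sup>2)"
  proof (rule integral_mono_AE[OF L2_integrable[OF N2] int])
    show "AE y in lborel. (norm (nonlinearity b s (y + h) - nonlinearity b s y))\<^sup>2
        \<le> 2 * ?c\<^sup>2 * (norm (?D y))\<^sup>2 + 2 * (L * a ^ 4)\<^sup>2 * h\<^sup>2 * (norm (u s y))\<^sup>2"
      using nonlinearity_increment[OF s, of b h]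
    proof eventually_elim
      case (elim y)
      define p where "p = ?c * norm (?D y)"
      define q where "q = L * a ^ 4 * (\<bar>h\<bar> * norm (u s y))"
      have "(norm (nonlinearity b s (y + h) - nonlinearity b s y))\<^sup>2 \<le> (p + q)\<^sup>2"
        using elim by (intro power_mono) (auto simp: p_def q_def)
      also have "\<dots> \<le> 2 * p\<^sup>2 + 2 * q\<^sup>2"
        using zero_le_power2[of "p - q"] by (simp add: power2_eq_square algebra_simps)
      also have "p\<^sup>2 = ?c\<^sup>2 * (norm (?D y))\<^sup>2"
        by (simp only: p_def power_mult_distrib)
      also have "q\<^sup>2 = (L * a ^ 4)\<^sup>2 * h\<^sup>2 * (norm (u s y))\<^sup>2"
        by (simp only: q_def power_mult_distrib power2_abs mult.assoc)
      finally show ?case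
        by (simp only: mult.assoc)
    qed
  qed
  also have "\<dots> = 2 * ?c\<^sup>2 * (LINT y|lborel. (norm (?D y))\<^sup>2) + 2 * (L * a ^ 4)\<^sup>2 * h\<^sup>2 * (LINT y|lborel. (norm (u s y))\<^sup>2)"
    using L2_integrable[OF D2] L2_integrable[OF u_L2[OF s]]
    by (simp only: Bochner_Integration.integral_add integrable_mult_right integral_mult_right_zero)
  also have "\<dots> \<le> 2 * ?c\<^sup>2 * (K * h\<^sup>2) + 2 * (L * a ^ 4)\<^sup>2 * h\<^sup>2 * (LINT y|lborel. (norm (u s y))\<^sup>2)"
    using lip unfolding L2_Lipschitz_def by (intro add_right_mono mult_left_mono) auto
  finally show "(LINT y|lborel. (norm (nonlinearity b s (y + h) - nonlinearity b s y))\<^sup>2)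
      \<le> (2 * ?c\<^sup>2 * K + 2 * (L * a ^ 4)\<^sup>2 * (LINT y|lborel. (norm (u s y))\<^sup>2)) * h\<^sup>2"
    by (simp add: algebra_simps)
qed


end

lemma borel_measurable_indicator_strip:
  fixes F :: "real \<Rightarrow> real \<Rightarrow> complex"
  assumes "continuous_on (A \<times> UNIV) (\<lambda>(s, \<zeta>). F s \<zeta>)" and A: "closed A"
  shows "(\<lambda>(s, \<zeta>). indicator A s *\<^sub>R F s \<zeta>) \<in> borel_measurable (lborel \<Otimes>\<^sub>M lborel)"
proof -
  have "(\<lambda>p. indicator (A \<times> UNIV) p *\<^sub>R (\<lambda>(s, \<zeta>). F s \<zeta>) p) \<in> borel_measurable borel"
    using A by (intro borel_measurable_continuous_on_indicator assms(1) borel_closed closed_Times) auto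
  moreover have "(\<lambda>p. indicator (A \<times> UNIV) p *\<^sub>R (\<lambda>(s, \<zeta>). F s \<zeta>) p) = (\<lambda>(s, \<zeta>). indicator A s *\<^sub>R F s \<zeta>)"
    by (auto simp: indicator_def fun_eq_iff)
  moreover have "borel_measurable (borel :: (real \<times> real) measure) = (borel_measurable (lborel \<Otimes>\<^sub>M lborel) :: (real \<times> real \<Rightarrow> complex) set)"
    by (intro measurable_cong_sets) (simp_all only: lborel_prod sets_lborel)
  ultimately show ?thesis
    by simp
qed

context decaying_solution
begin

section \<open>Duhamel's formula on the frequency side\<close>

text \<open>
  These bounds are monotone in \<open>B\<close> and stable under perturbations that are small in \<open>\<Sigma>\<close>, as the
  compactness argument below requires.
\<close>

definition bounded_state :: "real \<Rightarrow> real \<Rightarrow> bool" where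
  "bounded_state B s \<longleftrightarrow> L2_Lipschitz B (u s) \<and> (LINT y|lborel. (norm (u s y))\<^sup>2) \<le> B
     \<and> (LINT y|lborel. norm (u s y)) \<le> B"

lemma bounded_state_mono: "bounded_state B s \<Longrightarrow> B \<le> B' \<Longrightarrow> bounded_state B' s"
  unfolding bounded_state_def L2_Lipschitz_def
  by (meson mult_right_mono order_trans zero_le_power2)

lemma bounded_state_exists:
  assumes s: "s \<ge> 1"
  shows "\<exists>B. bounded_state B s"
proof -
  let ?B = "max ((Sigma_norm (u s))\<^sup>2) ((pi + 2) * Sigma_norm (u s))"
  have lip: "L2_Lipschitz ?B (u s)"
    using Sigma_space_bounds(3)[OF u_Sigma[OF s]] unfolding L2_Lipschitz_def
    by (meson max.cobounded1 mult_right_mono order_trans zero_le_power2)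
  then have "bounded_state ?B s"
    using Sigma_space_bounds(4,5)[OF u_Sigma[OF s]] unfolding bounded_state_def
    by (auto intro: max.coboundedI1 max.coboundedI2)
  then show ?thesis ..
qed

text \<open>The constant 6 exceeds \<open>pi + 2\<close>, the constant in the \<open>L\<^sup>1\<close> bound for \<open>\<Sigma>\<close>.\<close>

lemma bounded_state_perturbation:
  assumes s: "s \<ge> 1" and r: "r \<ge> 1" and B: "bounded_state B s" "0 \<le> B"
    and close: "Sigma_norm (\<lambda>y. u r y - u s y) < 1"
  shows "bounded_state (2 * B + 6) r"
proof -
  let ?d = "\<lambda>y. u r y - u s y"
  have d: "?d \<in> Sigma_space"
    by (intro Sigma_space_diff u_Sigma s r)
  note bd = Sigma_space_bounds[OF d]
  have sq: "(Sigma_norm ?d)\<^sup>2 \<le> 1"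
    using close bd(6) by (simp add: abs_square_le_1)
  have eq: "u r y = u s y + ?d y" for y
    by simp
  have Bs: "L2_Lipschitz B (u s)" "(LINT y|lborel. (norm (u s y))\<^sup>2) \<le> B" "(LINT y|lborel. norm (u s y)) \<le> B"
    using B by (auto simp: bounded_state_def)
  have lip: "(LINT y|lborel. (norm (u r (y + h) - u r y))\<^sup>2) \<le> (2 * B + 6) * h\<^sup>2" for h
  proof -
    have "(LINT y|lborel. (norm (u r (y + h) - u r y))\<^sup>2)
        = (LINT y|lborel. (norm ((u s (y + h) - u s y) + (?d (y + h) - ?d y)))\<^sup>2)"
      by simp
    also have "\<dots> \<le> 2 * (LINT y|lborel. (norm (u s (y + h) - u s y))\<^sup>2) + 2 * (LINT y|lborel. (norm (?d (y + h) - ?d y))\<^sup>2)"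
      by (rule L2_add(2)) (intro L2_diff L2_shift(1) u_L2 s r L2_shift(1)[OF bd(1)] bd(1))+
    also have "\<dots> \<le> 2 * (B * h\<^sup>2) + 2 * ((Sigma_norm ?d)\<^sup>2 * h\<^sup>2)"
      using Bs(1) bd(3) unfolding L2_Lipschitz_def by (intro add_mono mult_left_mono) auto
    also have "\<dots> \<le> 2 * (B * h\<^sup>2) + 2 * (1 * h\<^sup>2)"
      using sq by (intro add_left_mono mult_left_mono mult_right_mono) auto
    also have "\<dots> \<le> (2 * B + 6) * h\<^sup>2"
      by (simp add: algebra_simps)
    finally show ?thesis .
  qed
  moreover have "(LINT y|lborel. (norm (u r y))\<^sup>2) \<le> 2 * B + 6"
  proof -
    have "(LINT y|lborel. (norm (u r y))\<^sup>2) = (LINT y|lborel. (norm (u s y + ?d y))\<^sup>2)"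
      by simp
    also have "\<dots> \<le> 2 * (LINT y|lborel. (norm (u s y))\<^sup>2) + 2 * (LINT y|lborel. (norm (?d y))\<^sup>2)"
      by (rule L2_add(2)) (intro u_L2 s bd(1))+
    also have "\<dots> \<le> 2 * B + 6"
      using Bs(2) bd(4) sq by linarith
    finally show ?thesis .
  qed
  moreover have "(LINT y|lborel. norm (u r y)) \<le> 2 * B + 6"
  proof -
    have "(LINT y|lborel. norm (u r y)) \<le> (LINT y|lborel. norm (u s y) + norm (?d y))"
      using u_integrable[OF r] u_integrable[OF s] bd(2) norm_triangle_ineq[of "u s y" "?d y" for y]
      by (intro integral_mono) auto
    also have "\<dots> = (LINT y|lborel. norm (u s y)) + (LINT y|lborel. norm (?d y))"
      using u_integrable[OF s] bd(2) by (intro Bochner_Integration.integral_add integrable_norm)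
    also have "\<dots> \<le> B + (pi + 2) * 1"
      using Bs(3) bd(5) close bd(6) by (intro add_mono order_trans[OF bd(5)] mult_left_mono) auto
    also have "\<dots> \<le> 2 * B + 6"
      using pi_less_4 B(2) by simp
    finally show ?thesis .
  qed
  ultimately show ?thesis
    using u_L2[OF r] by (simp add: bounded_state_def L2_Lipschitz_def)
qed

text \<open>Continuity in \<open>\<Sigma>\<close> gives local bounds, hence bounds on compact time intervals.\<close>

lemma bounded_state_uniform:
  obtains B where "0 \<le> B" and "\<And>s. 1 \<le> s \<Longrightarrow> s \<le> t \<Longrightarrow> bounded_state B s"
proof -
  have "\<exists>n::nat. \<forall>s\<in>{1..t}. bounded_state (real n) s"
  proof (rule ccontr)
    assume "\<not> ?thesis"
    then have "\<forall>n::nat. \<exists>s. s \<in> {1..t} \<and> \<not> bounded_state (real n) s"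
      by blast
    then obtain S where S: "\<And>n. S n \<in> {1..t}" "\<And>n. \<not> bounded_state (real n) (S n)"
      by metis
    have "seq_compact {1..t}"
      by (rule compact_imp_seq_compact) simp
    then obtain l \<rho> where l: "l \<in> {1..t}" and \<rho>: "strict_mono \<rho>" and lim: "(S \<circ> \<rho>) \<longlonglongrightarrow> l"
      using S(1) unfolding seq_compact_def by blast
    have l1: "l \<ge> 1"
      using l by simp
    obtain B\<^sub>0 where B\<^sub>0: "bounded_state B\<^sub>0 l"
      using bounded_state_exists[OF l1] by blast
    define B where "B = max B\<^sub>0 0"
    have B: "bounded_state B l" "0 \<le> B"
      using bounded_state_mono[OF B\<^sub>0] by (auto simp: B_def)
    have "((\<lambda>r. Sigma_norm (\<lambda>y. u r y - u l y)) \<longlongrightarrow> 0) (at l within {1..})"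
      using u_continuous l1 by (simp add: C_Sigma_def)
    then have "\<forall>\<^sub>F r in at l within {1..}. Sigma_norm (\<lambda>y. u r y - u l y) < 1"
      by (rule order_tendstoD) simp
    then obtain d where d: "d > 0" "\<And>r. r \<ge> 1 \<Longrightarrow> r \<noteq> l \<Longrightarrow> dist r l < d \<Longrightarrow> Sigma_norm (\<lambda>y. u r y - u l y) < 1"
      unfolding eventually_at by auto
    have near: "bounded_state (2 * B + 6) r" if "r \<ge> 1" "dist r l < d" for r
    proof (cases "r = l")
      case True
      then show ?thesis
        using bounded_state_mono[OF B(1)] B(2) by simp
    next
      case False
      then show ?thesis
        using bounded_state_perturbation[OF l1 that(1) B] d(2) that by blast
    qed
    have "\<forall>\<^sub>F n in sequentially. dist ((S \<circ> \<rho>) n) l < d"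
      using lim d(1) by (rule tendstoD)
    moreover have "\<forall>\<^sub>F n in sequentially. 2 * B + 6 \<le> real n"
      by (rule eventually_sequentiallyI[of "nat \<lceil>2 * B + 6\<rceil>"]) linarith
    ultimately have "\<forall>\<^sub>F n in sequentially. False"
    proof eventually_elim
      case (elim n)
      have "real n \<le> real (\<rho> n)"
        using strict_mono_imp_increasing[OF \<rho>] by simp
      moreover have "bounded_state (2 * B + 6) (S (\<rho> n))"
        using near[of "S (\<rho> n)"] S(1)[of "\<rho> n"] elim(1) by simp
      moreover have "2 * B + 6 \<le> real (\<rho> n)"
        using elim(2) \<open>real n \<le> real (\<rho> n)\<close> by linarith
      ultimately have "bounded_state (real (\<rho> n)) (S (\<rho> n))"
        using bounded_state_mono by blast
      then show False
        using S(2) by blast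
    qed
    then show False
      by simp
  qed
  then obtain n where "\<forall>s\<in>{1..t}. bounded_state (real n) s"
    by blast
  then show ?thesis
    by (intro that[of "real n"]) auto
qed

text \<open>These bounds justify Fubini's theorem and dominated convergence in Duhamel's formula.\<close>

lemma nonlinearity_uniform_bounds:
  obtains B where "0 \<le> B"
    and "\<And>s. 1 \<le> s \<Longrightarrow> s \<le> t \<Longrightarrow> integrable lborel (fourier (nonlinearity b s))"
    and "\<And>s. 1 \<le> s \<Longrightarrow> s \<le> t \<Longrightarrow> (LINT \<zeta>|lborel. norm (fourier (nonlinearity b s) \<zeta>)) \<le> B"
    and "\<And>s \<zeta>. 1 \<le> s \<Longrightarrow> s \<le> t \<Longrightarrow> norm (fourier (nonlinearity b s) \<zeta>) \<le> B"
proof -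
  obtain B where B: "0 \<le> B" "\<And>s. 1 \<le> s \<Longrightarrow> s \<le> t \<Longrightarrow> bounded_state B s"
    using bounded_state_uniform by blast
  define c\<^sub>0 where "c\<^sub>0 = \<bar>b\<bar> * a\<^sup>2 + w\<^sub>0 * a ^ 4"
  define c\<^sub>1 where "c\<^sub>1 = 2 * (3 * \<bar>b\<bar> * a\<^sup>2 + 5 * w\<^sub>0 * a ^ 4)\<^sup>2"
  define c\<^sub>2 where "c\<^sub>2 = 2 * (L * a ^ 4)\<^sup>2"
  have c: "0 \<le> c\<^sub>0" "0 \<le> c\<^sub>1" "0 \<le> c\<^sub>2"
    using w0_nonneg a_nonneg by (auto simp: c\<^sub>0_def c\<^sub>1_def c\<^sub>2_def)
  define M\<^sub>1 where "M\<^sub>1 = pi + 2 * pi * (c\<^sub>0\<^sup>2 * B + (c\<^sub>1 * B + c\<^sub>2 * B))"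
  define M\<^sub>2 where "M\<^sub>2 = c\<^sub>0 * B"
  have *: "integrable lborel (fourier (nonlinearity b s))"
    "(LINT \<zeta>|lborel. norm (fourier (nonlinearity b s) \<zeta>)) \<le> M\<^sub>1"
    "norm (fourier (nonlinearity b s) \<zeta>) \<le> M\<^sub>2" if s: "1 \<le> s" "s \<le> t" for s \<zeta>
  proof -
    have Bs: "L2_Lipschitz B (u s)" "(LINT y|lborel. (norm (u s y))\<^sup>2) \<le> B" "(LINT y|lborel. norm (u s y)) \<le> B"
      using B(2)[OF s] by (auto simp: bounded_state_def)
    note lip = nonlinearity_Lipschitz[OF s(1) Bs(1), of b, folded c\<^sub>1_def c\<^sub>2_def]
    note F = fourier_integrable_of_L2_Lipschitz[OF nonlinearity_integrable[OF s(1)] lip]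
    show "integrable lborel (fourier (nonlinearity b s))"
      by (rule F(1))
    have "(LINT y|lborel. (norm (nonlinearity b s y))\<^sup>2) \<le> c\<^sub>0\<^sup>2 * B"
      using nonlinearity_L2(2)[OF s(1), of b, folded c\<^sub>0_def] mult_left_mono[OF Bs(2), of "c\<^sub>0\<^sup>2"] by simp
    moreover have "c\<^sub>2 * (LINT y|lborel. (norm (u s y))\<^sup>2) \<le> c\<^sub>2 * B"
      using Bs(2) c by (intro mult_left_mono)
    ultimately have "(LINT y|lborel. (norm (nonlinearity b s y))\<^sup>2) + (c\<^sub>1 * B + c\<^sub>2 * (LINT y|lborel. (norm (u s y))\<^sup>2))
        \<le> c\<^sub>0\<^sup>2 * B + (c\<^sub>1 * B + c\<^sub>2 * B)"
      by linarith
    then have "2 * pi * ((LINT y|lborel. (norm (nonlinearity b s y))\<^sup>2) + (c\<^sub>1 * B + c\<^sub>2 * (LINT y|lborel. (norm (u s y))\<^sup>2)))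
        \<le> 2 * pi * (c\<^sub>0\<^sup>2 * B + (c\<^sub>1 * B + c\<^sub>2 * B))"
      by (rule mult_left_mono) simp
    then show "(LINT \<zeta>|lborel. norm (fourier (nonlinearity b s) \<zeta>)) \<le> M\<^sub>1"
      using F(2) unfolding M\<^sub>1_def by linarith
    have "norm (fourier (nonlinearity b s) \<zeta>) \<le> (LINT y|lborel. norm (nonlinearity b s y))"
      by (rule norm_fourier_le[OF nonlinearity_integrable[OF s(1)]])
    also have "\<dots> \<le> (LINT y|lborel. c\<^sub>0 * norm (u s y))"
      using nonlinearity_bound[OF s(1), of b, folded c\<^sub>0_def] nonlinearity_integrable[OF s(1)] u_integrable[OF s(1)]
      by (intro integral_mono_AE) auto
    also have "\<dots> \<le> M\<^sub>2"
      using Bs(3) c unfolding M\<^sub>2_def integral_mult_right_zero by (intro mult_left_mono)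
    finally show "norm (fourier (nonlinearity b s) \<zeta>) \<le> M\<^sub>2" .
  qed
  show ?thesis
  proof (rule that[of "max 0 (max M\<^sub>1 M\<^sub>2)"])
    show "(LINT \<zeta>|lborel. norm (fourier (nonlinearity b s) \<zeta>)) \<le> max 0 (max M\<^sub>1 M\<^sub>2)" if "1 \<le> s" "s \<le> t" for s
      using *(2)[OF that] by linarith
    show "norm (fourier (nonlinearity b s) \<zeta>) \<le> max 0 (max M\<^sub>1 M\<^sub>2)" if "1 \<le> s" "s \<le> t" for s \<zeta>
      using *(3)[OF that, of \<zeta>] by linarith
  qed (use * in auto)
qed

lemma fourier_nonlinearity:
  assumes "s \<ge> 1"
  shows "fourier (nonlinearity b s) \<zeta> = - of_real b * fourier (cubic (u s)) \<zeta> + fourier (quintic W \<gamma> s (u s)) \<zeta>"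
proof -
  have "cis (- (\<zeta> * y)) * nonlinearity b s y = - of_real b * (cis (- (\<zeta> * y)) * cubic (u s) y) + cis (- (\<zeta> * y)) * quintic W \<gamma> s (u s) y" for y
    by (simp add: nonlinearity_def algebra_simps)
  then show ?thesis
    using fourier_integrable[OF cubic_integrable[OF assms]] fourier_integrable[OF quintic_integrable[OF assms]]
    by (simp add: fourier_def)
qed

lemma fourier_nonlinearity_continuous:
  "continuous_on ({1..} \<times> UNIV) (\<lambda>(s, \<zeta>). fourier (nonlinearity b s) \<zeta>)"
proof -
  have "continuous_on ({1..} \<times> UNIV) (\<lambda>p. - of_real b * (\<lambda>(s, \<zeta>). fourier (cubic (u s)) \<zeta>) p
      + (\<lambda>(s, \<zeta>). fourier (quintic W \<gamma> s (u s)) \<zeta>) p)"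
    by (intro continuous_on_add continuous_on_mult continuous_on_const
        fourier_jointly_continuous cubic_L1_continuous quintic_L1_continuous)
  then show ?thesis
    by (rule continuous_on_eq) (auto simp: fourier_nonlinearity)
qed


text \<open>
  The mild equation only involves inverse transforms. The right-hand side is a single inverse
  transform of an integrable function, so Fourier inversion applies to \<open>u t\<close> as a whole, which is
  integrable because it lies in \<open>\<Sigma>\<close>.
\<close>

lemma Duhamel_fourier:
  assumes t: "t \<ge> 1"
  shows "cis (t * \<zeta>\<^sup>2) * fourier (u t) \<zeta> = cis (\<zeta>\<^sup>2) * fourier (u 1) \<zeta>
    + \<i> * (LINT s|lborel. indicator {1..t} s *\<^sub>R (cis (s * \<zeta>\<^sup>2) * fourier (nonlinearity \<beta> s) \<zeta>))"
proof -
  obtain B where B: "0 \<le> B"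
    and Bint: "\<And>s. 1 \<le> s \<Longrightarrow> s \<le> t \<Longrightarrow> integrable lborel (fourier (nonlinearity \<beta> s))"
    and BL1: "\<And>s. 1 \<le> s \<Longrightarrow> s \<le> t \<Longrightarrow> (LINT \<zeta>|lborel. norm (fourier (nonlinearity \<beta> s) \<zeta>)) \<le> B"
    and Bsup: "\<And>s \<zeta>. 1 \<le> s \<Longrightarrow> s \<le> t \<Longrightarrow> norm (fourier (nonlinearity \<beta> s) \<zeta>) \<le> B"
    using nonlinearity_uniform_bounds by blast
  define E where "E s \<zeta> = indicator {1..t} s *\<^sub>R (cis (- ((t - s) * \<zeta>\<^sup>2)) * fourier (nonlinearity \<beta> s) \<zeta>)" for s \<zeta>
  have "continuous_on ({1..t} \<times> UNIV) (\<lambda>(s, \<zeta>). cis (- ((t - s) * \<zeta>\<^sup>2)) * fourier (nonlinearity \<beta> s) \<zeta>)"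
  proof -
    have "continuous_on ({1..t} \<times> UNIV) (\<lambda>p. cis (- ((t - fst p) * (snd p)\<^sup>2)) * (\<lambda>(s, \<zeta>). fourier (nonlinearity \<beta> s) \<zeta>) p)"
      by (intro continuous_intros continuous_on_subset[OF fourier_nonlinearity_continuous]) auto
    then show ?thesis
      by (simp add: split_beta')
  qed
  then have E_meas: "(\<lambda>(s, \<zeta>). E s \<zeta>) \<in> borel_measurable (lborel \<Otimes>\<^sub>M lborel)"
    unfolding E_def by (rule borel_measurable_indicator_strip) simp
  have E_le: "norm (E s \<zeta>) \<le> indicator {1..t} s * B" for s \<zeta>
    using Bsup[of s \<zeta>] by (auto simp: E_def norm_mult indicator_def)
  have E_norm: "norm (E s \<zeta>) = indicator {1..t} s * norm (fourier (nonlinearity \<beta> s) \<zeta>)" for s \<zeta>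
    by (simp add: E_def norm_mult)
  have E_int: "integrable (lborel \<Otimes>\<^sub>M lborel) (\<lambda>(s, \<zeta>). E s \<zeta>)"
  proof (rule lborel_pair.Fubini_integrable[OF E_meas])
    have [measurable]: "(\<lambda>p. E (fst p) (snd p)) \<in> borel_measurable (lborel \<Otimes>\<^sub>M lborel)"
      using E_meas by (simp add: split_beta')
    have m: "(\<lambda>s. LINT \<zeta>|lborel. norm (E s \<zeta>)) \<in> borel_measurable lborel"
      by measurable
    show "integrable lborel (\<lambda>s. LINT \<zeta>|lborel. norm (case (s, \<zeta>) of (s, \<zeta>) \<Rightarrow> E s \<zeta>))"
    proof (rule Bochner_Integration.integrable_bound)
      show "integrable lborel (\<lambda>s. indicator {1..t} s * B)"
        by (intro integrable_mult_left) (simp add: emeasure_lborel_Icc_eq)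
      have "(LINT \<zeta>|lborel. norm (E s \<zeta>)) \<le> indicator {1..t} s * B" for s
        unfolding E_norm using BL1[of s] by (auto simp: indicator_def)
      then show "AE s in lborel. norm (LINT \<zeta>|lborel. norm (case (s, \<zeta>) of (s, \<zeta>) \<Rightarrow> E s \<zeta>))
          \<le> norm (indicator {1..t} s * B)"
        using B by (simp add: abs_mult)
    qed (use m in simp)
    show "AE s in lborel. integrable lborel (\<lambda>\<zeta>. case (s, \<zeta>) of (s, \<zeta>) \<Rightarrow> E s \<zeta>)"
      using Bint by (auto simp: E_def indicator_def intro!: integrable_cis_mult)
  qed
  have u1: "integrable lborel (fourier (u 1))"
    using fourier_integrable_of_L2_Lipschitz(1)[OF u_integrable[of 1] Sigma_space_bounds(3)[OF u_Sigma[of 1]]]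
    by simp
  define H where "H \<zeta> = cis (- ((t - 1) * \<zeta>\<^sup>2)) * fourier (u 1) \<zeta> + \<i> * (LINT s|lborel. E s \<zeta>)" for \<zeta>
  have I_int: "integrable lborel (\<lambda>\<zeta>. LINT s|lborel. E s \<zeta>)"
    by (rule lborel_pair.integrable_snd[OF E_int])
  have H1: "integrable lborel (\<lambda>\<zeta>. cis (- ((t - 1) * \<zeta>\<^sup>2)) * fourier (u 1) \<zeta>)"
    by (rule integrable_cis_mult[OF u1]) auto
  have H_int: "integrable lborel H"
    unfolding H_def using H1 I_int by auto
  have w: "integrable lborel (\<lambda>s. indicator {1..t} s * B)"
    by (intro integrable_mult_left) (simp add: emeasure_lborel_Icc_eq)
  have [measurable]: "(\<lambda>s. E s \<zeta>) \<in> borel_measurable borel" for \<zeta>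
    using measurable_compose[OF measurable_Pair2' E_meas, of \<zeta>] by simp
  have "continuous_on UNIV (\<lambda>\<zeta>. LINT s|lborel. E s \<zeta>)"
  proof (rule continuous_on_dominated_integral[OF _ E_le w])
    show "continuous_on UNIV (E s)" for s
    proof (cases "s \<in> {1..t}")
      case True
      then show ?thesis
        unfolding E_def by (intro continuous_intros fourier_continuous nonlinearity_integrable) auto
    next
      case False
      then show ?thesis
        by (simp add: E_def)
    qed
  qed simp
  then have H_cont: "continuous_on UNIV H"
    unfolding H_def using fourier_continuous[OF u_integrable, of 1] by (intro continuous_intros) auto
  have H_bound: "norm (H \<zeta>) \<le> (LINT y|lborel. norm (u 1 y)) + (LINT s|lborel. indicator {1..t} s * B)" for \<zeta>
    unfolding H_def
  proof (intro norm_triangle_mono)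
    show "norm (cis (- ((t - 1) * \<zeta>\<^sup>2)) * fourier (u 1) \<zeta>) \<le> (LINT y|lborel. norm (u 1 y))"
      using norm_fourier_le[OF u_integrable, of 1 \<zeta>] by (simp add: norm_mult)
    show "norm (\<i> * (LINT s|lborel. E s \<zeta>)) \<le> (LINT s|lborel. indicator {1..t} s * B)"
      using norm_integral_le[OF w AE_I2[OF E_le]] by (simp add: norm_mult)
  qed
  have nonlin_eq: "(\<lambda>x. - of_real \<beta> * cubic (u s) x + quintic W \<gamma> s (u s) x) = nonlinearity \<beta> s" for s
    by (simp add: nonlinearity_def)
  have eq: "AE y in lborel. u t y = (1 / (2 * pi)) *\<^sub>R (LINT \<zeta>|lborel. cis (\<zeta> * y) * H \<zeta>)"
    using mild[unfolded mild_solution_def nonlin_eq, rule_format, OF t]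
  proof eventually_elim
    case (elim y)
    have E_y: "integrable (lborel \<Otimes>\<^sub>M lborel) (\<lambda>(s, \<zeta>). cis (\<zeta> * y) * E s \<zeta>)"
      using integrable_cis_mult[OF E_int, of "\<lambda>p. snd p * y"] by (simp add: split_beta')
    have "(LINT s:{1..t}|lborel. free_propagator (t - s) (nonlinearity \<beta> s) y)
        = (LINT s|lborel. (1 / (2 * pi)) *\<^sub>R (LINT \<zeta>|lborel. cis (\<zeta> * y) * E s \<zeta>))"
      unfolding set_lebesgue_integral_def
      by (intro Bochner_Integration.integral_cong) (auto simp: free_propagator_def E_def indicator_def)
    also have "\<dots> = (1 / (2 * pi)) *\<^sub>R (LINT s|lborel. LINT \<zeta>|lborel. cis (\<zeta> * y) * E s \<zeta>)"
      by (rule integral_scaleR_right)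
    also have "(LINT s|lborel. LINT \<zeta>|lborel. cis (\<zeta> * y) * E s \<zeta>)
        = (LINT \<zeta>|lborel. LINT s|lborel. cis (\<zeta> * y) * E s \<zeta>)"
      by (rule lborel_pair.Fubini_integral[OF E_y, symmetric])
    also have "\<dots> = (LINT \<zeta>|lborel. cis (\<zeta> * y) * (LINT s|lborel. E s \<zeta>))"
      by simp
    finally have N: "(LINT s:{1..t}|lborel. free_propagator (t - s) (nonlinearity \<beta> s) y)
        = (1 / (2 * pi)) *\<^sub>R (LINT \<zeta>|lborel. cis (\<zeta> * y) * (LINT s|lborel. E s \<zeta>))" .
    have "(LINT \<zeta>|lborel. cis (\<zeta> * y) * H \<zeta>)
        = (LINT \<zeta>|lborel. cis (\<zeta> * y) * (cis (- ((t - 1) * \<zeta>\<^sup>2)) * fourier (u 1) \<zeta>)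
            + \<i> * (cis (\<zeta> * y) * (LINT s|lborel. E s \<zeta>)))"
      by (simp add: H_def distrib_left mult_ac)
    also have "\<dots> = (LINT \<zeta>|lborel. cis (\<zeta> * y) * (cis (- ((t - 1) * \<zeta>\<^sup>2)) * fourier (u 1) \<zeta>))
            + (LINT \<zeta>|lborel. \<i> * (cis (\<zeta> * y) * (LINT s|lborel. E s \<zeta>)))"
      by (intro Bochner_Integration.integral_add integrable_mult_right integrable_cis_mult[OF H1] integrable_cis_mult[OF I_int]) auto
    also have "(LINT \<zeta>|lborel. \<i> * (cis (\<zeta> * y) * (LINT s|lborel. E s \<zeta>)))
        = \<i> * (LINT \<zeta>|lborel. cis (\<zeta> * y) * (LINT s|lborel. E s \<zeta>))"
      by (rule integral_mult_right_zero)
    finally show ?case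
      unfolding elim N by (simp add: free_propagator_def scaleR_add_right)
  qed
  have "fourier (u t) \<zeta> = H \<zeta>"
    by (rule fourier_inversion[OF u_integrable[OF t] H_int H_cont H_bound eq])
  then have "cis (t * \<zeta>\<^sup>2) * fourier (u t) \<zeta>
      = cis (t * \<zeta>\<^sup>2) * (cis (- ((t - 1) * \<zeta>\<^sup>2)) * fourier (u 1) \<zeta>) + \<i> * (cis (t * \<zeta>\<^sup>2) * (LINT s|lborel. E s \<zeta>))"
    by (simp add: H_def distrib_left mult_ac)
  also have "cis (t * \<zeta>\<^sup>2) * (cis (- ((t - 1) * \<zeta>\<^sup>2)) * fourier (u 1) \<zeta>) = cis (\<zeta>\<^sup>2) * fourier (u 1) \<zeta>"
    by (simp add: mult.assoc[symmetric] cis_mult left_diff_distrib)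
  also have "cis (t * \<zeta>\<^sup>2) * (LINT s|lborel. E s \<zeta>)
      = (LINT s|lborel. cis (t * \<zeta>\<^sup>2) * E s \<zeta>)"
    by (rule integral_mult_right_zero[symmetric])
  also have "(\<lambda>s. cis (t * \<zeta>\<^sup>2) * E s \<zeta>) = (\<lambda>s. indicator {1..t} s *\<^sub>R (cis (s * \<zeta>\<^sup>2) * fourier (nonlinearity \<beta> s) \<zeta>))"
  proof
    fix s
    have "cis (t * \<zeta>\<^sup>2) * cis (- ((t - s) * \<zeta>\<^sup>2)) = cis (s * \<zeta>\<^sup>2)"
      by (simp add: cis_mult left_diff_distrib)
    then show "cis (t * \<zeta>\<^sup>2) * E s \<zeta> = indicator {1..t} s *\<^sub>R (cis (s * \<zeta>\<^sup>2) * fourier (nonlinearity \<beta> s) \<zeta>)"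
      unfolding E_def by (metis mult.assoc mult_scaleR_right)
  qed
  finally show ?thesis .
qed

text \<open>
  The cubic part of Duhamel's formula is what the profile subtracts, so only the quintic part remains.
\<close>

lemma profile_eq:
  assumes t: "t \<ge> 1"
  shows "profile \<beta> u t \<zeta> = cis (\<zeta>\<^sup>2) * fourier (u 1) \<zeta>
    + \<i> * (LINT s|lborel. indicator {1..t} s *\<^sub>R (cis (s * \<zeta>\<^sup>2) * fourier (quintic W \<gamma> s (u s)) \<zeta>))"
proof -
  let ?c = "\<lambda>s. indicator {1..t} s *\<^sub>R (cis (s * \<zeta>\<^sup>2) * fourier (cubic (u s)) \<zeta>)"
  let ?q = "\<lambda>s. indicator {1..t} s *\<^sub>R (cis (s * \<zeta>\<^sup>2) * fourier (quintic W \<gamma> s (u s)) \<zeta>)"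
  have "integrable lborel (\<lambda>s. indicator {1..t} s *\<^sub>R (cis (s * \<zeta>\<^sup>2) * fourier (q s) \<zeta>))"
    if "L1_continuous_on {1..} q" for q
    by (rule borel_integrable_compact)
       (auto intro!: continuous_intros continuous_on_subset[OF fourier_continuous_in_time[OF that]])
  then have int: "integrable lborel ?c" "integrable lborel ?q"
    using cubic_L1_continuous quintic_L1_continuous by auto
  have "(LINT s|lborel. indicator {1..t} s *\<^sub>R (cis (s * \<zeta>\<^sup>2) * fourier (nonlinearity \<beta> s) \<zeta>))
      = (LINT s|lborel. - of_real \<beta> * ?c s + ?q s)"
    by (intro Bochner_Integration.integral_cong) (auto simp: fourier_nonlinearity indicator_def algebra_simps)
  also have "\<dots> = - of_real \<beta> * (LINT s|lborel. ?c s) + (LINT s|lborel. ?q s)"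
    unfolding Bochner_Integration.integral_add[OF integrable_mult_right[OF int(1)] int(2)]
      integral_mult_right_zero ..
  finally have eq: "(LINT s|lborel. indicator {1..t} s *\<^sub>R (cis (s * \<zeta>\<^sup>2) * fourier (nonlinearity \<beta> s) \<zeta>))
      = - of_real \<beta> * (LINT s|lborel. ?c s) + (LINT s|lborel. ?q s)" .
  show ?thesis
    unfolding profile_def Duhamel_fourier[OF t] set_lebesgue_integral_def eq by (simp add: algebra_simps)
qed

end

section \<open>The limit of the profile\<close>

context decaying_solution
begin

definition tail :: "real \<Rightarrow> real \<Rightarrow> complex" where
  "tail T \<zeta> = (LINT s|lborel. indicator {T..} s *\<^sub>R (cis (s * \<zeta>\<^sup>2) * fourier (quintic W \<gamma> s (u s)) \<zeta>))"

definition amplitude :: real where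
  "amplitude = w\<^sub>0 * pi * a ^ 5"

lemma amplitude_nonneg: "0 \<le> amplitude"
  using w0_nonneg a_nonneg by (simp add: amplitude_def)

lemma tail_integrand_measurable:
  assumes T: "T \<ge> 1"
  shows "(\<lambda>(s, \<zeta>). indicator {T..} s *\<^sub>R (cis (s * \<zeta>\<^sup>2) * fourier (quintic W \<gamma> s (u s)) \<zeta>))
    \<in> borel_measurable (lborel \<Otimes>\<^sub>M lborel)"
proof (rule borel_measurable_indicator_strip)
  have "continuous_on ({T..} \<times> UNIV) (\<lambda>p. cis (fst p * (snd p)\<^sup>2) * (\<lambda>(s, \<zeta>). fourier (quintic W \<gamma> s (u s)) \<zeta>) p)"
    using T by (intro continuous_intros continuous_on_subset[OF fourier_jointly_continuous[OF quintic_L1_continuous]]) auto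
  then show "continuous_on ({T..} \<times> UNIV) (\<lambda>(s, \<zeta>). cis (s * \<zeta>\<^sup>2) * fourier (quintic W \<gamma> s (u s)) \<zeta>)"
    by (simp add: split_beta')
qed simp

lemma tail_bounds:
  assumes T: "T \<ge> 1"
  shows "integrable lborel (\<lambda>s. indicator {T..} s *\<^sub>R (cis (s * \<zeta>\<^sup>2) * fourier (quintic W \<gamma> s (u s)) \<zeta>))"
    and "norm (tail T \<zeta>) \<le> 2 / 3 * amplitude * T powr (- 3 / 2)"
    and "tail T \<in> L2"
    and "(LINT \<zeta>|lborel. (norm (tail T \<zeta>))\<^sup>2) \<le> 112 / 9 * amplitude\<^sup>2 * T powr (- 7 / 2)"
proof -
  have q: "integrable lborel (quintic W \<gamma> s (u s))"
    and qA: "(LINT y|lborel. norm (quintic W \<gamma> s (u s) y)) \<le> amplitude * s powr (- 5 / 2)" if "s \<ge> T" for s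
    using quintic_integrable[of s] quintic_L1[of s] that T by (auto simp: amplitude_def)
  note * = oscillatory_tail_L2[OF T amplitude_nonneg q qA tail_integrand_measurable[OF T], folded tail_def]
  show "integrable lborel (\<lambda>s. indicator {T..} s *\<^sub>R (cis (s * \<zeta>\<^sup>2) * fourier (quintic W \<gamma> s (u s)) \<zeta>))"
    and "norm (tail T \<zeta>) \<le> 2 / 3 * amplitude * T powr (- 3 / 2)"
    and "tail T \<in> L2"
    and "(LINT \<zeta>|lborel. (norm (tail T \<zeta>))\<^sup>2) \<le> 112 / 9 * amplitude\<^sup>2 * T powr (- 7 / 2)"
    by (rule *; assumption)+
qed

definition limit_profile :: "real \<Rightarrow> complex" where
  "limit_profile \<zeta> = cis (\<zeta>\<^sup>2) * fourier (u 1) \<zeta> + \<i> * tail 1 \<zeta>"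

text \<open>The identity for the tail holds by construction once the integral over time is split at \<open>T\<close>.\<close>

lemma limit_profile_minus_profile:
  assumes T: "T \<ge> 1"
  shows "limit_profile \<zeta> - profile \<beta> u T \<zeta> = \<i> * tail T \<zeta>"
proof -
  let ?g = "\<lambda>s. cis (s * \<zeta>\<^sup>2) * fourier (quintic W \<gamma> s (u s)) \<zeta>"
  have i1: "integrable lborel (\<lambda>s. indicator {1..} s *\<^sub>R ?g s)" and iT: "integrable lborel (\<lambda>s. indicator {T..} s *\<^sub>R ?g s)"
    using tail_bounds(1) T by auto
  have "tail 1 \<zeta> - tail T \<zeta> = (LINT s|lborel. indicator {1..} s *\<^sub>R ?g s - indicator {T..} s *\<^sub>R ?g s)"
    unfolding tail_def using i1 iT by simp
  also have "\<dots> = (LINT s|lborel. indicator {1..T} s *\<^sub>R ?g s)"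
  proof (rule integral_cong_AE)
    show m: "(\<lambda>s. indicator {1..} s *\<^sub>R ?g s - indicator {T..} s *\<^sub>R ?g s) \<in> borel_measurable lborel"
      using i1 iT by auto
    have "integrable lborel (\<lambda>s. indicator {1..T} s *\<^sub>R ?g s)"
      by (rule borel_integrable_compact)
         (auto intro!: continuous_intros continuous_on_subset[OF fourier_continuous_in_time[OF quintic_L1_continuous]])
    then show "(\<lambda>s. indicator {1..T} s *\<^sub>R ?g s) \<in> borel_measurable lborel"
      by auto
    show "AE s in lborel. indicator {1..} s *\<^sub>R ?g s - indicator {T..} s *\<^sub>R ?g s = indicator {1..T} s *\<^sub>R ?g s"
      using AE_lborel_singleton[of T] by eventually_elim (use T in \<open>auto simp: indicator_def\<close>)
  qed
  finally have "(LINT s|lborel. indicator {1..T} s *\<^sub>R ?g s) = tail 1 \<zeta> - tail T \<zeta>" ..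
  then show ?thesis
    unfolding profile_eq[OF T] limit_profile_def by (simp add: right_diff_distrib)
qed

lemma norm_tail_integrand_le:
  "norm (indicator {1..} s *\<^sub>R (cis (s * \<zeta>\<^sup>2) * fourier (quintic W \<gamma> s (u s)) \<zeta>))
    \<le> amplitude * (indicator {1..} s * s powr (- 5 / 2))"
proof (cases "s \<ge> 1")
  case True
  have "norm (fourier (quintic W \<gamma> s (u s)) \<zeta>) \<le> amplitude * s powr (- 5 / 2)"
    using norm_fourier_le[OF quintic_integrable[OF True]] quintic_L1[OF True] unfolding amplitude_def
    by (rule order_trans)
  then show ?thesis
    using True by (simp add: norm_mult)
qed simp

lemma tail_continuous: "continuous_on UNIV (tail 1)"
  unfolding tail_def
proof (rule continuous_on_dominated_integral[OF _ norm_tail_integrand_le integrable_mult_right[OF power_tail_integral(1)[of 1]]])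
  show "continuous_on UNIV (\<lambda>\<zeta>. indicator {1..} s *\<^sub>R (cis (s * \<zeta>\<^sup>2) * fourier (quintic W \<gamma> s (u s)) \<zeta>))" for s
  proof (cases "s \<ge> 1")
    case True
    then show ?thesis
      by (intro continuous_intros fourier_continuous quintic_integrable)
  qed simp
  show "(\<lambda>s. indicator {1..} s *\<^sub>R (cis (s * \<zeta>\<^sup>2) * fourier (quintic W \<gamma> s (u s)) \<zeta>)) \<in> borel_measurable lborel" for \<zeta>
    using tail_bounds(1)[of 1 \<zeta>] by auto
qed simp

lemma fourier_u_vanishes:
  assumes "s \<ge> 1"
  shows "(fourier (u s) \<longlongrightarrow> 0) at_infinity"
  by (rule Riemann_Lebesgue[OF u_integrable[OF assms] Sigma_space_bounds(3)[OF u_Sigma[OF assms]]])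

lemma fourier_quintic_vanishes:
  assumes s: "s \<ge> 1"
  shows "(fourier (quintic W \<gamma> s (u s)) \<longlongrightarrow> 0) at_infinity"
proof -
  have eq: "nonlinearity 0 s = quintic W \<gamma> s (u s)"
    by (simp add: nonlinearity_def)
  show ?thesis
    using nonlinearity_Lipschitz[OF s Sigma_space_bounds(3)[OF u_Sigma[OF s]], of 0] unfolding eq
    by (rule Riemann_Lebesgue[OF quintic_integrable[OF s]])
qed

text \<open>Dominated convergence in time, with the Riemann--Lebesgue lemma at each time.\<close>

lemma tail_vanishes: "(tail 1 \<longlongrightarrow> 0) at_infinity"
proof -
  have lim: "((\<lambda>x. tail 1 (f x)) \<longlongrightarrow> 0) at_top" if f: "filterlim f at_infinity at_top" for f :: "real \<Rightarrow> real"
  proof -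
    let ?G = "\<lambda>x s. indicator {1..} s *\<^sub>R (cis (s * (f x)\<^sup>2) * fourier (quintic W \<gamma> s (u s)) (f x))"
    have "((\<lambda>x. LINT s|lborel. ?G x s) \<longlongrightarrow> (LINT s|(lborel :: real measure). 0)) at_top"
    proof (rule integral_dominated_convergence_at_top)
      have "((\<lambda>x. ?G x s) \<longlongrightarrow> 0) at_top" for s
      proof (cases "s \<ge> 1")
        case True
        have "((\<lambda>x. fourier (quintic W \<gamma> s (u s)) (f x)) \<longlongrightarrow> 0) at_top"
          by (rule filterlim_compose[OF fourier_quintic_vanishes[OF True] f])
        then have "((\<lambda>x. norm (fourier (quintic W \<gamma> s (u s)) (f x))) \<longlongrightarrow> 0) at_top"
          by (rule tendsto_norm_zero)
        then have "((\<lambda>x. norm (?G x s)) \<longlongrightarrow> 0) at_top"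
          using True by (simp add: norm_mult)
        then show ?thesis
          by (rule tendsto_norm_zero_cancel)
      qed simp
      then show "AE s in lborel. ((\<lambda>x. ?G x s) \<longlongrightarrow> 0) at_top"
        by simp
      show "integrable lborel (\<lambda>s. amplitude * (indicator {1..} s * s powr (- 5 / 2)))"
        by (intro integrable_mult_right power_tail_integral(1)) simp
      show "\<forall>\<^sub>F x in at_top. AE s in lborel. norm (?G x s) \<le> amplitude * (indicator {1..} s * s powr (- 5 / 2))"
        by (intro always_eventually allI AE_I2 norm_tail_integrand_le)
      show "?G x \<in> borel_measurable lborel" for x
        using tail_bounds(1)[of 1 "f x"] by auto
    qed simp
    then show ?thesis
      by (simp add: tail_def)
  qed
  have "(tail 1 \<longlongrightarrow> 0) at_top"
    using lim[of "\<lambda>x. x"] filterlim_at_top_imp_at_infinity[OF filterlim_ident] by simp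
  moreover have "filterlim (\<lambda>x :: real. - x) at_infinity at_top"
    by (rule filterlim_at_bot_imp_at_infinity[OF filterlim_uminus_at_bot_at_top])
  then have "(tail 1 \<longlongrightarrow> 0) at_bot"
    unfolding filterlim_at_bot_mirror by (rule lim)
  ultimately show ?thesis
    unfolding at_infinity_eq_at_top_bot by (rule filterlim_sup)
qed

lemma limit_profile_C0: "limit_profile \<in> C0"
proof -
  have "continuous_on UNIV limit_profile"
    unfolding limit_profile_def[abs_def]
    by (intro continuous_intros fourier_continuous tail_continuous u_integrable) simp
  moreover have "(limit_profile \<longlongrightarrow> 0) at_infinity"
  proof (rule Lim_null_comparison)
    have "((\<lambda>\<zeta>. norm (fourier (u 1) \<zeta>) + norm (tail 1 \<zeta>)) \<longlongrightarrow> norm (0 :: complex) + norm (0 :: complex)) at_infinity"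
      by (intro tendsto_intros fourier_u_vanishes tail_vanishes) simp
    then show "((\<lambda>\<zeta>. norm (fourier (u 1) \<zeta>) + norm (tail 1 \<zeta>)) \<longlongrightarrow> 0) at_infinity"
      by simp
    show "\<forall>\<^sub>F \<zeta> in at_infinity. norm (limit_profile \<zeta>) \<le> norm (fourier (u 1) \<zeta>) + norm (tail 1 \<zeta>)"
      unfolding limit_profile_def
      by (intro always_eventually allI order_trans[OF norm_triangle_ineq]) (simp add: norm_mult)
  qed
  ultimately show ?thesis
    by (simp add: C0_def)
qed

lemma limit_profile_L2: "limit_profile \<in> L2"
  unfolding limit_profile_def[abs_def]
proof (rule L2_add(1))
  have F: "fourier (u 1) \<in> L2"
    by (rule fourier_Bessel(1)[OF u_integrable u_L2]) simp_all
  have [measurable]: "fourier (u 1) \<in> borel_measurable borel"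
    using F by auto
  show "(\<lambda>\<zeta>. cis (\<zeta>\<^sup>2) * fourier (u 1) \<zeta>) \<in> L2"
    using L2_integrable[OF F] by (simp add: L2_def norm_mult)
  show "(\<lambda>\<zeta>. \<i> * tail 1 \<zeta>) \<in> L2"
    using tail_bounds(3)[of 1] by (intro L2_mult_left) simp
qed

lemma tail_L2_norm:
  assumes T: "T \<ge> 1"
  shows "(\<lambda>\<zeta>. \<i> * tail T \<zeta>) \<in> L2"
    and "L2_norm (\<lambda>\<zeta>. \<i> * tail T \<zeta>) \<le> 4 * amplitude * T powr (- 7 / 4)"
proof -
  show "(\<lambda>\<zeta>. \<i> * tail T \<zeta>) \<in> L2"
    by (rule L2_mult_left[OF tail_bounds(3)[OF T]])
  have "(T powr (- 7 / 4))\<^sup>2 = T powr (- 7 / 2)"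
    using T by (simp add: powr_power)
  then have "(4 * amplitude * T powr (- 7 / 4))\<^sup>2 = 16 * amplitude\<^sup>2 * T powr (- 7 / 2)"
    by (simp only: power_mult_distrib) simp
  moreover have "112 / 9 * (amplitude\<^sup>2 * T powr (- 7 / 2)) \<le> 16 * (amplitude\<^sup>2 * T powr (- 7 / 2))"
    by (intro mult_right_mono) auto
  ultimately have "(LINT \<zeta>|lborel. (norm (\<i> * tail T \<zeta>))\<^sup>2) \<le> (4 * amplitude * T powr (- 7 / 4))\<^sup>2"
    using tail_bounds(4)[OF T] unfolding norm_mult norm_ii mult_1 mult.assoc by linarith
  then show "L2_norm (\<lambda>\<zeta>. \<i> * tail T \<zeta>) \<le> 4 * amplitude * T powr (- 7 / 4)"
    unfolding L2_norm_def using amplitude_nonneg by (intro real_le_lsqrt) auto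
qed

lemma profile_tendsto_limit_profile: "profile_limit \<beta> u limit_profile"
  unfolding profile_limit_def
proof (intro conjI IntI limit_profile_L2 limit_profile_C0)
  have neg: "profile \<beta> u t \<zeta> - limit_profile \<zeta> = - (\<i> * tail t \<zeta>)" if "t \<ge> 1" for t \<zeta>
    using limit_profile_minus_profile[OF that, of \<zeta>] by (simp add: algebra_simps)
  have ev: "\<forall>\<^sub>F t :: real in at_top. t \<ge> 1"
    by (rule eventually_ge_at_top)
  have powr0: "((\<lambda>t. c * t powr (- q)) \<longlongrightarrow> 0) at_top" if "q > 0" for c q :: real
  proof -
    have "((\<lambda>t. c * t powr (- q)) \<longlongrightarrow> c * 0) at_top"
      using that by (intro tendsto_intros tendsto_neg_powr filterlim_ident) auto
    then show ?thesis
      by simp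
  qed
  show "L2_tendsto (profile \<beta> u) limit_profile at_top"
    unfolding L2_tendsto_def
  proof
    show "\<forall>\<^sub>F t in at_top. (\<lambda>x. profile \<beta> u t x - limit_profile x) \<in> L2"
      using ev by eventually_elim (use neg L2_uminus[OF tail_L2_norm(1)] in simp)
    show "((\<lambda>t. L2_norm (\<lambda>x. profile \<beta> u t x - limit_profile x)) \<longlongrightarrow> 0) at_top"
    proof (rule Lim_null_comparison[OF _ powr0[of "7 / 4" "4 * amplitude"]])
      show "\<forall>\<^sub>F t in at_top. norm (L2_norm (\<lambda>x. profile \<beta> u t x - limit_profile x)) \<le> 4 * amplitude * t powr (- (7 / 4))"
        using ev
      proof eventually_elim
        case (elim t)
        have "L2_norm (\<lambda>x. profile \<beta> u t x - limit_profile x) = L2_norm (\<lambda>x. \<i> * tail t x)"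
          using neg[OF elim] by (simp add: L2_norm_def)
        then show ?case
          using tail_L2_norm(2)[OF elim] by simp
      qed
    qed simp
  qed
  show "uniform_limit UNIV (profile \<beta> u) limit_profile at_top"
  proof (rule uniform_limitI)
    fix e :: real assume "e > 0"
    then have "\<forall>\<^sub>F t in at_top. 2 / 3 * amplitude * t powr (- (3 / 2)) < e"
      using powr0[of "3 / 2" "2 / 3 * amplitude"] by (intro order_tendstoD(2)) auto
    with ev show "\<forall>\<^sub>F t in at_top. \<forall>\<zeta>\<in>UNIV. dist (profile \<beta> u t \<zeta>) (limit_profile \<zeta>) < e"
    proof eventually_elim
      case (elim t)
      show ?case
      proof
        fix \<zeta>
        have "dist (profile \<beta> u t \<zeta>) (limit_profile \<zeta>) = norm (tail t \<zeta>)"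
          using neg[OF elim(1), of \<zeta>] by (simp add: dist_norm norm_mult)
        then show "dist (profile \<beta> u t \<zeta>) (limit_profile \<zeta>) < e"
          using tail_bounds(2)[OF elim(1), of \<zeta>] elim(2) by simp
      qed
    qed
  qed
qed

lemma profile_limit_unique:
  assumes "profile_limit \<beta> u P"
  shows "P = limit_profile"
proof
  fix \<zeta>
  have "((\<lambda>t. profile \<beta> u t \<zeta>) \<longlongrightarrow> P \<zeta>) at_top" "((\<lambda>t. profile \<beta> u t \<zeta>) \<longlongrightarrow> limit_profile \<zeta>) at_top"
    using assms profile_tendsto_limit_profile
    by (auto simp: profile_limit_def intro: tendsto_uniform_limitI)
  then show "P \<zeta> = limit_profile \<zeta>"
    by (intro tendsto_unique[of at_top "\<lambda>t. profile \<beta> u t \<zeta>"]) auto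
qed

lemma limit_profile_rates:
  assumes T: "T \<ge> 1" and K: "4 * amplitude \<le> K"
  shows "(\<lambda>\<zeta>. limit_profile \<zeta> - profile \<beta> u T \<zeta>) \<in> L2"
    and "L2_norm (\<lambda>\<zeta>. limit_profile \<zeta> - profile \<beta> u T \<zeta>) \<le> K * T powr (- 7 / 4)"
    and "Linf_norm (\<lambda>\<zeta>. limit_profile \<zeta> - profile \<beta> u T \<zeta>) \<le> ereal (K * T powr (- 3 / 2))"
    and "set_integrable lborel {T..} (\<lambda>s. cis (s * \<zeta>\<^sup>2) * fourier (quintic W \<gamma> s (u s)) \<zeta>)"
    and "limit_profile \<zeta> - profile \<beta> u T \<zeta> =
      \<i> * (LINT s:{T..}|lborel. cis (s * \<zeta>\<^sup>2) * fourier (quintic W \<gamma> s (u s)) \<zeta>)"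
proof -
  note eq = limit_profile_minus_profile[OF T]
  show "(\<lambda>\<zeta>. limit_profile \<zeta> - profile \<beta> u T \<zeta>) \<in> L2"
    unfolding eq by (rule tail_L2_norm(1)[OF T])
  have "4 * amplitude * T powr (- 7 / 4) \<le> K * T powr (- 7 / 4)"
    using K by (intro mult_right_mono) auto
  then show "L2_norm (\<lambda>\<zeta>. limit_profile \<zeta> - profile \<beta> u T \<zeta>) \<le> K * T powr (- 7 / 4)"
    unfolding eq using tail_L2_norm(2)[OF T] by linarith
  have le: "norm (\<i> * tail T \<zeta>) \<le> K * T powr (- 3 / 2)" for \<zeta>
  proof -
    have "2 / 3 * amplitude * T powr (- 3 / 2) \<le> K * T powr (- 3 / 2)"
      using K amplitude_nonneg by (intro mult_right_mono) auto
    then show ?thesis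
      using tail_bounds(2)[OF T, of \<zeta>] by (simp add: norm_mult)
  qed
  have [measurable]: "tail T \<in> borel_measurable borel"
    using tail_bounds(3)[OF T] by auto
  show "Linf_norm (\<lambda>\<zeta>. limit_profile \<zeta> - profile \<beta> u T \<zeta>) \<le> ereal (K * T powr (- 3 / 2))"
    unfolding eq Linf_norm_def using le by (intro esssup_I AE_I2) auto
  show "set_integrable lborel {T..} (\<lambda>s. cis (s * \<zeta>\<^sup>2) * fourier (quintic W \<gamma> s (u s)) \<zeta>)"
    using tail_bounds(1)[OF T] by (simp add: set_integrable_def)
  show "limit_profile \<zeta> - profile \<beta> u T \<zeta> =
      \<i> * (LINT s:{T..}|lborel. cis (s * \<zeta>\<^sup>2) * fourier (quintic W \<gamma> s (u s)) \<zeta>)"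
    unfolding eq by (simp add: tail_def set_lebesgue_integral_def)
qed

end

section \<open>Small-data solutions\<close>

lemma admissible_potential_bounds:
  assumes "admissible_potential W"
  obtains w\<^sub>0 L where "w\<^sub>0 > 0" and "\<And>x. \<bar>W x\<bar> \<le> w\<^sub>0 * (1 / (1 + x\<^sup>2))" and "\<And>x y. \<bar>W x - W y\<bar> \<le> L * \<bar>x - y\<bar>"
proof -
  obtain p where W: "smooth W" and p: "p > 2"
    and bd: "\<And>j. \<exists>c>0. \<forall>x. \<bar>(deriv ^^ j) W x\<bar> \<le> c * japanese x powr (- p - real j)"
    using assms unfolding admissible_potential_def by blast
  have jap: "japanese x \<ge> 1" for x
    by (simp add: japanese_def)
  obtain c\<^sub>0 where c\<^sub>0: "c\<^sub>0 > 0" "\<And>x. \<bar>W x\<bar> \<le> c\<^sub>0 * japanese x powr (- p)"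
    using bd[of 0] by auto
  obtain c\<^sub>1 where c\<^sub>1: "c\<^sub>1 > 0" "\<And>x. \<bar>deriv W x\<bar> \<le> c\<^sub>1 * japanese x powr (- p - 1)"
    using bd[of 1] by auto
  show ?thesis
  proof (rule that[of c\<^sub>0 c\<^sub>1])
    fix x
    have "japanese x powr (- p) \<le> japanese x powr (- 2)"
      using jap[of x] p by (intro powr_mono) auto
    also have "\<dots> = 1 / (1 + x\<^sup>2)"
      using jap[of x] by (simp add: powr_minus_divide japanese_def)
    finally have "c\<^sub>0 * japanese x powr (- p) \<le> c\<^sub>0 * (1 / (1 + x\<^sup>2))"
      using c\<^sub>0(1) by (intro mult_left_mono) auto
    then show "\<bar>W x\<bar> \<le> c\<^sub>0 * (1 / (1 + x\<^sup>2))"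
      using c\<^sub>0(2)[of x] by linarith
  next
    fix x y
    have "norm (W x - W y) \<le> c\<^sub>1 * norm (x - y)"
    proof (rule field_differentiable_bound[of UNIV W "deriv W"])
      fix z
      have "japanese z powr (- p - 1) \<le> japanese z powr 0"
        using jap[of z] p by (intro powr_mono) auto
      then have "c\<^sub>1 * japanese z powr (- p - 1) \<le> c\<^sub>1 * 1"
        using jap[of z] c\<^sub>1(1) by (intro mult_left_mono) auto
      then show "norm (deriv W z) \<le> c\<^sub>1"
        using c\<^sub>1(2)[of z] by simp
      show "(W has_field_derivative deriv W z) (at z within UNIV)"
        using smooth_DERIV[OF W] by simp
    qed auto
    then show "\<bar>W x - W y\<bar> \<le> c\<^sub>1 * \<bar>x - y\<bar>"
      by simp
  qed (rule c\<^sub>0)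
qed

text \<open>Uniqueness in the threshold transfers the decay estimate from the solution whose existence it
  asserts to any other one with the same data.\<close>

lemma small_data_decay:
  assumes thr: "small_data_threshold \<beta> W \<epsilon>\<^sub>0 C"
    and \<epsilon>: "0 < \<epsilon>" "\<epsilon> \<le> \<epsilon>\<^sub>0"
    and u: "global_solution \<beta> \<gamma> W u" "Sigma_norm (u 1) \<le> \<epsilon>" and t: "t \<ge> 1"
  shows "AE y in lborel. norm (u t y) \<le> C * \<epsilon> * t powr (- 1 / 2)"
proof -
  have "u 1 \<in> Sigma_space"
    using u(1) by (simp add: global_solution_def C_Sigma_def)
  then have data: "0 < \<epsilon> \<and> \<epsilon> \<le> \<epsilon>\<^sub>0 \<and> u 1 \<in> Sigma_space \<and> Sigma_norm (u 1) \<le> \<epsilon>"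
    using \<epsilon> u(2) by blast
  obtain v where v: "\<forall>t\<ge>1. Linf_norm (v t) \<le> ereal (C * \<epsilon> * t powr (- 1 / 2))"
    and unique: "\<forall>w. global_solution \<beta> \<gamma> W w \<and> (AE y in lborel. w 1 y = u 1 y) \<longrightarrow>
      (\<forall>t\<ge>1. AE y in lborel. w t y = v t y)"
    using thr[unfolded small_data_threshold_def, THEN conjunct2, THEN conjunct2,
        THEN spec[of _ \<gamma>], THEN spec[of _ \<epsilon>], THEN spec[of _ "u 1"], THEN mp, OF data]
    by (elim exE conjE)
  have "AE y in lborel. ereal (norm (v t y)) \<le> Linf_norm (v t)"
    unfolding Linf_norm_def by (rule esssup_AE)
  moreover have "AE y in lborel. u t y = v t y"
    using unique[THEN spec[of _ u]] u(1) t by simp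
  ultimately show ?thesis
  proof eventually_elim
    case (elim y)
    then show ?case
      using order_trans[OF elim(1) v[rule_format, OF t]] by simp
  qed
qed

theorem proposition4p2:
  fixes \<beta> :: real and W :: "real \<Rightarrow> real" and \<epsilon>\<^sub>0 C :: real
  assumes "admissible_potential W"
    and "small_data_threshold \<beta> W \<epsilon>\<^sub>0 C"
  shows "\<exists>K>0. \<forall>(\<gamma>::real) (\<epsilon>::real) (u :: real \<Rightarrow> real \<Rightarrow> complex).
           0 < \<epsilon> \<and> \<epsilon> \<le> \<epsilon>\<^sub>0 \<and> global_solution \<beta> \<gamma> W u \<and> Sigma_norm (u 1) \<le> \<epsilon> \<longrightarrow>
           (\<exists>!P. profile_limit \<beta> u P) \<and>
           (\<forall>P. profile_limit \<beta> u P \<longrightarrow>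
              (\<forall>T\<ge>1.
                 (\<lambda>\<zeta>. P \<zeta> - profile \<beta> u T \<zeta>) \<in> L2 \<and>
                 L2_norm (\<lambda>\<zeta>. P \<zeta> - profile \<beta> u T \<zeta>) \<le> K * \<epsilon> ^ 5 * T powr (- 7 / 4) \<and>
                 Linf_norm (\<lambda>\<zeta>. P \<zeta> - profile \<beta> u T \<zeta>) \<le> ereal (K * \<epsilon> ^ 5 * T powr (- 3 / 2)) \<and>
                 (\<forall>\<zeta>. set_integrable lborel {T..}
                         (\<lambda>s. cis (s * \<zeta>\<^sup>2) * fourier (quintic W \<gamma> s (u s)) \<zeta>) \<and>
                       P \<zeta> - profile \<beta> u T \<zeta> =
                         \<i> * (LINT s:{T..}|lborel.
                                cis (s * \<zeta>\<^sup>2) * fourier (quintic W \<gamma> s (u s)) \<zeta>))))"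
proof -
  obtain w\<^sub>0 L where w\<^sub>0: "w\<^sub>0 > 0" "\<And>x. \<bar>W x\<bar> \<le> w\<^sub>0 * (1 / (1 + x\<^sup>2))"
    and L: "\<And>x y. \<bar>W x - W y\<bar> \<le> L * \<bar>x - y\<bar>"
    using admissible_potential_bounds[OF assms(1)] by blast
  have C: "C > 0"
    using assms(2) by (simp add: small_data_threshold_def)
  define K where "K = 4 * (w\<^sub>0 * pi * C ^ 5)"
  have K_pos: "K > 0"
    using w\<^sub>0(1) C by (simp add: K_def)
  have main: "(\<exists>!P. profile_limit \<beta> u P) \<and>
      (\<forall>P. profile_limit \<beta> u P \<longrightarrow>
        (\<forall>T\<ge>1.
           (\<lambda>\<zeta>. P \<zeta> - profile \<beta> u T \<zeta>) \<in> L2 \<and>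
           L2_norm (\<lambda>\<zeta>. P \<zeta> - profile \<beta> u T \<zeta>) \<le> K * \<epsilon> ^ 5 * T powr (- 7 / 4) \<and>
           Linf_norm (\<lambda>\<zeta>. P \<zeta> - profile \<beta> u T \<zeta>) \<le> ereal (K * \<epsilon> ^ 5 * T powr (- 3 / 2)) \<and>
           (\<forall>\<zeta>. set_integrable lborel {T..}
                   (\<lambda>s. cis (s * \<zeta>\<^sup>2) * fourier (quintic W \<gamma> s (u s)) \<zeta>) \<and>
                 P \<zeta> - profile \<beta> u T \<zeta> =
                   \<i> * (LINT s:{T..}|lborel.
                          cis (s * \<zeta>\<^sup>2) * fourier (quintic W \<gamma> s (u s)) \<zeta>))))"
    if \<epsilon>: "0 < \<epsilon>" "\<epsilon> \<le> \<epsilon>\<^sub>0" and u: "global_solution \<beta> \<gamma> W u" "Sigma_norm (u 1) \<le> \<epsilon>" for \<gamma> \<epsilon> u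
  proof -
    interpret decaying_solution \<beta> \<gamma> W u w\<^sub>0 L "C * \<epsilon>"
      using w\<^sub>0(2) L u(1) small_data_decay[OF assms(2) \<epsilon> u] C \<epsilon>(1)
      by unfold_locales (auto simp: global_solution_def)
    have amp: "4 * amplitude \<le> K * \<epsilon> ^ 5"
      by (simp add: amplitude_def K_def power_mult_distrib)
    show ?thesis
    proof (intro conjI allI impI)
      show "\<exists>!P. profile_limit \<beta> u P"
        using profile_tendsto_limit_profile profile_limit_unique by (rule ex1I)
    next
      fix P T assume "profile_limit \<beta> u P" and T: "1 \<le> (T :: real)"
      from this(1) have P: "P = limit_profile"
        by (rule profile_limit_unique)
      note rates = limit_profile_rates[OF T amp, folded P]
      show "(\<lambda>\<zeta>. P \<zeta> - profile \<beta> u T \<zeta>) \<in> L2"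
        and "L2_norm (\<lambda>\<zeta>. P \<zeta> - profile \<beta> u T \<zeta>) \<le> K * \<epsilon> ^ 5 * T powr (- 7 / 4)"
        and "Linf_norm (\<lambda>\<zeta>. P \<zeta> - profile \<beta> u T \<zeta>) \<le> ereal (K * \<epsilon> ^ 5 * T powr (- 3 / 2))"
        by (rule rates)+
      show "set_integrable lborel {T..} (\<lambda>s. cis (s * \<zeta>\<^sup>2) * fourier (quintic W \<gamma> s (u s)) \<zeta>)"
        and "P \<zeta> - profile \<beta> u T \<zeta> =
          \<i> * (LINT s:{T..}|lborel. cis (s * \<zeta>\<^sup>2) * fourier (quintic W \<gamma> s (u s)) \<zeta>)" for \<zeta>
        by (rule rates)+
    qed
  qed
  show ?thesis
    by (rule exI[of _ K], rule conjI[OF K_pos], rule allI, rule allI, rule allI, rule impI,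
        elim conjE, rule main)
qed

end
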